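(* Suppose that the hierarchical model $X_i\mid\theta_i\sim N(\theta_i,1)$, $\theta_i\mid\xi_i\sim N(\xi_i,c_*^2)$, $\xi_i\overset{iid}{\sim}H^*$ (described in the context) holds for all $i=1,\dots,n$, where $c_*>0$. Let $\hat H_n$ be any maximizer of $\sum_{i=1}^n\log f_H(X_i)$ over $H\in\mathcal P(\mathbb R)$. For any fixed $M\ge\sqrt{10\sigma_*^2\log n}$ and nonempty compact set $S\subseteq\mathbb R$, let $\epsilon_n:=\epsilon_n(M,S,H^* )$. Suppose further that $\epsilon_n=o(1)$. Then $$\mathbb E_{H^*}\big[\mathrm{wTV}(\pi_{\hat H_n},\pi_{H^*})\big]\lesssim_{c_*}\sqrt{M\,\mathrm{Vol}(S^{\sigma_*})}\;\epsilon_n^{\alpha_*}.$$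
   Context: $\mathcal P(\mathbb R)$ is the set of Borel probability measures on $\mathbb R$; $\phi_\sigma$ is the $N(0,\sigma^2)$ density and $\phi=\phi_1$. Model: for $i=1,\dots,n$, $X_i\mid\theta_i\overset{ind}{\sim}N(\theta_i,1)$, $\theta_i\mid\xi_i\overset{ind}{\sim}N(\xi_i,c_*^2)$, $\xi_i\overset{iid}{\sim}H^*\in\mathcal P(\mathbb R)$; only $X_1,\dots,X_n$ are observed, $c_*$ is known, $H^*$ is unknown. $\mathbb E_{H^*},\mathbb P_{H^*}$ denote expectation and probability under this model. Put $\sigma_*^2:=1+c_*^2$ and $\alpha_*:=c_*^2/\sigma_*^2$. For $H\in\mathcal P(\mathbb R)$ let $g_H(\theta):=\int\phi_{c_*}(\theta-\xi)\,dH(\xi)$, $f_H(x):=\int\phi_{\sigma_*}(x-\xi)\,dH(\xi)$, and $\pi_H(\theta\mid x):=\phi(x-\theta)g_H(\theta)/f_H(x)$ (posterior density of $\theta_i$ given $X_i=x$ under $H$). $\mathrm{TV}(f,g)=\frac12\int|f-g|$ and $\mathrm{wTV}(\pi_{\hat H_n},\pi_{H^*}):=\int\mathrm{TV}(\pi_{\hat H_n}(\cdot\mid x),\pi_{H^*}(\cdot\mid x))\,f_{H^*}(x)\,dx$. For nonempty $S\subseteq\mathbb R$, $\mathfrak d_S(x):=\inf_{u\in S}|x-u|$, $S^{\sigma_*}:=\{x:\mathfrak d_S(x)\le\sigma_*\}$, $\mathrm{Vol}$ is Lebesgue measure, and $\mu_p(\mathfrak d_S,H):=\big(\int\mathfrak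 d_S(\xi)^p\,dH(\xi)\big)^{1/p}$ for $p>0$. For $H\in\mathcal P(\mathbb R)$, nonempty compact $S$, and $M\ge\sqrt{10\sigma_*^2\log n}$, $\epsilon_n(M,S,H)\ge0$ is defined by $$\epsilon_n^2(M,S,H):=\mathrm{Vol}(S^{\sigma_*})\frac{M}{n}(\log n)^{3/2}+(\log n)\inf_{p\ge1/\log n}\Big(\frac{2\mu_p(\mathfrak d_S,H)}{M}\Big)^p .$$ Here $M$ and $S$ are deterministic and may depend on $n$; $o(1)$ is as $n\to\infty$. $a\lesssim_{c_*}b$ means $a\le Cb$ for a constant $C>0$ depending only on $c_*$. *)

theory Defs
  imports "HOL-Probability.Probability"
begin

definition borel_probs :: "real measure set" where
  "borel_probs = {H. prob_space H \<and> sets H = sets borel}"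

definition \<sigma>\<^sub>s :: "real \<Rightarrow> real" where
  "\<sigma>\<^sub>s c = sqrt (1 + c\<^sup>2)"

definition \<alpha>\<^sub>s :: "real \<Rightarrow> real" where
  "\<alpha>\<^sub>s c = c\<^sup>2 / (\<sigma>\<^sub>s c)\<^sup>2"

abbreviation \<phi> :: "real \<Rightarrow> real \<Rightarrow> real" where
  "\<phi> \<sigma> \<equiv> normal_density 0 \<sigma>"

text \<open>The second parameter is the standard deviation, not the variance.\<close>

definition normal_law :: "real \<Rightarrow> real \<Rightarrow> real measure" where
  "normal_law \<mu> \<sigma> = density lborel (\<lambda>x. ennreal (normal_density \<mu> \<sigma> x))"

text \<open>The law of the observations \<open>(X 1, \<dots>, X n)\<close>, with the latent \<open>\<xi>\<close> and \<open>\<theta>\<close> integrated out.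
  The product measures express the (conditional) independence over \<open>i\<close> at each level.\<close>

definition hier_model :: "nat \<Rightarrow> real \<Rightarrow> real measure \<Rightarrow> (nat \<Rightarrow> real) measure" where
  "hier_model n c H = do {
     \<xi> \<leftarrow> PiM {1..n} (\<lambda>_. H);
     \<theta> \<leftarrow> PiM {1..n} (\<lambda>i. normal_law (\<xi> i) c);
     PiM {1..n} (\<lambda>i. normal_law (\<theta> i) 1)
   }"

definition g_dens :: "real \<Rightarrow> real measure \<Rightarrow> real \<Rightarrow> real" where
  "g_dens c H \<theta> = (\<integral>\<xi>. \<phi> c (\<theta> - \<xi>) \<partial>H)"

definition f_dens :: "real \<Rightarrow> real measure \<Rightarrow> real \<Rightarrow> real" where
  "f_dens c H x = (\<integral>\<xi>. \<phi> (\<sigma>\<^sub>s c) (x - \<xi>) \<partial>H)"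

definition posterior :: "real \<Rightarrow> real measure \<Rightarrow> real \<Rightarrow> real \<Rightarrow> real" where
  "posterior c H x \<theta> = \<phi> 1 (x - \<theta>) * g_dens c H \<theta> / f_dens c H x"

definition log_lik :: "nat \<Rightarrow> real \<Rightarrow> (nat \<Rightarrow> real) \<Rightarrow> real measure \<Rightarrow> real" where
  "log_lik n c X H = (\<Sum>i=1..n. ln (f_dens c H (X i)))"

definition is_npmle :: "nat \<Rightarrow> real \<Rightarrow> (nat \<Rightarrow> real) \<Rightarrow> real measure \<Rightarrow> bool" where
  "is_npmle n c X = is_arg_max (log_lik n c X) (\<lambda>H. H \<in> borel_probs)"

definition TV :: "(real \<Rightarrow> real) \<Rightarrow> (real \<Rightarrow> real) \<Rightarrow> ennreal" where
  "TV f g = (\<integral>\<^sup>+ x. ennreal \<bar>f x - g x\<bar> \<partial>lborel) / 2"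

definition wTV :: "real \<Rightarrow> real measure \<Rightarrow> real measure \<Rightarrow> ennreal" where
  "wTV c H' H = (\<integral>\<^sup>+ x. TV (posterior c H' x) (posterior c H x) * ennreal (f_dens c H x) \<partial>lborel)"

text \<open>Real powers of extended nonnegative reals, used only for exponents \<open>p > 0\<close>.\<close>

definition epowr :: "ennreal \<Rightarrow> real \<Rightarrow> ennreal" where
  "epowr x p = (if x = \<infinity> then \<infinity> else ennreal (enn2real x powr p))"

definition fatten :: "real \<Rightarrow> real set \<Rightarrow> real set" where
  "fatten r S = {x. infdist x S \<le> r}"

text \<open>The moment may be infinite (heavy-tailed \<open>H\<close>), hence the extended values here and below.\<close>

definition moment :: "real \<Rightarrow> real set \<Rightarrow> real measure \<Rightarrow> ennreal" where
  "moment p S H = epowr (\<integral>\<^sup>+ \<xi>. ennreal (infdist \<xi> S powr p) \<partial>H) (1 / p)"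

definition eps_sq :: "real \<Rightarrow> nat \<Rightarrow> real \<Rightarrow> real set \<Rightarrow> real measure \<Rightarrow> ennreal" where
  "eps_sq c n M S H =
     ennreal (measure lborel (fatten (\<sigma>\<^sub>s c) S) * (M / real n) * ln (real n) powr (3 / 2))
     + ennreal (ln (real n)) * (INF p\<in>{1 / ln (real n)..}. epowr (2 * moment p S H / ennreal M) p)"

definition eps :: "real \<Rightarrow> nat \<Rightarrow> real \<Rightarrow> real set \<Rightarrow> real measure \<Rightarrow> ennreal" where
  "eps c n M S H = epowr (eps_sq c n M S H) (1 / 2)"

end

theory Submission
  imports Defs
begin

text \<open>
Write \<open>f\<^sub>H\<close> and \<open>g\<^sub>H\<close> for the marginal and prior densities, \<open>d\<close> for the distance to \<open>S\<close>, \<open>B\<close> for the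
set where \<open>d \<le> M\<close>, \<open>V\<close> for the volume of the \<open>\<sigma>\<close>-neighbourhood of \<open>S\<close>, and \<open>L = ln n\<close>.

\<^bold>\<open>From posteriors to marginals.\<close> Up to the normalization by the marginal, the posterior is linear in the
prior density, and the marginal is the prior density convolved with \<open>N(0,1)\<close>; hence the weighted total
variation is at most the \<open>L\<^sup>1\<close> distance of the two prior densities (\<open>wTV_le\<close>). On \<open>B\<close>, whose volume is of
order \<open>M V\<close>, this distance is bounded through the \<open>L\<^sup>2\<close> distance, and off \<open>B\<close> by the tail of \<open>g\<^sub>H\<close>, because
both densities have mass one (\<open>L1_mix_split\<close>, \<open>wTV_le_mixL2_plus_tail\<close>). In the frequency domain, the
squared \<open>L\<^sup>2\<close> distances of the prior and of the marginal densities differ only by the weights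
\<open>exp (- c\<^sup>2 t\<^sup>2)\<close> and \<open>exp (- \<sigma>\<^sup>2 t\<^sup>2)\<close>. Cutting at the frequency where the second weight equals the squared
marginal error \<open>W\<close> shows that the squared prior error is of order \<open>W\<close> to the power \<open>c\<^sup>2 / \<sigma>\<^sup>2\<close>
(\<open>mixL2_deconvolution\<close>). This is the source of the exponent in the rate.

\<^bold>\<open>Estimating the marginal.\<close> It remains to see that the maximum likelihood estimator has expected squared
\<open>L\<^sup>2\<close> error of order \<open>\<epsilon>\<^sub>n\<^sup>2\<close> (\<open>npmle_L2_risk\<close>). Divided by a Gaussian, a mixture is a power series whose
coefficients are bounded moments of the mixing measure and which converges so fast that on an interval of
length of order \<open>sqrt L\<close> the first \<open>O(L)\<close> coefficients, rounded to precision \<open>n\<^sup>-\<^sup>3\<close>, determine it up to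
\<open>n\<^sup>-\<^sup>2\<close>. So on \<open>B\<close> all mixtures fall into \<open>N\<close> classes with \<open>ln N\<close> of order \<open>V M L\<^sup>3\<^sup>/\<^sup>2\<close>
(\<open>mixture_entropy\<close>). The estimator has at least the likelihood of the truth, and its density is at most
that of the representative of its class plus a small integrable envelope, times a penalty for observations
off \<open>B\<close>. Since square roots of likelihood ratios have expectation at most the Hellinger affinity
(\<open>affinity_bound\<close>), the error is at most \<open>ln N\<close> plus the expected penalty, divided by \<open>n\<close>. The penalty is
logarithmic in \<open>d\<close>, and \<open>ln y \<le> L y\<^sup>p\<close> for \<open>p \<ge> 1 / L\<close> turns it into the moment term of \<open>\<epsilon>\<^sub>n\<^sup>2\<close>
(\<open>mixture_tail\<close>).
\<close>

section \<open>Gaussian location mixtures\<close>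

definition mix :: "real \<Rightarrow> real measure \<Rightarrow> real \<Rightarrow> real" where
  "mix s H x = (\<integral>\<xi>. \<phi> s (x - \<xi>) \<partial>H)"

lemma f_dens_eq_mix: "f_dens c H = mix (\<sigma>\<^sub>s c) H"
  by (simp add: fun_eq_iff f_dens_def mix_def)

lemma g_dens_eq_mix: "g_dens c H = mix c H"
  by (simp add: fun_eq_iff g_dens_def mix_def)

lemma borel_probsD:
  assumes "H \<in> borel_probs"
  shows "prob_space H" "sets H = sets borel" "space H = UNIV" "sigma_finite_measure H"
proof -
  show *: "prob_space H" "sets H = sets borel" using assms by (auto simp: borel_probs_def)
  then show "space H = UNIV" by (metis sets_eq_imp_space_eq space_borel)
  from * show "sigma_finite_measure H"
    by (simp add: prob_space.axioms(1) finite_measure.axioms(1))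
qed

lemma phi_even: "\<phi> s (- x) = \<phi> s x"
  by (simp add: normal_density_def)

lemma phi_le: "s > 0 \<Longrightarrow> \<phi> s x \<le> 1 / (sqrt (2 * pi) * s)"
  by (simp add: normal_density_def real_sqrt_mult divide_right_mono)

lemma integrable_phi_H:
  assumes "H \<in> borel_probs" "s > 0"
  shows "integrable H (\<lambda>\<xi>. \<phi> s (x - \<xi>))"
proof -
  interpret prob_space H using borel_probsD[OF assms(1)] by simp
  note [measurable_cong] = borel_probsD(2)[OF assms(1)]
  show ?thesis
    by (rule integrable_const_bound[where B = "1 / (sqrt (2 * pi) * s)"])
       (auto simp: phi_le assms)
qed

lemma mix_pos: "H \<in> borel_probs \<Longrightarrow> s > 0 \<Longrightarrow> mix s H x > 0"
proof -
  assume H: "H \<in> borel_probs" and s: "s > 0"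
  interpret prob_space H using borel_probsD[OF H] by simp
  have "(\<integral>\<xi>. \<phi> s (x - \<xi>) \<partial>H) \<noteq> 0"
  proof
    assume "(\<integral>\<xi>. \<phi> s (x - \<xi>) \<partial>H) = 0"
    then have "AE \<xi> in H. \<phi> s (x - \<xi>) = 0"
      by (subst (asm) integral_nonneg_eq_0_iff_AE) (auto intro: integrable_phi_H H s)
    then have "AE \<xi> in H. False"
      by eventually_elim (use normal_density_pos[OF s] in \<open>auto simp: less_le\<close>)
    then show False by (simp)
  qed
  moreover have "(\<integral>\<xi>. \<phi> s (x - \<xi>) \<partial>H) \<ge> 0" by simp
  ultimately show "mix s H x > 0" by (simp add: mix_def less_le)
qed

lemma mix_nonneg [simp]: "mix s H x \<ge> 0"
  by (simp add: mix_def)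

lemma mix_le:
  assumes "H \<in> borel_probs" "s > 0"
  shows "mix s H x \<le> 1 / (sqrt (2 * pi) * s)"
proof -
  interpret prob_space H using borel_probsD[OF assms(1)] by simp
  show ?thesis unfolding mix_def
    by (rule integral_le_const) (auto intro!: integrable_phi_H assms phi_le)
qed

lemma measurable_mix [measurable]:
  assumes "H \<in> borel_probs"
  shows "mix s H \<in> borel_measurable borel"
proof -
  interpret sigma_finite_measure H using borel_probsD[OF assms(1)] by simp
  note [measurable_cong] = borel_probsD(2)[OF assms(1)]
  show ?thesis unfolding mix_def by measurable
qed

lemma ennreal_mix:
  assumes "H \<in> borel_probs" "s > 0"
  shows "ennreal (mix s H x) = (\<integral>\<^sup>+\<xi>. \<phi> s (x - \<xi>) \<partial>H)"
  unfolding mix_def by (rule nn_integral_eq_integral[symmetric]) (auto intro: integrable_phi_H assms)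

lemma nn_integral_mix:
  assumes H: "H \<in> borel_probs" and s: "s > 0" and [measurable]: "u \<in> borel_measurable borel"
  shows "(\<integral>\<^sup>+x. u x * ennreal (mix s H x) \<partial>lborel)
       = (\<integral>\<^sup>+\<xi>. (\<integral>\<^sup>+z. u (\<xi> + z) * ennreal (\<phi> s z) \<partial>lborel) \<partial>H)"
proof -
  note [measurable_cong] = borel_probsD(2)[OF H]
  interpret H: prob_space H using borel_probsD[OF H] by simp
  interpret pair_sigma_finite lborel H
    by (intro pair_sigma_finite.intro) (auto simp: borel_probsD[OF H] lborel.sigma_finite_measure_axioms)
  have "(\<integral>\<^sup>+x. u x * ennreal (mix s H x) \<partial>lborel) = (\<integral>\<^sup>+x. (\<integral>\<^sup>+\<xi>. u x * ennreal (\<phi> s (x - \<xi>)) \<partial>H) \<partial>lborel)"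
    by (simp add: ennreal_mix H s nn_integral_cmult)
  also have "\<dots> = (\<integral>\<^sup>+\<xi>. (\<integral>\<^sup>+x. u x * ennreal (\<phi> s (x - \<xi>)) \<partial>lborel) \<partial>H)"
    by (rule Fubini'[symmetric]) measurable
  also have "\<dots> = (\<integral>\<^sup>+\<xi>. (\<integral>\<^sup>+z. u (\<xi> + z) * ennreal (\<phi> s z) \<partial>lborel) \<partial>H)"
  proof (rule nn_integral_cong)
    fix \<xi>
    have "(\<integral>\<^sup>+x. u x * ennreal (\<phi> s (x - \<xi>)) \<partial>lborel) = (\<integral>\<^sup>+z. u (\<xi> + 1 * z) * ennreal (\<phi> s ((\<xi> + 1 * z) - \<xi>)) \<partial>lborel)"
      by (subst nn_integral_real_affine[where c = 1 and t = \<xi>]) auto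
    then show "(\<integral>\<^sup>+x. u x * ennreal (\<phi> s (x - \<xi>)) \<partial>lborel) = (\<integral>\<^sup>+z. u (\<xi> + z) * ennreal (\<phi> s z) \<partial>lborel)"
      by simp
  qed
  finally show ?thesis .
qed

lemma nn_integral_phi: "s > 0 \<Longrightarrow> (\<integral>\<^sup>+x. ennreal (\<phi> s x) \<partial>lborel) = 1"
  by (subst nn_integral_eq_integral) auto

lemma nn_integral_mix_1:
  assumes "H \<in> borel_probs" "s > 0"
  shows "(\<integral>\<^sup>+x. ennreal (mix s H x) \<partial>lborel) = 1"
  using nn_integral_mix[OF assms, of "\<lambda>_. 1"] prob_space.emeasure_space_1[OF borel_probsD(1)[OF assms(1)]]
  by (simp add: nn_integral_phi assms)

lemma integrable_mix:
  assumes "H \<in> borel_probs" "s > 0"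
  shows "integrable lborel (mix s H)"
  using assms by (intro integrableI_nn_integral_finite[where x = 1]) (auto simp: nn_integral_mix_1)

lemma integral_mix:
  assumes "H \<in> borel_probs" "s > 0"
  shows "(\<integral>x. mix s H x \<partial>lborel) = 1"
  using nn_integral_mix_1[OF assms] assms
  by (subst integral_eq_nn_integral) auto

text \<open>Gaussian smoothing adds variances: the marginal is the prior density convolved with
  the noise.\<close>

lemma nn_integral_phi_mix:
  assumes H: "H \<in> borel_probs" and s: "s > 0" and t: "t > 0"
  shows "(\<integral>\<^sup>+\<theta>. ennreal (\<phi> t (x - \<theta>)) * ennreal (mix s H \<theta>) \<partial>lborel)
    = ennreal (mix (sqrt (t\<^sup>2 + s\<^sup>2)) H x)"
proof -
  have st: "sqrt (t\<^sup>2 + s\<^sup>2) > 0" using s by (simp add: sum_power2_gt_zero_iff)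
  have "(\<integral>\<^sup>+\<theta>. ennreal (\<phi> t (x - \<theta>)) * ennreal (mix s H \<theta>) \<partial>lborel)
     = (\<integral>\<^sup>+\<xi>. (\<integral>\<^sup>+z. ennreal (\<phi> t (x - (\<xi> + z))) * ennreal (\<phi> s z) \<partial>lborel) \<partial>H)"
    by (rule nn_integral_mix[OF H s]) measurable
  also have "\<dots> = (\<integral>\<^sup>+\<xi>. ennreal (\<phi> (sqrt (t\<^sup>2 + s\<^sup>2)) (x - \<xi>)) \<partial>H)"
    using fun_cong[OF conv_normal_density_zero_mean[OF t s]]
    by (intro nn_integral_cong) (simp add: ennreal_mult' diff_diff_eq[symmetric])
  also have "\<dots> = ennreal (mix (sqrt (t\<^sup>2 + s\<^sup>2)) H x)"
    by (rule ennreal_mix[symmetric, OF H st])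
  finally show ?thesis .
qed

section \<open>Plancherel\<close>

text \<open>The Gaussian is its own Fourier transform; since it is even, the real part carries all the information,
and rescaling reduces the claim to the standard normal characteristic function.\<close>

lemma phi_cos_transform:
  assumes s: "s > 0"
  shows "has_bochner_integral lborel (\<lambda>t. exp (- (s\<^sup>2 * t\<^sup>2) / 2) * cos (t * u)) (2 * pi * \<phi> s u)"
proof -
  define r where "r = u / s"
  have "char std_normal_distribution r = complex_of_real (exp (- r\<^sup>2 / 2))"
    by (simp add: char_std_normal_distribution)
  moreover have "Re (char std_normal_distribution r) = (\<integral>x. cos (r * x) \<partial>std_normal_distribution)"
  proof -
    have "integrable std_normal_distribution (\<lambda>x. iexp (r * x))"
      by (intro prob_space.integrable_iexp prob_space_normal_density) auto
    then have "Re (char std_normal_distribution r) = (\<integral>x. Re (iexp (r * x)) \<partial>std_normal_distribution)"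
      unfolding char_def by (rule integral_Re[symmetric])
    then show ?thesis by (simp only: cis_conv_exp[symmetric] cis.simps)
  qed
  ultimately have "(\<integral>x. cos (r * x) \<partial>std_normal_distribution) = exp (- r\<^sup>2 / 2)" by simp
  then have I: "(\<integral>x. std_normal_density x * cos (r * x) \<partial>lborel) = exp (- r\<^sup>2 / 2)"
    by (simp add: integral_density)
  have int: "integrable lborel (\<lambda>x. std_normal_density x * cos (r * x))"
    by (rule Bochner_Integration.integrable_bound[where f = std_normal_density]) (auto simp: abs_mult mult_left_le)
  have hb: "has_bochner_integral lborel (\<lambda>x. std_normal_density x * cos (r * x)) (exp (- r\<^sup>2 / 2))"
    using int I by (simp add: has_bochner_integral_iff)
  have "has_bochner_integral lborel (\<lambda>t. std_normal_density (0 + s * t) * cos (r * (0 + s * t))) (exp (- r\<^sup>2 / 2) /\<^sub>R \<bar>s\<bar>)"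
    using s by (intro lborel_has_bochner_integral_real_affine_iff[THEN iffD1, of s, OF _ hb]) auto
  then have "has_bochner_integral lborel (\<lambda>t. sqrt (2 * pi) * (std_normal_density (0 + s * t) * cos (r * (0 + s * t)))) (sqrt (2 * pi) * (exp (- r\<^sup>2 / 2) /\<^sub>R \<bar>s\<bar>))"
    by (intro has_bochner_integral_mult_right) auto
  moreover have "sqrt (2 * pi) * (exp (- r\<^sup>2 / 2) /\<^sub>R \<bar>s\<bar>) = 2 * pi * \<phi> s u"
  proof -
    have "2 * pi * (1 / sqrt (2 * pi)) = sqrt (2 * pi)" by (simp add: real_div_sqrt)
    moreover have "\<phi> s u = 1 / sqrt (2 * pi) * (exp (- r\<^sup>2 / 2) / s)"
      using s by (simp add: normal_density_def r_def power_divide real_sqrt_mult)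
    ultimately have "2 * pi * \<phi> s u = sqrt (2 * pi) * (exp (- r\<^sup>2 / 2) / s)"
      by (simp only: mult.assoc[symmetric])
    moreover have "x /\<^sub>R \<bar>s\<bar> = x / s" for x using s by (simp add: divide_inverse)
    ultimately show ?thesis by (simp only:)
  qed
  moreover have "sqrt (2 * pi) * (std_normal_density (0 + s * t) * cos (r * (0 + s * t))) = exp (- (s\<^sup>2 * t\<^sup>2) / 2) * cos (t * u)" for t
    using s by (simp add: std_normal_density_def r_def power_mult_distrib mult.commute)
  ultimately show ?thesis by simp
qed

definition cos_tr :: "real measure \<Rightarrow> real \<Rightarrow> real" where
  "cos_tr H t = (\<integral>\<xi>. cos (t * \<xi>) \<partial>H)"

definition sin_tr :: "real measure \<Rightarrow> real \<Rightarrow> real" where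
  "sin_tr H t = (\<integral>\<xi>. sin (t * \<xi>) \<partial>H)"

lemma cos_sin_integrable:
  assumes "H \<in> borel_probs"
  shows "integrable H (\<lambda>\<xi>. cos (t * \<xi> + a))" "integrable H (\<lambda>\<xi>. sin (t * \<xi> + a))"
    "integrable H (\<lambda>\<xi>. cos (t * \<xi>))" "integrable H (\<lambda>\<xi>. sin (t * \<xi>))"
proof -
  interpret prob_space H using borel_probsD[OF assms(1)] by simp
  note [measurable_cong] = borel_probsD(2)[OF assms(1)]
  show "integrable H (\<lambda>\<xi>. cos (t * \<xi> + a))" "integrable H (\<lambda>\<xi>. sin (t * \<xi> + a))"
    "integrable H (\<lambda>\<xi>. cos (t * \<xi>))" "integrable H (\<lambda>\<xi>. sin (t * \<xi>))"
    by (rule integrable_const_bound[where B = 1]; auto)+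
qed

lemma cos_sin_tr_abs_le:
  assumes "H \<in> borel_probs"
  shows "\<bar>cos_tr H t\<bar> \<le> 1" "\<bar>sin_tr H t\<bar> \<le> 1"
proof -
  interpret prob_space H using borel_probsD[OF assms(1)] by simp
  show "\<bar>cos_tr H t\<bar> \<le> 1" unfolding cos_tr_def
    by (rule order_trans[OF integral_abs_bound], rule integral_le_const)
       (auto intro!: cos_sin_integrable assms integrable_abs)
  show "\<bar>sin_tr H t\<bar> \<le> 1" unfolding sin_tr_def
    by (rule order_trans[OF integral_abs_bound], rule integral_le_const)
       (auto intro!: cos_sin_integrable assms integrable_abs)
qed

lemma measurable_cos_sin_tr [measurable]:
  assumes "H \<in> borel_probs"
  shows "cos_tr H \<in> borel_measurable borel" "sin_tr H \<in> borel_measurable borel"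
proof -
  interpret sigma_finite_measure H using borel_probsD[OF assms(1)] by simp
  note [measurable_cong] = borel_probsD(2)[OF assms(1)]
  show "cos_tr H \<in> borel_measurable borel" "sin_tr H \<in> borel_measurable borel"
    unfolding cos_tr_def sin_tr_def by measurable
qed

lemma integral_cos_diff:
  assumes "H \<in> borel_probs" "H' \<in> borel_probs"
  shows "(\<integral>\<xi>. (\<integral>\<xi>'. cos (t * (\<xi> - \<xi>')) \<partial>H') \<partial>H) = cos_tr H t * cos_tr H' t + sin_tr H t * sin_tr H' t"
proof -
  have "(\<integral>\<xi>'. cos (t * (\<xi> - \<xi>')) \<partial>H') = cos (t * \<xi>) * cos_tr H' t + sin (t * \<xi>) * sin_tr H' t" for \<xi>
    using assms by (simp add: right_diff_distrib cos_diff cos_tr_def sin_tr_def cos_sin_integrable)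
  then show ?thesis
    using assms by (simp add: cos_sin_integrable) (simp add: cos_tr_def sin_tr_def)
qed

lemma integrable_exp_sq:
  fixes s T :: real
  assumes "s > 0"
  shows "has_bochner_integral lborel (\<lambda>t. exp (- (s\<^sup>2 * (t - T)\<^sup>2))) (sqrt pi / s)"
proof -
  have eq: "normal_density T (1 / (sqrt 2 * s)) t * (sqrt pi / s) = exp (- (s\<^sup>2 * (t - T)\<^sup>2))" for t
    using assms by (simp add: normal_density_def real_sqrt_divide real_sqrt_mult power_divide power_mult_distrib field_simps)
  have "has_bochner_integral lborel (\<lambda>t. normal_density T (1 / (sqrt 2 * s)) t * (sqrt pi / s)) (1 * (sqrt pi / s))"
    using assms by (intro has_bochner_integral_mult_left) (auto simp: has_bochner_integral_iff)
  then show ?thesis by (simp only: eq mult_1)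
qed

lemma integrable_exp_sq_bounded:
  fixes s B :: real and A :: "real \<Rightarrow> real"
  assumes s: "s > 0" and [measurable]: "A \<in> borel_measurable borel" and A: "\<And>t. \<bar>A t\<bar> \<le> B"
  shows "integrable lborel (\<lambda>t. exp (- (s\<^sup>2 * t\<^sup>2)) * A t)"
proof (rule Bochner_Integration.integrable_bound)
  show "integrable lborel (\<lambda>t. exp (- (s\<^sup>2 * t\<^sup>2)) * B)"
    using integrable_exp_sq[OF s, of 0] by (simp add: has_bochner_integral_iff)
  show "AE t in lborel. norm (exp (- (s\<^sup>2 * t\<^sup>2)) * A t) \<le> norm (exp (- (s\<^sup>2 * t\<^sup>2)) * B)"
    using A by (auto simp: abs_mult intro!: mult_left_mono order_trans[OF A abs_ge_self])
qed measurable

lemma integral_mix_mix_phi: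
  assumes H: "H \<in> borel_probs" and H': "H' \<in> borel_probs" and s: "s > 0"
  shows "(\<integral>x. mix s H x * mix s H' x \<partial>lborel) = (\<integral>\<xi>. mix (sqrt (s\<^sup>2 + s\<^sup>2)) H' \<xi> \<partial>H)"
proof -
  note [measurable] = measurable_mix[OF H] measurable_mix[OF H']
  note [measurable_cong] = borel_probsD(2)[OF H]
  have st: "sqrt (s\<^sup>2 + s\<^sup>2) > 0" using s by simp
  have "(\<integral>\<^sup>+x. ennreal (mix s H' x) * ennreal (mix s H x) \<partial>lborel)
      = (\<integral>\<^sup>+\<xi>. (\<integral>\<^sup>+z. ennreal (mix s H' (\<xi> + z)) * ennreal (\<phi> s z) \<partial>lborel) \<partial>H)"
    by (rule nn_integral_mix[OF H s]) measurable
  also have "\<dots> = (\<integral>\<^sup>+\<xi>. ennreal (mix (sqrt (s\<^sup>2 + s\<^sup>2)) H' \<xi>) \<partial>H)"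
  proof (rule nn_integral_cong)
    fix \<xi>
    have "(\<integral>\<^sup>+z. ennreal (mix s H' (\<xi> + z)) * ennreal (\<phi> s z) \<partial>lborel)
      = (\<integral>\<^sup>+\<theta>. ennreal (\<phi> s (\<xi> - \<theta>)) * ennreal (mix s H' \<theta>) \<partial>lborel)"
      using nn_integral_real_affine[where c = 1 and t = \<xi> and f = "\<lambda>\<theta>. ennreal (\<phi> s (\<xi> - \<theta>)) * ennreal (mix s H' \<theta>)"]
      by (simp add: phi_even mult.commute)
    then show "(\<integral>\<^sup>+z. ennreal (mix s H' (\<xi> + z)) * ennreal (\<phi> s z) \<partial>lborel) = ennreal (mix (sqrt (s\<^sup>2 + s\<^sup>2)) H' \<xi>)"
      by (simp add: nn_integral_phi_mix[OF H' s s])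
  qed
  finally have "(\<integral>\<^sup>+x. ennreal (mix s H x * mix s H' x) \<partial>lborel) = (\<integral>\<^sup>+\<xi>. ennreal (mix (sqrt (s\<^sup>2 + s\<^sup>2)) H' \<xi>) \<partial>H)"
    by (simp add: ennreal_mult mult.commute)
  then show ?thesis
    by (subst (1 2) integral_eq_nn_integral) auto
qed

text \<open>By \<open>integral_mix_mix_phi\<close> the left-hand side is the mean of the kernel \<open>\<phi> (\<surd>2 s) (\<xi> - \<xi>')\<close> for independent
\<open>\<xi>\<close> and \<open>\<xi>'\<close>. Writing the kernel as a cosine integral, exchanging the integrations and applying the
addition theorem separates \<open>\<xi>\<close> from \<open>\<xi>'\<close>.\<close>

lemma integral_mix_mix:
  assumes H: "H \<in> borel_probs" and H': "H' \<in> borel_probs" and s: "s > 0"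
  shows "2 * pi * (\<integral>x. mix s H x * mix s H' x \<partial>lborel)
    = (\<integral>t. exp (- (s\<^sup>2 * t\<^sup>2)) * (cos_tr H t * cos_tr H' t + sin_tr H t * sin_tr H' t) \<partial>lborel)"
proof -
  note [measurable_cong] = borel_probsD(2)[OF H] borel_probsD(2)[OF H']
  interpret H: prob_space H using borel_probsD[OF H] by simp
  interpret H': prob_space H' using borel_probsD[OF H'] by simp
  interpret p: pair_prob_space H H' ..
  interpret q: pair_sigma_finite lborel "H \<Otimes>\<^sub>M H'" ..
  define r where "r = sqrt (s\<^sup>2 + s\<^sup>2)"
  have r: "r > 0" "r\<^sup>2 = 2 * s\<^sup>2" using s by (auto simp: r_def)
  have spc: "integrable (H \<Otimes>\<^sub>M H') (\<lambda>(\<xi>,\<xi>'). h \<xi> \<xi>')" 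
    if "case_prod h \<in> borel_measurable (H \<Otimes>\<^sub>M H')" "\<And>x y. \<bar>h x y\<bar> \<le> B" for h :: "real \<Rightarrow> real \<Rightarrow> real" and B :: real
    using that by (intro p.P.integrable_const_bound[where B = B]) auto
  have intE: "integrable lborel (\<lambda>t. exp (- (s\<^sup>2 * t\<^sup>2)))"
    using integrable_exp_sq[OF s, of 0] by (simp add: has_bochner_integral_iff)
  have "2 * pi * (\<integral>\<xi>. mix r H' \<xi> \<partial>H) = (\<integral>\<xi>. (\<integral>\<xi>'. 2 * pi * \<phi> r (\<xi> - \<xi>') \<partial>H') \<partial>H)"
    by (simp add: mix_def)
  also have "\<dots> = (\<integral>p. 2 * pi * \<phi> r (fst p - snd p) \<partial>(H \<Otimes>\<^sub>M H'))"
  proof -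
    have "\<bar>\<phi> r a\<bar> \<le> 1 / (sqrt (2 * pi) * r)" for a using phi_le[OF r(1)] by simp
    then have "integrable (H \<Otimes>\<^sub>M H') (\<lambda>(\<xi>,\<xi>'). 2 * pi * \<phi> r (\<xi> - \<xi>'))"
      by (intro spc[of "\<lambda>\<xi> \<xi>'. 2 * pi * \<phi> r (\<xi> - \<xi>')" "2 * pi * (1 / (sqrt (2 * pi) * r))"])
         (auto simp only: abs_mult abs_of_nonneg pi_ge_zero intro!: mult_left_mono mult_mono, measurable)
    from p.integral_fst'[OF this] show ?thesis by (simp only: case_prod_beta' fst_conv snd_conv)
  qed
  also have "\<dots> = (\<integral>p. (\<integral>t. exp (- (s\<^sup>2 * t\<^sup>2)) * cos (t * (fst p - snd p)) \<partial>lborel) \<partial>(H \<Otimes>\<^sub>M H'))"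
  proof (rule Bochner_Integration.integral_cong)
    fix p :: "real \<times> real"
    have "(\<integral>t. exp (- (r\<^sup>2 * t\<^sup>2) / 2) * cos (t * (fst p - snd p)) \<partial>lborel) = 2 * pi * \<phi> r (fst p - snd p)"
      using phi_cos_transform[OF r(1), of "fst p - snd p"] by (simp add: has_bochner_integral_iff)
    moreover have "- (r\<^sup>2 * t\<^sup>2) / 2 = - (s\<^sup>2 * t\<^sup>2)" for t by (simp add: r)
    then have "(\<lambda>t. exp (- (r\<^sup>2 * t\<^sup>2) / 2) * cos (t * (fst p - snd p))) = (\<lambda>t. exp (- (s\<^sup>2 * t\<^sup>2)) * cos (t * (fst p - snd p)))" by (simp only:)
    ultimately show "2 * pi * \<phi> r (fst p - snd p) = (\<integral>t. exp (- (s\<^sup>2 * t\<^sup>2)) * cos (t * (fst p - snd p)) \<partial>lborel)"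
      by simp
  qed simp
  also have "\<dots> = (\<integral>t. (\<integral>p. exp (- (s\<^sup>2 * t\<^sup>2)) * cos (t * (fst p - snd p)) \<partial>(H \<Otimes>\<^sub>M H')) \<partial>lborel)"
  proof (rule q.Fubini_integral)
    show "integrable (lborel \<Otimes>\<^sub>M (H \<Otimes>\<^sub>M H')) (\<lambda>(t, p). exp (- (s\<^sup>2 * t\<^sup>2)) * cos (t * (fst p - snd p)))"
    proof (rule q.Fubini_integrable)
      show "AE t in lborel. integrable (H \<Otimes>\<^sub>M H') (\<lambda>p. case (t, p) of (t, p) \<Rightarrow> exp (- (s\<^sup>2 * t\<^sup>2)) * cos (t * (fst p - snd p)))"
        by (intro always_eventually allI p.P.integrable_const_bound[where B = 1])
           (auto simp: abs_mult intro!: mult_le_one)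
      show "integrable lborel (\<lambda>t. \<integral>p. norm (case (t, p) of (t, p) \<Rightarrow> exp (- (s\<^sup>2 * t\<^sup>2)) * cos (t * (fst p - snd p))) \<partial>(H \<Otimes>\<^sub>M H'))"
      proof (rule Bochner_Integration.integrable_bound[OF intE])
        show "AE t in lborel. norm (\<integral>p. norm (case (t, p) of (t, p) \<Rightarrow> exp (- (s\<^sup>2 * t\<^sup>2)) * cos (t * (fst p - snd p))) \<partial>(H \<Otimes>\<^sub>M H')) \<le> norm (exp (- (s\<^sup>2 * t\<^sup>2)))"
        proof (intro always_eventually allI)
          fix t
          have "(\<integral>p. norm (case (t, p) of (t, p) \<Rightarrow> exp (- (s\<^sup>2 * t\<^sup>2)) * cos (t * (fst p - snd p))) \<partial>(H \<Otimes>\<^sub>M H')) \<le> exp (- (s\<^sup>2 * t\<^sup>2))"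
            by (intro p.P.integral_le_const p.P.integrable_const_bound[where B = 1])
               (auto simp: abs_mult intro!: mult_le_one mult_left_le)
          then show "norm (\<integral>p. norm (case (t, p) of (t, p) \<Rightarrow> exp (- (s\<^sup>2 * t\<^sup>2)) * cos (t * (fst p - snd p))) \<partial>(H \<Otimes>\<^sub>M H')) \<le> norm (exp (- (s\<^sup>2 * t\<^sup>2)))"
            by (simp)
        qed
      qed measurable
    qed measurable
  qed
  also have "\<dots> = (\<integral>t. exp (- (s\<^sup>2 * t\<^sup>2)) * (cos_tr H t * cos_tr H' t + sin_tr H t * sin_tr H' t) \<partial>lborel)"
  proof (rule Bochner_Integration.integral_cong)
    fix t
    have "integrable (H \<Otimes>\<^sub>M H') (\<lambda>(\<xi>,\<xi>'). cos (t * (\<xi> - \<xi>')))"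
      by (intro spc[of _ 1]) auto
    from p.integral_fst'[OF this]
    have "(\<integral>p. cos (t * (fst p - snd p)) \<partial>(H \<Otimes>\<^sub>M H')) = cos_tr H t * cos_tr H' t + sin_tr H t * sin_tr H' t"
      by (simp only: integral_cos_diff[OF H H'] case_prod_beta' fst_conv snd_conv)
    then show "(\<integral>p. exp (- (s\<^sup>2 * t\<^sup>2)) * cos (t * (fst p - snd p)) \<partial>(H \<Otimes>\<^sub>M H')) = exp (- (s\<^sup>2 * t\<^sup>2)) * (cos_tr H t * cos_tr H' t + sin_tr H t * sin_tr H' t)"
      by simp
  qed simp
  finally show ?thesis using integral_mix_mix_phi[OF H H' s] by (simp add: r_def)
qed

lemma integrable_mix_mult:
  assumes H: "H \<in> borel_probs" and H': "H' \<in> borel_probs" and s: "s > 0" and s': "s' > 0"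
  shows "integrable lborel (\<lambda>x. mix s H x * mix s' H' x)"
proof (rule Bochner_Integration.integrable_bound)
  note [measurable] = measurable_mix[OF H] measurable_mix[OF H']
  show "integrable lborel (\<lambda>x. mix s H x * (1 / (sqrt (2 * pi) * s')))"
    using integrable_mix[OF H s] by simp
  show "AE x in lborel. norm (mix s H x * mix s' H' x) \<le> norm (mix s H x * (1 / (sqrt (2 * pi) * s')))"
  proof (intro always_eventually allI)
    fix x
    have "mix s H x * mix s' H' x \<le> mix s H x * (1 / (sqrt (2 * pi) * s'))"
      by (intro mult_left_mono mix_le H' s') auto
    then show "norm (mix s H x * mix s' H' x) \<le> norm (mix s H x * (1 / (sqrt (2 * pi) * s')))"
      by (simp only: real_norm_def abs_mult abs_of_nonneg[OF mix_nonneg]) (use s' in simp)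
  qed
  show "(\<lambda>x. mix s H x * mix s' H' x) \<in> borel_measurable lborel" by measurable
qed

definition mixL2 :: "real \<Rightarrow> real measure \<Rightarrow> real measure \<Rightarrow> real" where
  "mixL2 s H H' = (\<integral>x. (mix s H x - mix s H' x)\<^sup>2 \<partial>lborel)"

definition tr_gap :: "real measure \<Rightarrow> real measure \<Rightarrow> real \<Rightarrow> real" where
  "tr_gap H H' t = (cos_tr H t - cos_tr H' t)\<^sup>2 + (sin_tr H t - sin_tr H' t)\<^sup>2"

lemma integrable_mix_diff_sq:
  assumes H: "H \<in> borel_probs" and H': "H' \<in> borel_probs" and s: "s > 0"
  shows "integrable lborel (\<lambda>x. (mix s H x - mix s H' x)\<^sup>2)"
  unfolding power2_eq_square left_diff_distrib right_diff_distrib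
  by (intro Bochner_Integration.integrable_diff integrable_mix_mult assms)

lemma mixL2_nonneg: "mixL2 s H H' \<ge> 0" by (simp add: mixL2_def)

lemma tr_gap_nonneg: "tr_gap H H' t \<ge> 0" by (simp add: tr_gap_def)

lemma measurable_tr_gap:
  assumes H: "H \<in> borel_probs" and H': "H' \<in> borel_probs"
  shows "tr_gap H H' \<in> borel_measurable borel"
proof -
  note [measurable] = measurable_cos_sin_tr[OF H] measurable_cos_sin_tr[OF H']
  show ?thesis unfolding tr_gap_def by measurable
qed

lemma tr_gap_le:
  assumes H: "H \<in> borel_probs" and H': "H' \<in> borel_probs"
  shows "tr_gap H H' t \<le> 8"
proof -
  have "\<bar>cos_tr H t - cos_tr H' t\<bar> \<le> 2" "\<bar>sin_tr H t - sin_tr H' t\<bar> \<le> 2"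
    using cos_sin_tr_abs_le[OF H, of t] cos_sin_tr_abs_le[OF H', of t] by linarith+
  then have "(cos_tr H t - cos_tr H' t)\<^sup>2 \<le> 2\<^sup>2" "(sin_tr H t - sin_tr H' t)\<^sup>2 \<le> 2\<^sup>2"
    by (metis abs_le_square_iff abs_numeral)+
  then show ?thesis by (simp add: tr_gap_def)
qed

text \<open>Plancherel's identity for the difference of two mixtures, by expanding the square into three inner
products.\<close>

lemma mixL2_eq_Fourier:
  assumes H: "H \<in> borel_probs" and H': "H' \<in> borel_probs" and s: "s > 0"
  shows "2 * pi * mixL2 s H H' = (\<integral>t. exp (- (s\<^sup>2 * t\<^sup>2)) * tr_gap H H' t \<partial>lborel)"
proof -
  let ?K = "\<lambda>A B t. cos_tr A t * cos_tr B t + sin_tr A t * sin_tr B t"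
  let ?E = "\<lambda>t. exp (- (s\<^sup>2 * t\<^sup>2))"
  have int: "integrable lborel (\<lambda>t. ?E t * ?K A B t)" if A: "A \<in> borel_probs" and B: "B \<in> borel_probs" for A B
  proof (rule integrable_exp_sq_bounded[OF s, where B = 2])
    note [measurable] = measurable_cos_sin_tr[OF A] measurable_cos_sin_tr[OF B]
    show "?K A B \<in> borel_measurable borel" by measurable
    fix t
    have "\<bar>cos_tr A t * cos_tr B t\<bar> \<le> 1" "\<bar>sin_tr A t * sin_tr B t\<bar> \<le> 1"
      using cos_sin_tr_abs_le[OF A, of t] cos_sin_tr_abs_le[OF B, of t] by (auto simp: abs_mult intro!: mult_le_one)
    then show "\<bar>?K A B t\<bar> \<le> 2" by linarith
  qed
  have "mixL2 s H H' = (\<integral>x. mix s H x * mix s H x \<partial>lborel) - 2 * (\<integral>x. mix s H x * mix s H' x \<partial>lborel)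
     + (\<integral>x. mix s H' x * mix s H' x \<partial>lborel)"
    using integrable_mix_mult[OF H H s s] integrable_mix_mult[OF H H' s s] integrable_mix_mult[OF H' H' s s]
    unfolding mixL2_def power2_diff by (simp add: power2_eq_square mult.assoc)
  then have "2 * pi * mixL2 s H H' = (\<integral>t. ?E t * ?K H H t \<partial>lborel) - 2 * (\<integral>t. ?E t * ?K H H' t \<partial>lborel) + (\<integral>t. ?E t * ?K H' H' t \<partial>lborel)"
    by (simp only: integral_mix_mix[OF H H s, symmetric] integral_mix_mix[OF H H' s, symmetric] integral_mix_mix[OF H' H' s, symmetric])
       (simp add: algebra_simps)
  also have "\<dots> = (\<integral>t. ?E t * ?K H H t - 2 * (?E t * ?K H H' t) + ?E t * ?K H' H' t \<partial>lborel)"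
    using int[OF H H] int[OF H H'] int[OF H' H'] by simp
  also have "\<dots> = (\<integral>t. ?E t * tr_gap H H' t \<partial>lborel)"
    by (intro Bochner_Integration.integral_cong) (auto simp: tr_gap_def power2_eq_square algebra_simps)
  finally show ?thesis .
qed

text \<open>Deconvolution of the \<open>N(0,1)\<close> noise. For \<open>W < 1\<close> let \<open>T\<close> satisfy \<open>exp (- \<sigma>\<^sup>2 T\<^sup>2) = W\<close>. Below \<open>T\<close> the weight
\<open>exp (- c\<^sup>2 t\<^sup>2)\<close> exceeds \<open>exp (- \<sigma>\<^sup>2 t\<^sup>2)\<close> by at most the factor \<open>exp (T\<^sup>2)\<close>, and above \<open>T\<close> it is a Gaussian tail
of order \<open>exp (- c\<^sup>2 T\<^sup>2)\<close>. Both contributions are of order \<open>W powr (c\<^sup>2 / \<sigma>\<^sup>2)\<close>, so no logarithm is lost.\<close>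

lemma mixL2_deconvolution:
  assumes H: "H \<in> borel_probs" and H': "H' \<in> borel_probs" and c: "c > 0"
    and W: "mixL2 (\<sigma>\<^sub>s c) H H' \<le> W" "W > 0"
  shows "mixL2 c H H' \<le> (1 + 8 / c) * W powr \<alpha>\<^sub>s c"
proof -
  define s where "s = \<sigma>\<^sub>s c"
  have s: "s > 0" "s\<^sup>2 = 1 + c\<^sup>2" by (auto simp: s_def \<sigma>\<^sub>s_def sum_power2_gt_zero_iff add_pos_nonneg)
  have al: "\<alpha>\<^sub>s c = c\<^sup>2 / s\<^sup>2" by (simp add: \<alpha>\<^sub>s_def s_def)
  have alpos: "\<alpha>\<^sub>s c > 0" unfolding al using c s(1) by (intro divide_pos_pos) auto
  note m[measurable] = measurable_tr_gap[OF H H']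
  have pi1: "pi > 1" using pi_gt3 by simp
  have sp: "sqrt pi \<le> pi" using pi1 real_le_lsqrt[of pi pi] by (simp add: power2_eq_square)
  have intg: "integrable lborel (\<lambda>t. exp (- (r\<^sup>2 * t\<^sup>2)) * tr_gap H H' t)" if "r > 0" for r
    by (rule integrable_exp_sq_bounded[OF that m, where B = 8])
       (use tr_gap_le[OF H H'] tr_gap_nonneg in auto)
  show ?thesis
  proof (cases "W \<ge> 1")
    case True
    have "2 * pi * mixL2 c H H' \<le> (\<integral>t. 8 * exp (- (c\<^sup>2 * (t - 0)\<^sup>2)) \<partial>lborel)"
      unfolding mixL2_eq_Fourier[OF H H' c]
      using tr_gap_le[OF H H'] integrable_exp_sq[OF c, of 0] intg[OF c]
      by (intro integral_mono) (auto simp: has_bochner_integral_iff intro!: mult_right_mono)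
    also have "\<dots> = 8 * (sqrt pi / c)"
      using integrable_exp_sq[OF c, of 0] by (simp add: has_bochner_integral_iff)
    also have "\<dots> \<le> 2 * pi * (1 + 8 / c)"
    proof -
      have "8 * (sqrt pi / c) \<le> 8 * (pi / c)"
        using sp c by (intro mult_left_mono divide_right_mono) auto
      moreover have "pi / c > 0" using c pi1 by simp
      moreover have "2 * pi * (1 + 8 / c) = 2 * pi + 16 * (pi / c)" using c by (simp add: field_simps)
      ultimately show ?thesis using pi1 by linarith
    qed
    finally have "mixL2 c H H' \<le> 1 + 8 / c"
      by (rule mult_left_le_imp_le) (use pi1 in auto)
    also have "\<dots> \<le> (1 + 8 / c) * W powr \<alpha>\<^sub>s c"
      using mult_left_mono[OF ge_one_powr_ge_zero[of W "\<alpha>\<^sub>s c"], of "1 + 8 / c"] True alpos c by simp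
    finally show ?thesis .
  next
    case False
    define T where "T = sqrt (ln (1 / W) / s\<^sup>2)"
    have "ln (1 / W) / s\<^sup>2 \<ge> 0" using False W by (intro divide_nonneg_nonneg) (auto simp: ln_div)
    then have T2: "T\<^sup>2 = ln (1 / W) / s\<^sup>2" and T0: "T \<ge> 0" by (auto simp: T_def)
    have e1: "exp (- (c\<^sup>2 * T\<^sup>2)) = W powr \<alpha>\<^sub>s c"
      using W by (simp add: powr_def T2 al ln_div)
    have "s\<^sup>2 * T\<^sup>2 = - ln W" using s(1) W by (simp add: T2 ln_div)
    moreover have "s\<^sup>2 * T\<^sup>2 = T\<^sup>2 + c\<^sup>2 * T\<^sup>2" unfolding s(2) by (simp only: distrib_right mult_1)
    ultimately have lnW: "ln W = - (c\<^sup>2 * T\<^sup>2) - T\<^sup>2" by linarith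
    have "exp (T\<^sup>2) * W = exp (T\<^sup>2 + ln W)" using W by (simp add: exp_add)
    then have e2: "exp (T\<^sup>2) * W = exp (- (c\<^sup>2 * T\<^sup>2))" unfolding lnW by simp
    \<comment> \<open>For \<open>\<bar>t\<bar> > T\<close> one of the two shifted Gaussians absorbs the tail, as \<open>t\<^sup>2 \<ge> T\<^sup>2 + (\<bar>t\<bar> - T)\<^sup>2\<close>.\<close>
    have pt: "exp (- (c\<^sup>2 * t\<^sup>2)) * tr_gap H H' t \<le> exp (T\<^sup>2) * (exp (- (s\<^sup>2 * t\<^sup>2)) * tr_gap H H' t)
       + 8 * exp (- (c\<^sup>2 * T\<^sup>2)) * (exp (- (c\<^sup>2 * (t - T)\<^sup>2)) + exp (- (c\<^sup>2 * (t - (- T))\<^sup>2)))" (is "?l \<le> ?a + ?b") for t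
    proof (cases "\<bar>t\<bar> \<le> T")
      case True
      then have "t\<^sup>2 \<le> T\<^sup>2" by (metis abs_le_square_iff abs_of_nonneg T0)
      then have "exp (- (c\<^sup>2 * t\<^sup>2)) \<le> exp (T\<^sup>2) * exp (- (s\<^sup>2 * t\<^sup>2))"
        by (simp add: exp_add[symmetric] s algebra_simps)
      then have "?l \<le> ?a" using tr_gap_nonneg[of H H' t]
        by (metis mult.assoc mult_right_mono)
      then show ?thesis by (smt (verit) exp_gt_zero mult_nonneg_nonneg)
    next
      case False
      have "exp (- (c\<^sup>2 * t\<^sup>2)) \<le> exp (- (c\<^sup>2 * T\<^sup>2)) * (exp (- (c\<^sup>2 * (t - T)\<^sup>2)) + exp (- (c\<^sup>2 * (t - (- T))\<^sup>2)))"
      proof (cases "t \<ge> 0")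
        case True
        then have "T * T \<le> t * T" using False T0 by (intro mult_right_mono) auto
        then have "T\<^sup>2 + (t - T)\<^sup>2 \<le> t\<^sup>2" by (simp add: power2_eq_square algebra_simps)
        then have "c\<^sup>2 * T\<^sup>2 + c\<^sup>2 * (t - T)\<^sup>2 \<le> c\<^sup>2 * t\<^sup>2"
          by (metis distrib_left mult_left_mono zero_le_power2)
        then have "exp (- (c\<^sup>2 * t\<^sup>2)) \<le> exp (- (c\<^sup>2 * T\<^sup>2)) * exp (- (c\<^sup>2 * (t - T)\<^sup>2))"
          by (simp add: exp_add[symmetric])
        then show ?thesis by (simp add: distrib_left add_increasing2)
      next
        case False2: False
        then have "T * T \<le> - t * T" using False T0 by (intro mult_right_mono) auto
        then have "T\<^sup>2 + (t - (- T))\<^sup>2 \<le> t\<^sup>2" by (simp add: power2_eq_square algebra_simps)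
        then have "c\<^sup>2 * T\<^sup>2 + c\<^sup>2 * (t - (- T))\<^sup>2 \<le> c\<^sup>2 * t\<^sup>2"
          by (metis distrib_left mult_left_mono zero_le_power2)
        then have "exp (- (c\<^sup>2 * t\<^sup>2)) \<le> exp (- (c\<^sup>2 * T\<^sup>2)) * exp (- (c\<^sup>2 * (t - (- T))\<^sup>2))"
          by (simp add: exp_add[symmetric])
        then show ?thesis by (simp add: distrib_left add_increasing)
      qed
      then have "?l \<le> (exp (- (c\<^sup>2 * T\<^sup>2)) * (exp (- (c\<^sup>2 * (t - T)\<^sup>2)) + exp (- (c\<^sup>2 * (t - (- T))\<^sup>2)))) * 8"
        using tr_gap_nonneg[of H H' t] tr_gap_le[OF H H', of t] by (intro mult_mono) auto
      moreover have "?a \<ge> 0" by (simp add: tr_gap_nonneg)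
      ultimately show ?thesis by simp
    qed
    have "2 * pi * mixL2 c H H' \<le> (\<integral>t. exp (T\<^sup>2) * (exp (- (s\<^sup>2 * t\<^sup>2)) * tr_gap H H' t)
       + 8 * exp (- (c\<^sup>2 * T\<^sup>2)) * (exp (- (c\<^sup>2 * (t - T)\<^sup>2)) + exp (- (c\<^sup>2 * (t - (- T))\<^sup>2))) \<partial>lborel)"
      unfolding mixL2_eq_Fourier[OF H H' c]
      using integrable_exp_sq[OF c, of T] integrable_exp_sq[OF c, of "- T"] intg[OF c] intg[OF s(1)] pt
      by (intro integral_mono) (auto simp: has_bochner_integral_iff simp del: minus_minus diff_minus_eq_add)
    also have "\<dots> = exp (T\<^sup>2) * (2 * pi * mixL2 s H H') + 8 * exp (- (c\<^sup>2 * T\<^sup>2)) * (sqrt pi / c + sqrt pi / c)"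
      using integrable_exp_sq[OF c, of T] integrable_exp_sq[OF c, of "- T"] intg[OF s(1)]
      unfolding mixL2_eq_Fourier[OF H H' s(1)]
      by (simp add: has_bochner_integral_iff del: minus_minus diff_minus_eq_add)
    also have "\<dots> \<le> exp (T\<^sup>2) * (2 * pi * W) + 8 * exp (- (c\<^sup>2 * T\<^sup>2)) * (pi / c + pi / c)"
      using W(1) sp c pi1 by (intro add_mono mult_left_mono divide_right_mono) (auto simp: s_def)
    also have "\<dots> = 2 * pi * ((1 + 8 / c) * W powr \<alpha>\<^sub>s c)"
    proof -
      have "exp (T\<^sup>2) * (2 * pi * W) = 2 * pi * (exp (T\<^sup>2) * W)" by (simp only: ac_simps)
      also have "\<dots> = 2 * pi * W powr \<alpha>\<^sub>s c" by (simp only: e1 e2)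
      finally show ?thesis unfolding e1 by (simp add: add_divide_distrib algebra_simps)
    qed
    finally show ?thesis
      by (rule mult_left_le_imp_le) (use pi1 in auto)
  qed
qed

section \<open>From posteriors to prior densities\<close>

lemma sigma_s: "\<sigma>\<^sub>s c \<ge> 1" "\<sigma>\<^sub>s c > 0" "(\<sigma>\<^sub>s c)\<^sup>2 = 1 + c\<^sup>2" "\<sigma>\<^sub>s c \<ge> c"
proof -
  show "\<sigma>\<^sub>s c \<ge> 1" by (simp add: \<sigma>\<^sub>s_def)
  then show "\<sigma>\<^sub>s c > 0" by linarith
  show "(\<sigma>\<^sub>s c)\<^sup>2 = 1 + c\<^sup>2" by (simp add: \<sigma>\<^sub>s_def)
  show "\<sigma>\<^sub>s c \<ge> c" unfolding \<sigma>\<^sub>s_def by (rule real_le_rsqrt) simp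
qed

lemma nn_integral_phi1_mix:
  assumes "H \<in> borel_probs" "c > 0"
  shows "(\<integral>\<^sup>+\<theta>. ennreal (\<phi> 1 (x - \<theta>)) * ennreal (mix c H \<theta>) \<partial>lborel) = ennreal (mix (\<sigma>\<^sub>s c) H x)"
  using nn_integral_phi_mix[OF assms, of 1 x] by (simp add: \<sigma>\<^sub>s_def)

text \<open>The difference of the two posterior densities, multiplied by \<open>f x\<close>, splits into the smoothed difference of
the prior densities and a term coming from the different normalizations. Let \<open>Q x\<close> be the noise density
integrated against \<open>\<bar>g' - g\<bar>\<close>. The first term integrates over \<open>\<theta>\<close> to \<open>Q x\<close> and the second one to
\<open>\<bar>f x - f' x\<bar> \<le> Q x\<close>; the factor \<open>1 / 2\<close> of the total variation compensates for the two terms, and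
\<open>Q\<close> has the same integral as \<open>\<bar>g' - g\<bar>\<close>.\<close>

lemma wTV_le:
  assumes H': "H' \<in> borel_probs" and H: "H \<in> borel_probs" and c: "c > 0"
  shows "wTV c H' H \<le> (\<integral>\<^sup>+\<theta>. ennreal \<bar>mix c H' \<theta> - mix c H \<theta>\<bar> \<partial>lborel)"
proof -
  note [measurable] = measurable_mix[OF H] measurable_mix[OF H']
  define f f' where "f = mix (\<sigma>\<^sub>s c) H" and "f' = mix (\<sigma>\<^sub>s c) H'"
  define g g' where "g = mix c H" and "g' = mix c H'"
  define Q where "Q x = (\<integral>\<^sup>+\<theta>. ennreal (\<phi> 1 (x - \<theta>)) * ennreal \<bar>g' \<theta> - g \<theta>\<bar> \<partial>lborel)" for x
  have m[measurable]: "f \<in> borel_measurable borel" "f' \<in> borel_measurable borel"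
    "g \<in> borel_measurable borel" "g' \<in> borel_measurable borel"
    by (simp_all add: f_def f'_def g_def g'_def)
  have pos: "f x > 0" "f' x > 0" "g x \<ge> 0" "g' x \<ge> 0" for x
    using mix_pos[OF H sigma_s(2)] mix_pos[OF H' sigma_s(2)] by (auto simp: f_def f'_def g_def g'_def)
  have conv: "(\<integral>\<^sup>+\<theta>. ennreal (\<phi> 1 (x - \<theta>)) * ennreal (g \<theta>) \<partial>lborel) = ennreal (f x)"
    "(\<integral>\<^sup>+\<theta>. ennreal (\<phi> 1 (x - \<theta>)) * ennreal (g' \<theta>) \<partial>lborel) = ennreal (f' x)" for x
    unfolding f_def f'_def g_def g'_def by (rule nn_integral_phi1_mix; fact)+
  have Qm[measurable]: "Q \<in> borel_measurable borel" unfolding Q_def by measurable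
  have le_add: "ennreal (a x) \<le> ennreal (b x) + Q x"
    if "\<And>x. (\<integral>\<^sup>+\<theta>. ennreal (\<phi> 1 (x - \<theta>)) * ennreal (u \<theta>) \<partial>lborel) = ennreal (a x)"
      "\<And>x. (\<integral>\<^sup>+\<theta>. ennreal (\<phi> 1 (x - \<theta>)) * ennreal (v \<theta>) \<partial>lborel) = ennreal (b x)"
      and [measurable]: "u \<in> borel_measurable borel" "v \<in> borel_measurable borel"
      and uv: "\<And>\<theta>. u \<theta> \<ge> 0" "\<And>\<theta>. v \<theta> \<ge> 0" "\<And>\<theta>. \<bar>g' \<theta> - g \<theta>\<bar> = \<bar>u \<theta> - v \<theta>\<bar>" for a b u v :: "real \<Rightarrow> real" and x
  proof -
    have "ennreal (a x) = (\<integral>\<^sup>+\<theta>. ennreal (\<phi> 1 (x - \<theta>)) * ennreal (u \<theta>) \<partial>lborel)" by (simp add: that)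
    also have "\<dots> \<le> (\<integral>\<^sup>+\<theta>. ennreal (\<phi> 1 (x - \<theta>)) * ennreal (v \<theta>) + ennreal (\<phi> 1 (x - \<theta>)) * ennreal \<bar>g' \<theta> - g \<theta>\<bar> \<partial>lborel)"
    proof (rule nn_integral_mono)
      fix \<theta>
      have "u \<theta> \<le> v \<theta> + \<bar>g' \<theta> - g \<theta>\<bar>" using uv(3)[of \<theta>] by linarith
      then have "ennreal (u \<theta>) \<le> ennreal (v \<theta>) + ennreal \<bar>g' \<theta> - g \<theta>\<bar>"
        using uv(2) by (simp flip: ennreal_plus)
      then show "ennreal (\<phi> 1 (x - \<theta>)) * ennreal (u \<theta>) \<le> ennreal (\<phi> 1 (x - \<theta>)) * ennreal (v \<theta>) + ennreal (\<phi> 1 (x - \<theta>)) * ennreal \<bar>g' \<theta> - g \<theta>\<bar>"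
        by (metis distrib_left mult_left_mono zero_le)
    qed
    also have "\<dots> = ennreal (b x) + Q x"
      by (subst nn_integral_add) (auto simp: that Q_def)
    finally show ?thesis .
  qed
  have dQ: "ennreal \<bar>f x - f' x\<bar> \<le> Q x" for x
  proof (cases "Q x")
    case (real q)
    have "ennreal (f x) \<le> ennreal (f' x) + Q x"
      by (rule le_add[OF conv(1) conv(2)]) (use pos in auto)
    moreover have "ennreal (f' x) \<le> ennreal (f x) + Q x"
      by (rule le_add[OF conv(2) conv(1)]) (use pos in auto)
    ultimately show ?thesis
      using real pos[of x] by (auto simp flip: ennreal_plus simp: ennreal_le_iff2 abs_real_def)
  qed simp
  have inner: "TV (posterior c H' x) (posterior c H x) * ennreal (f_dens c H x) \<le> Q x" for x
  proof -
    have mp[measurable]: "posterior c H' x \<in> borel_measurable borel" "posterior c H x \<in> borel_measurable borel"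
      unfolding posterior_def g_dens_eq_mix by measurable
    have "(\<integral>\<^sup>+ \<theta>. ennreal \<bar>posterior c H' x \<theta> - posterior c H x \<theta>\<bar> \<partial>lborel) * ennreal (f x)
       = (\<integral>\<^sup>+ \<theta>. ennreal \<bar>posterior c H' x \<theta> - posterior c H x \<theta>\<bar> * ennreal (f x) \<partial>lborel)"
      by (rule nn_integral_multc[symmetric]) measurable
    also have "\<dots> \<le> (\<integral>\<^sup>+ \<theta>. ennreal (\<phi> 1 (x - \<theta>)) * ennreal \<bar>g' \<theta> - g \<theta>\<bar>
        + ennreal (\<bar>f x - f' x\<bar> / f' x) * (ennreal (\<phi> 1 (x - \<theta>)) * ennreal (g' \<theta>)) \<partial>lborel)"
    proof (rule nn_integral_mono)
      fix \<theta>
      let ?w = "\<phi> 1 (x - \<theta>)"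
      have "(posterior c H' x \<theta> - posterior c H x \<theta>) * f x = ?w * (g' \<theta> - g \<theta>) + ((f x - f' x) / f' x) * (?w * g' \<theta>)"
        using pos[of x] unfolding posterior_def g_dens_eq_mix f_dens_eq_mix f_def[symmetric] f'_def[symmetric] g_def[symmetric] g'_def[symmetric]
        by (simp add: field_simps)
      then have "\<bar>posterior c H' x \<theta> - posterior c H x \<theta>\<bar> * f x = \<bar>?w * (g' \<theta> - g \<theta>) + ((f x - f' x) / f' x) * (?w * g' \<theta>)\<bar>"
        using pos(1)[of x] by (metis abs_mult abs_of_pos)
      also have "\<dots> \<le> \<bar>?w * (g' \<theta> - g \<theta>)\<bar> + \<bar>((f x - f' x) / f' x) * (?w * g' \<theta>)\<bar>" by (rule abs_triangle_ineq)
      also have "\<dots> = ?w * \<bar>g' \<theta> - g \<theta>\<bar> + (\<bar>f x - f' x\<bar> / f' x) * (?w * g' \<theta>)"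
        using pos(2)[of x] pos(4)[of \<theta>] by (simp add: abs_mult)
      finally have "ennreal (\<bar>posterior c H' x \<theta> - posterior c H x \<theta>\<bar> * f x) \<le> ennreal (?w * \<bar>g' \<theta> - g \<theta>\<bar> + (\<bar>f x - f' x\<bar> / f' x) * (?w * g' \<theta>))"
        by (rule ennreal_leI)
      then show "ennreal \<bar>posterior c H' x \<theta> - posterior c H x \<theta>\<bar> * ennreal (f x)
        \<le> ennreal ?w * ennreal \<bar>g' \<theta> - g \<theta>\<bar> + ennreal (\<bar>f x - f' x\<bar> / f' x) * (ennreal ?w * ennreal (g' \<theta>))"
        using pos(1,2)[of x] pos(4)[of \<theta>]
        by (simp add: ennreal_mult less_imp_le del: times_divide_eq_left times_divide_eq_right)
    qed
    also have "\<dots> = Q x + ennreal (\<bar>f x - f' x\<bar> / f' x) * ennreal (f' x)"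
      by (subst nn_integral_add) (auto simp: Q_def nn_integral_cmult conv)
    also have "ennreal (\<bar>f x - f' x\<bar> / f' x) * ennreal (f' x) = ennreal \<bar>f x - f' x\<bar>"
      using pos(2)[of x] by (simp flip: ennreal_mult'')
    also have "Q x + ennreal \<bar>f x - f' x\<bar> \<le> Q x + Q x" by (intro add_left_mono dQ)
    finally have "(\<integral>\<^sup>+ \<theta>. ennreal \<bar>posterior c H' x \<theta> - posterior c H x \<theta>\<bar> \<partial>lborel) * ennreal (f x) \<le> Q x + Q x" .
    then have "((\<integral>\<^sup>+ \<theta>. ennreal \<bar>posterior c H' x \<theta> - posterior c H x \<theta>\<bar> \<partial>lborel) * ennreal (f x)) / 2 \<le> (Q x + Q x) / 2"
      by (rule divide_right_mono_ennreal)
    also have "(Q x + Q x) / 2 = Q x"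
      by (cases "Q x") (auto simp: ennreal_divide_numeral ennreal_top_divide simp flip: ennreal_plus)
    finally show ?thesis unfolding TV_def f_dens_eq_mix f_def[symmetric]
      by (simp add: divide_ennreal_def mult_ac)
  qed
  have "wTV c H' H \<le> (\<integral>\<^sup>+ x. Q x \<partial>lborel)"
    unfolding wTV_def by (intro nn_integral_mono inner)
  also have "\<dots> = (\<integral>\<^sup>+ \<theta>. (\<integral>\<^sup>+x. ennreal (\<phi> 1 (x - \<theta>)) * ennreal \<bar>g' \<theta> - g \<theta>\<bar> \<partial>lborel) \<partial>lborel)"
    unfolding Q_def by (rule lborel_pair.Fubini') measurable
  also have "\<dots> = (\<integral>\<^sup>+ \<theta>. ennreal \<bar>g' \<theta> - g \<theta>\<bar> \<partial>lborel)"
  proof (rule nn_integral_cong)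
    fix \<theta>
    have "(\<integral>\<^sup>+x. ennreal (\<phi> 1 (x - \<theta>)) \<partial>lborel) = 1"
      using nn_integral_real_affine[where c = 1 and t = \<theta> and f = "\<lambda>x. ennreal (\<phi> 1 (x - \<theta>))"]
      by (simp add: nn_integral_phi)
    then show "(\<integral>\<^sup>+x. ennreal (\<phi> 1 (x - \<theta>)) * ennreal \<bar>g' \<theta> - g \<theta>\<bar> \<partial>lborel) = ennreal \<bar>g' \<theta> - g \<theta>\<bar>"
      by (simp add: nn_integral_multc)
  qed
  finally show ?thesis by (simp add: g_def g'_def)
qed

lemma L1_mix_le_2:
  assumes H': "H' \<in> borel_probs" and H: "H \<in> borel_probs" and s: "s > 0"
  shows "(\<integral>\<^sup>+x. ennreal \<bar>mix s H' x - mix s H x\<bar> \<partial>lborel) \<le> 2"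
proof -
  note [measurable] = measurable_mix[OF H] measurable_mix[OF H']
  have "(\<integral>\<^sup>+x. ennreal \<bar>mix s H' x - mix s H x\<bar> \<partial>lborel) \<le> (\<integral>\<^sup>+x. ennreal (mix s H' x) + ennreal (mix s H x) \<partial>lborel)"
  proof (intro nn_integral_mono)
    fix x
    have "\<bar>mix s H' x - mix s H x\<bar> \<le> mix s H' x + mix s H x"
      using mix_nonneg[of s H x] mix_nonneg[of s H' x] by linarith
    then show "ennreal \<bar>mix s H' x - mix s H x\<bar> \<le> ennreal (mix s H' x) + ennreal (mix s H x)"
      by (simp flip: ennreal_plus)
  qed
  also have "\<dots> = 2" by (subst nn_integral_add) (auto simp: nn_integral_mix_1 assms)
  finally show ?thesis .
qed

text \<open>Both densities have mass one, so what the first one puts outside \<open>B\<close> is at most what the second one puts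
there plus the difference of their masses on \<open>B\<close>. In this way the tail of an estimated density is
controlled by the tail of the true one.\<close>

lemma L1_mix_split:
  assumes H': "H' \<in> borel_probs" and H: "H \<in> borel_probs" and s: "s > 0" and B[measurable]: "B \<in> sets borel"
  shows "(\<integral>\<^sup>+x. ennreal \<bar>mix s H' x - mix s H x\<bar> \<partial>lborel)
    \<le> 2 * (\<integral>\<^sup>+x. ennreal \<bar>mix s H' x - mix s H x\<bar> * indicator B x \<partial>lborel)
     + 2 * (\<integral>\<^sup>+x. ennreal (mix s H x) * indicator (- B) x \<partial>lborel)"
proof -
  note [measurable] = measurable_mix[OF H] measurable_mix[OF H']
  define g g' where "g = mix s H" and "g' = mix s H'"
  have [measurable]: "g \<in> borel_measurable borel" "g' \<in> borel_measurable borel" by (simp_all add: g_def g'_def)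
  have nn: "g x \<ge> 0" "g' x \<ge> 0" for x by (simp_all add: g_def g'_def)
  have split: "(\<integral>\<^sup>+x. u x \<partial>lborel) = (\<integral>\<^sup>+x. u x * indicator B x \<partial>lborel) + (\<integral>\<^sup>+x. u x * indicator (-B) x \<partial>lborel)"
    if [measurable]: "u \<in> borel_measurable borel" for u :: "real \<Rightarrow> ennreal"
    by (subst nn_integral_add[symmetric]) (auto intro!: nn_integral_cong simp: indicator_def)
  let ?I = "\<lambda>u A. \<integral>\<^sup>+x. ennreal (u x) * indicator A x \<partial>lborel"
  let ?d = "\<lambda>x. \<bar>g' x - g x\<bar>"
  have 1: "?I g B + ?I g (-B) = 1" "?I g' B + ?I g' (-B) = 1"
    using split[of "\<lambda>x. ennreal (g x)"] split[of "\<lambda>x. ennreal (g' x)"] nn_integral_mix_1[OF H s] nn_integral_mix_1[OF H' s]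
    by (simp_all add: g_def g'_def)
  have "?I g B \<le> (\<integral>\<^sup>+x. ennreal (g' x) * indicator B x + ennreal (?d x) * indicator B x \<partial>lborel)"
    using nn by (intro nn_integral_mono) (auto simp: indicator_def simp flip: ennreal_plus)
  also have "\<dots> = ?I g' B + ?I ?d B" by (rule nn_integral_add) measurable
  finally have "?I g' B + ?I g' (-B) \<le> ?I g' B + (?I ?d B + ?I g (-B))"
    unfolding 1(2) 1(1)[symmetric] add.assoc[symmetric] by (intro add_right_mono)
  moreover have "?I g' B \<noteq> top" using 1(2) by (metis ennreal_add_eq_top ennreal_one_neq_top)
  ultimately have 2: "?I g' (-B) \<le> ?I ?d B + ?I g (-B)"
    by (simp add: ennreal_add_left_cancel_le)
  have "?I ?d (-B) \<le> (\<integral>\<^sup>+x. ennreal (g' x) * indicator (-B) x + ennreal (g x) * indicator (-B) x \<partial>lborel)"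
    using nn by (intro nn_integral_mono) (auto simp: indicator_def abs_real_def add_increasing add_increasing2 simp flip: ennreal_plus)
  also have "\<dots> = ?I g' (-B) + ?I g (-B)" by (rule nn_integral_add) measurable
  also have "\<dots> \<le> ?I ?d B + ?I g (-B) + ?I g (-B)" by (intro add_right_mono 2)
  finally have "?I ?d B + ?I ?d (-B) \<le> ?I ?d B + (?I ?d B + ?I g (-B) + ?I g (-B))" by (rule add_left_mono)
  also have "\<dots> = 2 * ?I ?d B + 2 * ?I g (-B)" by (simp add: mult_2 add_ac)
  finally show ?thesis using split[of "\<lambda>x. ennreal (?d x)"] by (simp add: g_def g'_def)
qed

text \<open>Cauchy-Schwarz in the form \<open>\<bar>a\<bar> \<le> \<tau> + a\<^sup>2 / \<tau>\<close>; the free parameter lets \<open>\<tau>\<close> be chosen from an upper bound on the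
\<open>L\<^sup>2\<close> distance.\<close>

lemma L1_le_L2_on:
  assumes H': "H' \<in> borel_probs" and H: "H \<in> borel_probs" and s: "s > 0" and B[measurable]: "B \<in> sets borel"
    and fin: "emeasure lborel B < \<infinity>" and \<tau>: "\<tau> > 0"
  shows "(\<integral>\<^sup>+x. ennreal \<bar>mix s H' x - mix s H x\<bar> * indicator B x \<partial>lborel)
    \<le> ennreal (\<tau> * measure lborel B + mixL2 s H' H / \<tau>)"
proof -
  note [measurable] = measurable_mix[OF H] measurable_mix[OF H']
  define d where "d x = mix s H' x - mix s H x" for x
  have [measurable]: "d \<in> borel_measurable borel" unfolding d_def by measurable
  have pt: "\<bar>d x\<bar> \<le> \<tau> + (d x)\<^sup>2 / \<tau>" for x
  proof -
    have "\<bar>d x\<bar> * \<tau> \<le> \<tau>\<^sup>2 + \<bar>d x\<bar>\<^sup>2"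
      using sum_squares_bound[of "\<bar>d x\<bar>" \<tau>] mult_nonneg_nonneg[of "\<bar>d x\<bar>" \<tau>] \<tau> by linarith
    then show ?thesis using \<tau> by (simp add: field_simps power2_eq_square)
  qed
  have "(\<integral>\<^sup>+x. ennreal \<bar>d x\<bar> * indicator B x \<partial>lborel)
    \<le> (\<integral>\<^sup>+x. ennreal \<tau> * indicator B x + ennreal ((d x)\<^sup>2 / \<tau>) \<partial>lborel)"
    using pt \<tau> by (intro nn_integral_mono) (auto simp: indicator_def simp flip: ennreal_plus)
  also have "\<dots> = ennreal \<tau> * emeasure lborel B + (\<integral>\<^sup>+x. ennreal ((d x)\<^sup>2 / \<tau>) \<partial>lborel)"
    by (subst nn_integral_add) (auto simp: nn_integral_cmult)
  also have "(\<integral>\<^sup>+x. ennreal ((d x)\<^sup>2 / \<tau>) \<partial>lborel) = ennreal (mixL2 s H' H / \<tau>)"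
    using integrable_mix_diff_sq[OF H' H s] \<tau>
    by (subst nn_integral_eq_integral) (auto simp: mixL2_def d_def)
  also have "ennreal \<tau> * emeasure lborel B = ennreal (\<tau> * measure lborel B)"
    using fin \<tau> by (simp add: emeasure_eq_ennreal_measure ennreal_mult less_top)
  finally show ?thesis
    using \<tau> mixL2_nonneg[of s H' H] unfolding d_def by (simp flip: ennreal_plus)
qed

section \<open>Neighbourhoods of the support and tails outside them\<close>

lemma measurable_infdist [measurable]: "(\<lambda>x. infdist x S) \<in> borel_measurable borel"
  by (intro borel_measurable_continuous_onI continuous_intros)

lemma fatten_borel [measurable]: "fatten r S \<in> sets borel"
  unfolding fatten_def by measurable

lemma infdist_le_dist:
  fixes x s :: real
  shows "s \<in> S \<Longrightarrow> infdist x S \<le> \<bar>x - s\<bar>"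
  using infdist_le[of s S x] by (simp add: dist_real_def)

lemma infdist_attained:
  fixes x :: real
  assumes "compact S" "S \<noteq> {}"
  obtains s where "s \<in> S" "infdist x S = \<bar>x - s\<bar>"
  using infdist_attains_inf[of S x] assms by (metis compact_imp_closed dist_real_def)

lemma fatten_finite:
  assumes "compact S" "S \<noteq> {}"
  shows "emeasure lborel (fatten r S) < \<infinity>"
proof -
  obtain b where b: "\<And>s. s \<in> S \<Longrightarrow> \<bar>s\<bar> \<le> b"
    using compact_imp_bounded[OF assms(1)] by (auto simp: bounded_real)
  have "fatten r S \<subseteq> {- (b + r) .. b + r}"
  proof
    fix x assume "x \<in> fatten r S"
    moreover obtain s where "s \<in> S" "infdist x S = \<bar>x - s\<bar>" using infdist_attained[OF assms] .
    ultimately show "x \<in> {- (b + r) .. b + r}" using b[of s] by (auto simp: fatten_def)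
  qed
  then have "emeasure lborel (fatten r S) \<le> emeasure lborel {- (b + r) .. b + r}"
    by (intro emeasure_mono) auto
  also have "\<dots> < \<infinity>" by (simp add: emeasure_lborel_Icc_eq)
  finally show ?thesis .
qed

text \<open>A maximal \<open>2 r\<close>-separated subset of \<open>S\<close>: by maximality it is a \<open>2 r\<close>-net, and the intervals of radius \<open>r\<close>
around its points are disjoint and contained in the \<open>r\<close>-neighbourhood of \<open>S\<close>, which bounds their number.\<close>

lemma packing_net:
  assumes S: "compact S" "S \<noteq> {}" and r: "r > 0"
  obtains T :: "real set" where "finite T" "T \<subseteq> S" "T \<noteq> {}"
    "\<And>x. \<exists>t\<in>T. \<bar>x - t\<bar> \<le> infdist x S + 2 * r"
    "real (card T) * (2 * r) \<le> measure lborel (fatten r S)"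
proof -
  define P where "P T \<longleftrightarrow> finite T \<and> T \<subseteq> S \<and> (\<forall>a\<in>T. \<forall>b\<in>T. a \<noteq> b \<longrightarrow> \<bar>a - b\<bar> > 2 * r)" for T
  have card: "real (card T) * (2 * r) \<le> measure lborel (fatten r S)" if "P T" for T
  proof -
    have T: "finite T" "T \<subseteq> S" "\<And>a b. a \<in> T \<Longrightarrow> b \<in> T \<Longrightarrow> a \<noteq> b \<Longrightarrow> \<bar>a - b\<bar> > 2 * r"
      using that by (auto simp: P_def)
    have "real (card T) * (2 * r) = (\<Sum>t\<in>T. measure lborel {t - r .. t + r})" using r by simp
    also have "\<dots> = measure lborel (\<Union>t\<in>T. {t - r .. t + r})"
    proof (rule measure_finite_Union[symmetric])
      show "disjoint_family_on (\<lambda>t. {t - r .. t + r}) T"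
        unfolding disjoint_family_on_def using T(3) by force
    qed (auto simp: T emeasure_lborel_Icc_eq)
    also have "\<dots> \<le> measure lborel (fatten r S)"
    proof (rule measure_mono_fmeasurable)
      show "(\<Union>t\<in>T. {t - r .. t + r}) \<subseteq> fatten r S"
      proof
        fix x assume "x \<in> (\<Union>t\<in>T. {t - r .. t + r})"
        then obtain t where "t \<in> T" "\<bar>x - t\<bar> \<le> r" by (auto simp: abs_le_iff algebra_simps)
        then show "x \<in> fatten r S" using infdist_le_dist[of t S x] T(2) by (auto simp: fatten_def)
      qed
      show "fatten r S \<in> fmeasurable lborel"
        using fatten_finite[OF S, of r] by (intro fmeasurableI) auto
    qed (use T(1) in auto)
    finally show ?thesis .
  qed
  obtain s0 where s0: "s0 \<in> S" using S by auto
  have P0: "P {s0}" using s0 by (auto simp: P_def)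
  define K where "K = nat \<lceil>measure lborel (fatten r S) / (2 * r)\<rceil>"
  have bd: "card T \<le> K" if "P T" for T
  proof -
    have "real (card T) \<le> measure lborel (fatten r S) / (2 * r)"
      using card[OF that] r by (simp add: field_simps)
    then show ?thesis unfolding K_def by linarith
  qed
  obtain T where T: "P T" "\<And>T'. P T' \<Longrightarrow> card T' \<le> card T"
    using ex_has_greatest_nat[of P "{s0}" card "Suc K"] P0 bd by (auto simp: less_Suc_eq_le)
  show thesis
  proof (rule that[of T])
    show "finite T" "T \<subseteq> S" using T(1) by (auto simp: P_def)
    show "T \<noteq> {}" using T(2)[OF P0] by auto
    show "real (card T) * (2 * r) \<le> measure lborel (fatten r S)" by (rule card[OF T(1)])
    fix x
    obtain s where s: "s \<in> S" "infdist x S = \<bar>x - s\<bar>" using infdist_attained[OF S] .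
    have "\<exists>t\<in>T. \<bar>s - t\<bar> \<le> 2 * r"
    proof (rule ccontr)
      assume "\<not> ?thesis"
      then have far: "\<And>t. t \<in> T \<Longrightarrow> \<bar>s - t\<bar> > 2 * r" by force
      then have "P (insert s T)" using T(1) s(1) by (auto simp: P_def abs_minus_commute)
      moreover have "s \<notin> T" using far[of s] r by auto
      ultimately show False using T(2)[of "insert s T"] T(1) by (auto simp: P_def)
    qed
    then show "\<exists>t\<in>T. \<bar>x - t\<bar> \<le> infdist x S + 2 * r" using s(2) by force
  qed
qed

lemma ln_nat_ge_two_thirds:
  fixes n :: nat
  assumes "n \<ge> 2"
  shows "ln (real n) \<ge> 2 / 3"
proof -
  have "ln 2 \<le> ln (real n)" using assms by (subst ln_le_cancel_iff) auto
  then show ?thesis using ln2_ge_two_thirds by linarith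
qed

lemma cutoff_bounds:
  fixes \<sigma> L M :: real
  assumes sg: "\<sigma> \<ge> 1" and L: "L \<ge> 2 / 3" and M: "M \<ge> sqrt (10 * \<sigma>\<^sup>2 * L)"
  shows "sqrt L \<ge> 3 / 4" "M \<ge> 2 * \<sigma>" "M \<ge> 3 * sqrt L" "M \<ge> 3 * (\<sigma> * sqrt L)"
proof -
  show sL: "sqrt L \<ge> 3 / 4" using L by (intro real_le_rsqrt) (simp add: power2_eq_square)
  have "3 * \<sigma> * sqrt L = sqrt (9 * \<sigma>\<^sup>2 * L)" using sg by (simp add: real_sqrt_mult)
  also have "\<dots> \<le> sqrt (10 * \<sigma>\<^sup>2 * L)" using L by (intro real_sqrt_le_mono mult_right_mono) auto
  finally have Ms: "3 * \<sigma> * sqrt L \<le> M" using M by simp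
  have "3 * \<sigma> * (3 / 4) \<le> 3 * \<sigma> * sqrt L" using sL sg by (intro mult_left_mono) auto
  then show "M \<ge> 2 * \<sigma>" using Ms sg by linarith
  have "1 * (3 * sqrt L) \<le> \<sigma> * (3 * sqrt L)" using sg L by (intro mult_right_mono) auto
  then show "M \<ge> 3 * sqrt L" using Ms by (simp add: mult_ac)
  show "M \<ge> 3 * (\<sigma> * sqrt L)" using Ms by (simp add: mult_ac)
qed

text \<open>The logarithmic penalty at \<open>\<xi> + u\<close>. If \<open>\<bar>u\<bar> \<le> d \<xi>\<close>, the distance at \<open>\<xi> + u\<close> is at most \<open>2 d \<xi>\<close>, and
\<open>ln y \<le> y\<^sup>p / p \<le> L y\<^sup>p\<close> applies. Otherwise the noise is large, \<open>2 \<bar>u\<bar> > M\<close>; the constant 10 in the bound on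
\<open>M\<close> gives \<open>(u / s)\<^sup>2 \<ge> 5 L / 2\<close>, hence \<open>exp (2 (u / s)\<^sup>2 / 5) \<ge> exp L\<close>, and the remaining
\<open>exp ((u / s)\<^sup>2 / 20)\<close> dominates the polynomial growth. The exponent \<open>9 / 20 = 2 / 5 + 1 / 20\<close> stays below
\<open>1 / 2\<close>, so that the bound is integrable against the noise density.\<close>

lemma tail_pointwise:
  fixes d :: "real \<Rightarrow> real"
  assumes sg: "\<sigma> > 0" and s: "0 < s" "s \<le> \<sigma>" and L: "L \<ge> 1 / 2" and M: "M \<ge> sqrt (10 * \<sigma>\<^sup>2 * L)"
    and p: "p \<ge> 1 / L" and dd: "d (\<xi> + u) \<le> d \<xi> + \<bar>u\<bar>" and far: "d (\<xi> + u) > M"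
  shows "L + ln (d (\<xi> + u) / M) \<le> 2 * L * (2 * d \<xi> / M) powr p + 32 * L * exp (- L) * exp (9 / 20 * (u / s)\<^sup>2)"
proof -
  have L0: "L > 0" using L by simp
  have p0: "p > 0" using p L0 by (meson divide_pos_pos less_le_trans zero_less_one)
  have M0: "M > 0" using M L0 sg by (smt (verit) real_sqrt_gt_zero mult_pos_pos zero_less_power)
  have y1: "d (\<xi> + u) / M > 1" using far M0 by simp
  show ?thesis
  proof (cases "\<bar>u\<bar> \<le> d \<xi>")
    case True
    define y where "y = 2 * d \<xi> / M"
    have yy: "d (\<xi> + u) / M \<le> y" using True dd M0 by (simp add: y_def divide_right_mono)
    have y: "y > 1" using y1 yy by simp
    have "ln (d (\<xi> + u) / M) \<le> ln y" using yy y1 by (subst ln_le_cancel_iff) auto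
    also have "ln y \<le> L * y powr p"
    proof -
      have "p * ln y \<le> y powr p" using y ln_le_minus_one[of "y powr p"] by (simp add: ln_powr)
      then have "ln y \<le> y powr p / p" using p0 by (simp add: field_simps)
      also have "\<dots> = (1 / p) * y powr p" by simp
      also have "\<dots> \<le> L * y powr p" using p p0 L0 by (intro mult_right_mono) (auto simp: field_simps)
      finally show ?thesis .
    qed
    finally have "ln (d (\<xi> + u) / M) \<le> L * y powr p" .
    moreover have "L \<le> L * y powr p" using L0 y p0 by (simp add: ge_one_powr_ge_zero)
    ultimately have "L + ln (d (\<xi> + u) / M) \<le> 2 * L * y powr p" by linarith
    moreover have "0 \<le> 32 * L * exp (- L) * exp (9 / 20 * (u / s)\<^sup>2)" using L0 by simp
    ultimately show ?thesis unfolding y_def by linarith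
  next
    case False
    define y where "y = 2 * \<bar>u\<bar> / M"
    define w where "w = (u / s)\<^sup>2"
    have w0: "w \<ge> 0" by (simp add: w_def)
    have yy: "d (\<xi> + u) / M \<le> y" using False dd M0 by (simp add: y_def divide_right_mono)
    have y: "y > 1" using y1 yy by simp
    have M2: "10 * \<sigma>\<^sup>2 * L \<le> M\<^sup>2"
    proof -
      have "sqrt (10 * \<sigma>\<^sup>2 * L) ^ 2 \<le> M\<^sup>2" using M L0 by (intro power_mono) auto
      then show ?thesis using L0 by simp
    qed
    have "5 / 2 * L * y\<^sup>2 \<le> w"
    proof -
      have "s\<^sup>2 \<le> \<sigma>\<^sup>2" using s by (intro power_mono) auto
      then have "10 * s\<^sup>2 * L \<le> M\<^sup>2" using M2 L0 by (smt (verit) mult_right_mono)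
      then have "(10 * s\<^sup>2 * L) * u\<^sup>2 \<le> M\<^sup>2 * u\<^sup>2" by (intro mult_right_mono) auto
      then have "10 * L * u\<^sup>2 / M\<^sup>2 \<le> u\<^sup>2 / s\<^sup>2"
        using M0 s(1) by (simp add: divide_le_eq pos_le_divide_eq mult_ac)
      then show ?thesis by (simp add: y_def w_def power_divide power_mult_distrib mult_ac)
    qed
    then have wy: "L * y\<^sup>2 \<le> 2 / 5 * w" by simp
    have yL: "L \<le> L * y\<^sup>2" using y L0 by (simp add: one_le_power)
    have "ln (d (\<xi> + u) / M) \<le> ln y" using yy y1 by (subst ln_le_cancel_iff) auto
    also have "\<dots> \<le> y" using y ln_le_minus_one[of y] by simp
    also have "\<dots> \<le> y\<^sup>2" using y by (simp add: power2_eq_square)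
    also have "\<dots> \<le> 2 * (L * y\<^sup>2)" using mult_right_mono[of 1 "2 * L" "y\<^sup>2"] L by simp
    also have "\<dots> \<le> 4 / 5 * w" using wy by simp
    finally have "L + ln (d (\<xi> + u) / M) \<le> L + 4 / 5 * w" by simp
    also have "\<dots> \<le> 32 * L * (1 + w / 20)"
    proof -
      have "1 * w \<le> (2 * L) * w" using L w0 by (intro mult_right_mono) auto
      then have "4 / 5 * w \<le> 8 / 5 * (L * w)" by simp
      then show ?thesis using L0 by (simp add: algebra_simps)
    qed
    also have "\<dots> \<le> 32 * L * exp (w / 20)" using L0 by (intro mult_left_mono exp_ge_add_one_self) auto
    also have "\<dots> \<le> 32 * L * (exp (- L) * exp (9 / 20 * w))"
    proof -
      have "w / 20 \<le> - L + 9 / 20 * w" using wy yL by simp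
      then show ?thesis using L0 by (intro mult_left_mono) (simp_all flip: exp_add)
    qed
    finally have "L + ln (d (\<xi> + u) / M) \<le> 32 * L * exp (- L) * exp (9 / 20 * (u / s)\<^sup>2)"
      by (simp only: w_def mult.assoc)
    moreover have "0 \<le> 2 * L * (2 * d \<xi> / M) powr p" using L0 by simp
    ultimately show ?thesis by linarith
  qed
qed

lemma phi_exp_tilt:
  assumes s: "s > 0"
  shows "\<phi> s u * exp (9 / 20 * (u / s)\<^sup>2) = sqrt 10 * \<phi> (sqrt 10 * s) u"
proof -
  have "- (u\<^sup>2 / (2 * s\<^sup>2)) + 9 / 20 * (u / s)\<^sup>2 = - (u\<^sup>2 / (2 * (sqrt 10 * s)\<^sup>2))"
    using s by (simp add: field_simps power2_eq_square)
  then have "exp (- (u\<^sup>2 / (2 * s\<^sup>2))) * exp (9 / 20 * (u / s)\<^sup>2) = exp (- (u\<^sup>2 / (2 * (sqrt 10 * s)\<^sup>2)))"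
    by (simp only: exp_add[symmetric])
  moreover have "1 / sqrt (2 * pi * s\<^sup>2) = sqrt 10 * (1 / sqrt (2 * pi * (sqrt 10 * s)\<^sup>2))"
    using s by (simp add: real_sqrt_mult)
  ultimately show ?thesis by (simp add: normal_density_def mult.assoc)
qed

text \<open>The first term of \<open>tail_pointwise\<close> integrates to the moment of the mixing measure. By \<open>phi_exp_tilt\<close> the
exponential factor turns the noise density into \<open>sqrt 10\<close> times a wider normal density, so the second
term is of order \<open>L exp (- L)\<close>.\<close>

lemma mixture_tail:
  assumes H: "H \<in> borel_probs" and sg: "\<sigma> > 0" and s: "0 < s" "s \<le> \<sigma>" and L: "L \<ge> 1 / 2"
    and M: "M \<ge> sqrt (10 * \<sigma>\<^sup>2 * L)" and p: "p \<ge> 1 / L"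
  shows "(\<integral>\<^sup>+x. ennreal (L + ln (infdist x S / M)) * indicator (- fatten M S) x * ennreal (mix s H x) \<partial>lborel)
    \<le> ennreal (2 * L) * (\<integral>\<^sup>+\<xi>. ennreal ((2 * infdist \<xi> S / M) powr p) \<partial>H) + ennreal (128 * L * exp (- L))"
proof -
  note [measurable_cong] = borel_probsD(2)[OF H]
  have L0: "L > 0" using L by simp
  let ?d = "\<lambda>x. infdist x S"
  let ?F = "\<lambda>\<xi>. (2 * ?d \<xi> / M) powr p"
  let ?E = "32 * L * exp (- L)"
  have inner: "(\<integral>\<^sup>+z. ennreal (L + ln (?d (\<xi> + z) / M)) * indicator (- fatten M S) (\<xi> + z) * ennreal (\<phi> s z) \<partial>lborel)
     \<le> ennreal (2 * L) * ennreal (?F \<xi>) + ennreal (128 * L * exp (- L))" for \<xi>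
  proof -
    have "(\<integral>\<^sup>+z. ennreal (L + ln (?d (\<xi> + z) / M)) * indicator (- fatten M S) (\<xi> + z) * ennreal (\<phi> s z) \<partial>lborel)
      \<le> (\<integral>\<^sup>+z. ennreal (2 * L * ?F \<xi>) * ennreal (\<phi> s z) + ennreal (?E * sqrt 10) * ennreal (\<phi> (sqrt 10 * s) z) \<partial>lborel)"
    proof (rule nn_integral_mono)
      fix z
      show "ennreal (L + ln (?d (\<xi> + z) / M)) * indicator (- fatten M S) (\<xi> + z) * ennreal (\<phi> s z)
        \<le> ennreal (2 * L * ?F \<xi>) * ennreal (\<phi> s z) + ennreal (?E * sqrt 10) * ennreal (\<phi> (sqrt 10 * s) z)"
      proof (cases "\<xi> + z \<in> fatten M S")
        case False
        then have far: "?d (\<xi> + z) > M" by (simp add: fatten_def)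
        have "?d (\<xi> + z) \<le> ?d \<xi> + \<bar>z\<bar>"
          using infdist_triangle[of "\<xi> + z" S \<xi>] by (simp add: dist_real_def)
        from tail_pointwise[of \<sigma> s L M p ?d, OF sg s L M p this far]
        have "(L + ln (?d (\<xi> + z) / M)) * \<phi> s z \<le> (2 * L * ?F \<xi> + ?E * exp (9 / 20 * (z / s)\<^sup>2)) * \<phi> s z"
          by (intro mult_right_mono) auto
        also have "\<dots> = 2 * L * ?F \<xi> * \<phi> s z + ?E * (\<phi> s z * exp (9 / 20 * (z / s)\<^sup>2))"
          by (simp add: algebra_simps)
        also have "\<dots> = 2 * L * ?F \<xi> * \<phi> s z + ?E * sqrt 10 * \<phi> (sqrt 10 * s) z"
          by (simp only: phi_exp_tilt[OF s(1)] mult.assoc)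
        finally have "(L + ln (?d (\<xi> + z) / M)) * \<phi> s z \<le> \<dots>" .
        then have "ennreal ((L + ln (?d (\<xi> + z) / M)) * \<phi> s z) \<le> ennreal (2 * L * ?F \<xi> * \<phi> s z + ?E * sqrt 10 * \<phi> (sqrt 10 * s) z)"
          by (rule ennreal_leI)
        then show ?thesis using False L0
          by (simp add: ennreal_mult'' ennreal_plus)
      qed simp
    qed
    also have "\<dots> = ennreal (2 * L * ?F \<xi>) + ennreal (?E * sqrt 10)"
      using s(1) by (subst nn_integral_add) (auto simp: nn_integral_cmult nn_integral_phi)
    also have "\<dots> \<le> ennreal (2 * L) * ennreal (?F \<xi>) + ennreal (128 * L * exp (- L))"
    proof -
      have "sqrt 10 \<le> 4" by (rule real_le_lsqrt) auto
      then have "?E * sqrt 10 \<le> ?E * 4" using L0 by (intro mult_left_mono) auto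
      then show ?thesis using L0 by (intro add_mono ennreal_leI) (auto simp: ennreal_mult)
    qed
    finally show ?thesis .
  qed
  have "(\<integral>\<^sup>+x. ennreal (L + ln (?d x / M)) * indicator (- fatten M S) x * ennreal (mix s H x) \<partial>lborel)
    = (\<integral>\<^sup>+\<xi>. (\<integral>\<^sup>+z. ennreal (L + ln (?d (\<xi> + z) / M)) * indicator (- fatten M S) (\<xi> + z) * ennreal (\<phi> s z) \<partial>lborel) \<partial>H)"
    by (rule nn_integral_mix[OF H s(1)]) measurable
  also have "\<dots> \<le> (\<integral>\<^sup>+\<xi>. ennreal (2 * L) * ennreal (?F \<xi>) + ennreal (128 * L * exp (- L)) \<partial>H)"
    by (intro nn_integral_mono inner)
  also have "\<dots> = ennreal (2 * L) * (\<integral>\<^sup>+\<xi>. ennreal (?F \<xi>) \<partial>H) + ennreal (128 * L * exp (- L))"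
    using borel_probsD[OF H] prob_space.emeasure_space_1[OF borel_probsD(1)[OF H]]
    by (subst nn_integral_add) (auto simp: nn_integral_cmult)
  finally show ?thesis .
qed

text \<open>The extended power of the moment becomes an integral over \<open>H\<close>, the form in which the tail bounds produce it.\<close>

lemma epowr_moment:
  assumes H: "H \<in> borel_probs" and p: "p > 0" and M: "M > 0"
  shows "epowr (2 * moment p S H / ennreal M) p = (\<integral>\<^sup>+\<xi>. ennreal ((2 * infdist \<xi> S / M) powr p) \<partial>H)"
proof -
  note [measurable_cong] = borel_probsD(2)[OF H]
  define I where "I = (\<integral>\<^sup>+\<xi>. ennreal (infdist \<xi> S powr p) \<partial>H)"
  have rhs: "(\<integral>\<^sup>+\<xi>. ennreal ((2 * infdist \<xi> S / M) powr p) \<partial>H) = ennreal ((2 / M) powr p) * I"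
  proof -
    have "ennreal ((2 * infdist \<xi> S / M) powr p) = ennreal ((2 / M) powr p) * ennreal (infdist \<xi> S powr p)" for \<xi>
    proof -
      have "(2 * infdist \<xi> S / M) = (2 / M) * infdist \<xi> S" by simp
      then have "(2 * infdist \<xi> S / M) powr p = (2 / M) powr p * infdist \<xi> S powr p"
        using M by (simp only: powr_mult infdist_nonneg divide_nonneg_pos zero_le_numeral)
      then show ?thesis by (simp add: ennreal_mult)
    qed
    then show ?thesis unfolding I_def by (simp add: nn_integral_cmult)
  qed
  show ?thesis
  proof (cases I)
    case (real i)
    have "moment p S H = ennreal (i powr (1 / p))" using real
      by (simp add: moment_def epowr_def I_def[symmetric])
    then have "2 * moment p S H / ennreal M = ennreal (2 * i powr (1 / p) / M)"
      using M divide_ennreal[of "2 * i powr (1 / p)" M] by (simp add: ennreal_mult)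
    then have "epowr (2 * moment p S H / ennreal M) p = ennreal ((2 * i powr (1 / p) / M) powr p)"
      using M by (simp add: epowr_def)
    also have "(2 * i powr (1 / p) / M) powr p = (2 / M * i powr (1 / p)) powr p" by simp
    also have "\<dots> = (2 / M) powr p * i" using M p real
      by (subst powr_mult) (auto simp: powr_powr)
    also have "ennreal ((2 / M) powr p * i) = ennreal ((2 / M) powr p) * I" using real by (simp add: ennreal_mult)
    finally show ?thesis by (simp add: rhs)
  next
    case top
    have "moment p S H = top" using top by (simp add: moment_def epowr_def I_def[symmetric])
    then have "2 * moment p S H / ennreal M = top"
      using M by (simp add: ennreal_mult_top ennreal_top_divide)
    moreover have "(2 / M) powr p > 0" using M by simp
    ultimately show ?thesis unfolding rhs using top by (simp add: epowr_def ennreal_mult_top)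
  qed
qed

section \<open>Metric entropy of Gaussian mixtures\<close>

text \<open>Dividing \<open>\<phi> s (x - \<xi>)\<close> by \<open>\<phi> s (x - a)\<close> leaves the exponential series of \<open>y v\<close> times \<open>exp (- v\<^sup>2 / 2)\<close>, where
\<open>y = (x - a) / s\<close> and \<open>v = (\<xi> - a) / s\<close>. The factor \<open>1 / fact k\<close> of this series is shared between \<open>y ^ k\<close> and
\<open>v ^ k\<close>, which keeps the coefficients bounded by one for every mixing measure, however heavy its tails.\<close>

definition damped_moment :: "real \<Rightarrow> real measure \<Rightarrow> real \<Rightarrow> nat \<Rightarrow> real" where
  "damped_moment s H a k = (\<integral>\<xi>. ((\<xi> - a) / s) ^ k * exp (- ((\<xi> - a) / s)\<^sup>2 / 2) / sqrt (fact k) \<partial>H)"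

lemma damped_power_le: "\<bar>v ^ k * exp (- v\<^sup>2 / 2) / sqrt (fact k)\<bar> \<le> (1::real)"
proof -
  have "(v\<^sup>2) ^ k / fact k \<le> exp (v\<^sup>2)"
  proof -
    have "(v\<^sup>2) ^ k / fact k = (\<Sum>i\<in>{k}. (v\<^sup>2) ^ i / fact i)" by simp
    also have "\<dots> \<le> (\<Sum>i. (v\<^sup>2) ^ i / fact i)"
      using summable_exp[of "v\<^sup>2"] by (intro sum_le_suminf) (auto simp: divide_inverse mult.commute)
    also have "\<dots> = exp (v\<^sup>2)" by (simp add: exp_def divide_inverse mult.commute)
    finally show ?thesis .
  qed
  then have "(v\<^sup>2) ^ k \<le> exp (v\<^sup>2) * fact k" by (simp add: divide_le_eq)
  then have "sqrt ((v ^ k)\<^sup>2) \<le> sqrt ((exp (v\<^sup>2 / 2))\<^sup>2 * fact k)"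
    by (intro real_sqrt_le_mono) (simp add: exp_double[symmetric] power_mult[symmetric] mult.commute)
  then have "\<bar>v ^ k\<bar> \<le> exp (v\<^sup>2 / 2) * sqrt (fact k)" by (simp add: real_sqrt_mult)
  then have "\<bar>v ^ k\<bar> * exp (- v\<^sup>2 / 2) \<le> exp (v\<^sup>2 / 2) * sqrt (fact k) * exp (- v\<^sup>2 / 2)"
    by (intro mult_right_mono) auto
  also have "\<dots> = sqrt (fact k)"
    by (simp add: mult.commute mult.left_commute flip: exp_add)
  finally show ?thesis by (simp add: abs_mult)
qed

lemma integrable_damped:
  assumes "H \<in> borel_probs"
  shows "integrable H (\<lambda>\<xi>. ((\<xi> - a) / s) ^ k * exp (- ((\<xi> - a) / s)\<^sup>2 / 2) / sqrt (fact k))"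
proof -
  interpret prob_space H using borel_probsD[OF assms] by simp
  note [measurable_cong] = borel_probsD(2)[OF assms]
  show ?thesis
    by (rule integrable_const_bound[where B = 1]) (use damped_power_le in auto)
qed

lemma damped_moment_le:
  assumes "H \<in> borel_probs"
  shows "\<bar>damped_moment s H a k\<bar> \<le> 1"
proof -
  interpret prob_space H using borel_probsD[OF assms] by simp
  show ?thesis unfolding damped_moment_def
  proof (rule order_trans[OF integral_abs_bound], rule integral_le_const)
    show "AE \<xi> in H. \<bar>((\<xi> - a) / s) ^ k * exp (- ((\<xi> - a) / s)\<^sup>2 / 2) / sqrt (fact k)\<bar> \<le> 1"
      by (intro always_eventually allI damped_power_le)
  qed (intro integrable_abs integrable_damped assms)
qed

text \<open>Each term is a product of square roots, of \<open>(1 / 2) ^ k\<close> and of the exponential series at \<open>2 z\<^sup>2\<close>; the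
arithmetic-geometric mean inequality with balancing factor \<open>exp (z\<^sup>2)\<close> separates them.\<close>

lemma sqrt_fact_series:
  fixes z :: real
  assumes z: "z \<ge> 0"
  shows "summable (\<lambda>k. z ^ k / sqrt (fact k))" "(\<Sum>k. z ^ k / sqrt (fact k)) \<le> 3 / 2 * exp (z\<^sup>2)"
proof -
  define t where "t = exp (z\<^sup>2)"
  have t: "t > 0" by (simp add: t_def)
  let ?b = "\<lambda>k. t / 2 * (1 / 2) ^ k + 1 / (2 * t) * ((2 * z\<^sup>2) ^ k / fact k)"
  have s1: "(\<lambda>k. t / 2 * (1 / 2) ^ k) sums (t / 2 * 2)"
    using geometric_sums[of "1 / 2 :: real"] by (intro sums_mult) simp
  have s2: "(\<lambda>k. 1 / (2 * t) * ((2 * z\<^sup>2) ^ k / fact k)) sums (1 / (2 * t) * exp (2 * z\<^sup>2))"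
    using exp_converges[of "2 * z\<^sup>2"] by (intro sums_mult) (simp add: divide_inverse mult.commute)
  have bs: "?b sums (3 / 2 * exp (z\<^sup>2))"
  proof -
    have "t / 2 * 2 + 1 / (2 * t) * exp (2 * z\<^sup>2) = 3 / 2 * exp (z\<^sup>2)"
      using t by (simp add: t_def exp_double power2_eq_square)
    then show ?thesis using sums_add[OF s1 s2] by (simp only:)
  qed
  have le: "z ^ k / sqrt (fact k) \<le> ?b k" for k
  proof -
    define p q where "p = sqrt (t * (1 / 2) ^ k)" and "q = sqrt (1 / t * ((2 * z\<^sup>2) ^ k / fact k))"
    have "p * q = sqrt ((z ^ k)\<^sup>2 / fact k)"
      unfolding p_def q_def real_sqrt_mult[symmetric] using t
      by (simp add: power_mult_distrib power_divide power_mult[symmetric] mult.commute)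
    then have pq: "p * q = z ^ k / sqrt (fact k)" using z by (simp add: real_sqrt_divide)
    have "2 * (p * q) \<le> p\<^sup>2 + q\<^sup>2" using sum_squares_bound[of p q] by simp
    also have "p\<^sup>2 = t * (1 / 2) ^ k" using t by (simp add: p_def)
    also have "q\<^sup>2 = 1 / t * ((2 * z\<^sup>2) ^ k / fact k)" using t by (simp add: q_def)
    finally have "2 * (p * q) \<le> t * (1 / 2) ^ k + 1 / t * ((2 * z\<^sup>2) ^ k / fact k)" .
    moreover have "?b k = (t * (1 / 2) ^ k + 1 / t * ((2 * z\<^sup>2) ^ k / fact k)) / 2"
      by (simp add: add_divide_distrib)
    ultimately show ?thesis unfolding pq[symmetric] by linarith
  qed
  show sm: "summable (\<lambda>k. z ^ k / sqrt (fact k))"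
    by (rule summable_comparison_test'[OF sums_summable[OF bs], of 0]) (use le z in simp)
  show "(\<Sum>k. z ^ k / sqrt (fact k)) \<le> 3 / 2 * exp (z\<^sup>2)"
    using suminf_le[OF le sm sums_summable[OF bs]] sums_unique[OF bs] by simp
qed

lemma mix_expansion:
  assumes H: "H \<in> borel_probs" and s: "s > 0"
  shows "(\<lambda>k. ((x - a) / s) ^ k / sqrt (fact k) * damped_moment s H a k) sums (mix s H x / \<phi> s (x - a))"
proof -
  interpret prob_space H using borel_probsD[OF H] by simp
  note [measurable_cong] = borel_probsD(2)[OF H]
  define y where "y = (x - a) / s"
  define h where "h k \<xi> = y ^ k / sqrt (fact k) * (((\<xi> - a) / s) ^ k * exp (- ((\<xi> - a) / s)\<^sup>2 / 2) / sqrt (fact k))" for k and \<xi> :: real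
  have ph: "\<phi> s (x - a) > 0" using s by (simp add: normal_density_pos)
  have hint: "integrable H (h k)" for k unfolding h_def by (intro integrable_mult_right integrable_damped H)
  have hb: "\<bar>h k \<xi>\<bar> \<le> \<bar>y\<bar> ^ k / sqrt (fact k)" for k \<xi>
  proof -
    have "\<bar>h k \<xi>\<bar> = \<bar>y\<bar> ^ k / sqrt (fact k) * \<bar>((\<xi> - a) / s) ^ k * exp (- ((\<xi> - a) / s)\<^sup>2 / 2) / sqrt (fact k)\<bar>"
      unfolding h_def by (simp add: abs_mult power_abs)
    also have "\<dots> \<le> \<bar>y\<bar> ^ k / sqrt (fact k) * 1" by (intro mult_left_mono damped_power_le) auto
    finally show ?thesis by simp
  qed
  have hs: "(\<lambda>k. h k \<xi>) sums (\<phi> s (x - \<xi>) / \<phi> s (x - a))" for \<xi>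
  proof -
    define v where "v = (\<xi> - a) / s"
    have "h k \<xi> = exp (- v\<^sup>2 / 2) * ((y * v) ^ k / fact k)" for k
    proof -
      have "h k \<xi> = exp (- v\<^sup>2 / 2) * (y ^ k * v ^ k / (sqrt (fact k) * sqrt (fact k)))"
        unfolding h_def v_def[symmetric] by simp
      then show ?thesis by (simp add: power_mult_distrib)
    qed
    moreover have "(\<lambda>k. exp (- v\<^sup>2 / 2) * ((y * v) ^ k / fact k)) sums (exp (- v\<^sup>2 / 2) * exp (y * v))"
      using exp_converges[of "y * v"] by (intro sums_mult) (simp add: divide_inverse mult.commute)
    moreover have "exp (- v\<^sup>2 / 2) * exp (y * v) = \<phi> s (x - \<xi>) / \<phi> s (x - a)"
    proof -
      have "- v\<^sup>2 / 2 + y * v = - ((x - \<xi>)\<^sup>2 / (2 * s\<^sup>2)) - (- ((x - a)\<^sup>2 / (2 * s\<^sup>2)))"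
        using s unfolding v_def y_def by (simp add: field_simps power2_eq_square)
      then have "exp (- v\<^sup>2 / 2) * exp (y * v) = exp (- ((x - \<xi>)\<^sup>2 / (2 * s\<^sup>2))) / exp (- ((x - a)\<^sup>2 / (2 * s\<^sup>2)))"
        by (simp only: exp_add[symmetric] exp_diff[symmetric])
      then show ?thesis using s by (simp add: normal_density_def)
    qed
    ultimately show ?thesis by simp
  qed
  have "(\<lambda>k. \<integral>\<xi>. h k \<xi> \<partial>H) sums (\<integral>\<xi>. (\<Sum>k. h k \<xi>) \<partial>H)"
  proof (rule sums_integral)
    show "AE \<xi> in H. summable (\<lambda>k. norm (h k \<xi>))"
    proof (intro always_eventually allI)
      fix \<xi>
      show "summable (\<lambda>k. norm (h k \<xi>))"
        by (rule summable_comparison_test'[OF sqrt_fact_series(1)[of "\<bar>y\<bar>"], of 0]) (use hb in auto)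
    qed
    show "summable (\<lambda>k. \<integral>\<xi>. norm (h k \<xi>) \<partial>H)"
    proof (rule summable_comparison_test'[OF sqrt_fact_series(1)[of "\<bar>y\<bar>"], of 0])
      fix k
      have "(\<integral>\<xi>. norm (h k \<xi>) \<partial>H) \<le> \<bar>y\<bar> ^ k / sqrt (fact k)"
        using hb by (intro integral_le_const integrable_norm hint) auto
      then show "norm (\<integral>\<xi>. norm (h k \<xi>) \<partial>H) \<le> \<bar>y\<bar> ^ k / sqrt (fact k)" by simp
    qed simp
  qed (rule hint)
  moreover have "(\<integral>\<xi>. (\<Sum>k. h k \<xi>) \<partial>H) = mix s H x / \<phi> s (x - a)"
    using hs by (simp add: sums_iff mix_def)
  moreover have "(\<integral>\<xi>. h k \<xi> \<partial>H) = y ^ k / sqrt (fact k) * damped_moment s H a k" for k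
    unfolding h_def damped_moment_def by simp
  ultimately show ?thesis by (simp add: y_def)
qed

text \<open>The first \<open>D\<close> coefficients differ by at most \<open>\<delta>\<close>. For \<open>k \<ge> D\<close> they differ by at most \<open>2 \<le> 2 \<cdot> 2\<^sup>k / 2\<^sup>D\<close>, and the
factor \<open>2\<^sup>k\<close> is absorbed by evaluating the majorizing series at \<open>2 z\<close>; so truncation costs \<open>2 / 2\<^sup>D\<close>.\<close>

lemma mix_close_if_moments_close:
  assumes H: "H \<in> borel_probs" and H': "H' \<in> borel_probs" and s: "s > 0"
    and z: "\<bar>x - a\<bar> \<le> s * z" and \<delta>: "\<delta> \<ge> 0"
    and cl: "\<And>k. k < D \<Longrightarrow> \<bar>damped_moment s H a k - damped_moment s H' a k\<bar> \<le> \<delta>"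
  shows "\<bar>mix s H x - mix s H' x\<bar> \<le> \<phi> s (x - a) * (\<delta> * (3 / 2 * exp (z\<^sup>2)) + 2 / 2 ^ D * (3 / 2 * exp (4 * z\<^sup>2)))"
proof -
  define y where "y = (x - a) / s"
  have yz: "\<bar>y\<bar> \<le> z" using z s by (simp add: y_def divide_le_eq mult.commute)
  then have z0: "z \<ge> 0" by simp
  have ph: "\<phi> s (x - a) > 0" using s by (simp add: normal_density_pos)
  let ?\<Delta> = "\<lambda>k. damped_moment s H a k - damped_moment s H' a k"
  have sm: "(\<lambda>k. y ^ k / sqrt (fact k) * ?\<Delta> k) sums ((mix s H x - mix s H' x) / \<phi> s (x - a))"
    using sums_diff[OF mix_expansion[OF H s, of x a] mix_expansion[OF H' s, of x a]]
    by (simp add: y_def right_diff_distrib diff_divide_distrib)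
  let ?b = "\<lambda>k. \<delta> * (z ^ k / sqrt (fact k)) + 2 / 2 ^ D * ((2 * z) ^ k / sqrt (fact k))"
  have bsm: "summable ?b"
    by (intro summable_add summable_mult sqrt_fact_series) (use z0 in auto)
  have le: "\<bar>y ^ k / sqrt (fact k) * ?\<Delta> k\<bar> \<le> ?b k" for k
  proof -
    have D: "\<bar>?\<Delta> k\<bar> \<le> \<delta> + 2 / 2 ^ D * 2 ^ k"
    proof (cases "k < D")
      case True
      then show ?thesis using cl[OF True] by (simp add: add_increasing2)
    next
      case False
      then have "(2::real) ^ D \<le> 2 ^ k" by (intro power_increasing) auto
      then have "(2::real) \<le> 2 / 2 ^ D * 2 ^ k" by (simp add: field_simps)
      moreover have "\<bar>?\<Delta> k\<bar> \<le> 2" using damped_moment_le[OF H, of s a k] damped_moment_le[OF H', of s a k] by linarith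
      ultimately show ?thesis using \<delta> by linarith
    qed
    have "\<bar>y ^ k / sqrt (fact k) * ?\<Delta> k\<bar> = \<bar>y\<bar> ^ k / sqrt (fact k) * \<bar>?\<Delta> k\<bar>" by (simp add: abs_mult power_abs)
    also have "\<dots> \<le> z ^ k / sqrt (fact k) * (\<delta> + 2 / 2 ^ D * 2 ^ k)"
      using yz z0 \<delta> D by (intro mult_mono divide_right_mono power_mono) auto
    also have "\<dots> = ?b k" by (simp add: power_mult_distrib ring_distribs mult_ac)
    finally show ?thesis .
  qed
  have "\<bar>(mix s H x - mix s H' x) / \<phi> s (x - a)\<bar> \<le> (\<Sum>k. ?b k)"
  proof -
    have sa: "summable (\<lambda>k. \<bar>y ^ k / sqrt (fact k) * ?\<Delta> k\<bar>)"
      by (rule summable_comparison_test'[OF bsm, of 0]) (use le in simp)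
    have "\<bar>\<Sum>k. y ^ k / sqrt (fact k) * ?\<Delta> k\<bar> \<le> (\<Sum>k. \<bar>y ^ k / sqrt (fact k) * ?\<Delta> k\<bar>)"
      by (rule summable_rabs[OF sa])
    also have "\<dots> \<le> (\<Sum>k. ?b k)" by (rule suminf_le[OF le sa bsm])
    finally show ?thesis using sums_unique[OF sm] by simp
  qed
  also have "(\<Sum>k. ?b k) = \<delta> * (\<Sum>k. z ^ k / sqrt (fact k)) + 2 / 2 ^ D * (\<Sum>k. (2 * z) ^ k / sqrt (fact k))"
    using sqrt_fact_series(1)[of z] sqrt_fact_series(1)[of "2 * z"] z0
    by (subst suminf_add[symmetric]) (auto intro!: summable_mult simp: suminf_mult simp del: times_divide_eq_left times_divide_eq_right)
  also have "\<dots> \<le> \<delta> * (3 / 2 * exp (z\<^sup>2)) + 2 / 2 ^ D * (3 / 2 * exp (4 * z\<^sup>2))"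
    using sqrt_fact_series(2)[of z] sqrt_fact_series(2)[of "2 * z"] z0 \<delta>
    by (intro add_mono mult_left_mono) (auto simp: power_mult_distrib)
  finally show ?thesis using ph by (simp add: abs_mult divide_le_eq mult.commute)
qed

text \<open>From each class one takes a member whose \<open>gap\<close> is at least half the supremum over the class, which need
not be attained. A bound on the gaps of the finitely many representatives then controls the gap of every
member, however a member is chosen from its class.\<close>

lemma finite_representatives:
  fixes gap :: "'a \<Rightarrow> real"
  assumes fin: "finite (code ` P)" and gap: "\<And>H. H \<in> P \<Longrightarrow> 0 \<le> gap H \<and> gap H \<le> b"
  shows "\<exists>R. R \<subseteq> P \<and> finite R \<and> card R \<le> card (code ` P) \<and>
    (\<forall>H\<in>P. \<exists>r\<in>R. code r = code H \<and> gap H \<le> 2 * gap r)"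
proof -
  have ex: "\<exists>r\<in>P. code r = w \<and> (\<forall>H\<in>P. code H = w \<longrightarrow> gap H \<le> 2 * gap r)" if w: "w \<in> code ` P" for w
  proof -
    define C where "C = {H \<in> P. code H = w}"
    obtain H0 where H0: "H0 \<in> C" using w by (auto simp: C_def)
    have bdd: "bdd_above (gap ` C)" using gap by (auto simp: C_def bdd_above_def)
    show ?thesis
    proof (cases "(SUP H\<in>C. gap H) > 0")
      case True
      then have "(SUP H\<in>C. gap H) / 2 < (SUP H\<in>C. gap H)" by simp
      then obtain r where r: "r \<in> C" "(SUP H\<in>C. gap H) / 2 < gap r"
        using less_cSUP_iff[OF _ bdd, of "(SUP H\<in>C. gap H) / 2"] H0 by blast
      have "gap H \<le> 2 * gap r" if "H \<in> C" for H
        using cSUP_upper[OF that bdd] r(2) by linarith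
      then show ?thesis using r(1) by (auto simp: C_def)
    next
      case False
      have "gap H \<le> 2 * gap H0" if "H \<in> C" for H
        using cSUP_upper[OF that bdd] False gap[of H0] H0 by (auto simp: C_def)
      then show ?thesis using H0 by (auto simp: C_def)
    qed
  qed
  then obtain rep where rep: "\<And>w. w \<in> code ` P \<Longrightarrow> rep w \<in> P \<and> code (rep w) = w \<and> (\<forall>H\<in>P. code H = w \<longrightarrow> gap H \<le> 2 * gap (rep w))"
    by metis
  show ?thesis
    by (rule exI[of _ "rep ` code ` P"]) (use rep fin card_image_le[OF fin] in auto)
qed

lemma grid_covers:
  fixes t h M x :: real
  assumes h: "h > 0" and x: "\<bar>x - t\<bar> \<le> 2 * M"
  obtains k :: int where "k \<in> {- (\<lceil>M / h\<rceil> + 1) .. \<lceil>M / h\<rceil> + 1}" "\<bar>x - (t + 2 * h * of_int k)\<bar> \<le> h"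
proof -
  define k where "k = round ((x - t) / (2 * h))"
  have r: "\<bar>of_int k - (x - t) / (2 * h)\<bar> \<le> 1 / 2" unfolding k_def by (rule of_int_round_abs_le)
  then have "\<bar>of_int k - (x - t) / (2 * h)\<bar> * (2 * h) \<le> 1 / 2 * (2 * h)" using h by (intro mult_right_mono) auto
  then have "\<bar>(of_int k - (x - t) / (2 * h)) * (2 * h)\<bar> \<le> h" using h by (simp add: abs_mult)
  moreover have "(of_int k - (x - t) / (2 * h)) * (2 * h) = 2 * h * of_int k - (x - t)" using h by (simp add: field_simps)
  ultimately have d: "\<bar>x - (t + 2 * h * of_int k)\<bar> \<le> h" by (simp add: abs_le_iff)
  have "\<bar>(x - t) / (2 * h)\<bar> \<le> M / h" using x h by (simp add: abs_divide field_simps)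
  then have "\<bar>real_of_int k\<bar> \<le> M / h + 1 / 2" using r by linarith
  then have "\<bar>k\<bar> \<le> \<lceil>M / h\<rceil> + 1" by linarith
  then show thesis using that[of k] d by (auto simp: abs_le_iff)
qed

text \<open>Intervals of radius \<open>h = \<sigma> sqrt L\<close> cover the neighbourhood of \<open>T\<close>; with this radius the series of
\<open>mix_expansion\<close> is evaluated at \<open>z = sqrt L\<close>, so that the factors \<open>exp (z\<^sup>2)\<close> and \<open>exp (4 z\<^sup>2)\<close> of the error bound
are powers of \<open>n\<close>. Rounding the first \<open>D \<ge> 14 L\<close> coefficients at each centre to multiples of \<open>n\<^sup>-\<^sup>3\<close> then
leaves an error of at most \<open>n\<^sup>-\<^sup>2\<close>. There are at most \<open>4 M / h\<close> centres for each point of \<open>T\<close> and at most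
\<open>n\<^sup>5\<close> values for each coefficient, which gives the logarithmic count \<open>M L\<^sup>2 / sqrt L\<close> up to constants.\<close>

lemma mixture_entropy:
  fixes n :: nat and gap :: "real measure \<Rightarrow> real"
  assumes n: "n \<ge> 2" and sg: "\<sigma> \<ge> 1" and L: "L = ln (real n)"
    and M: "M \<ge> sqrt (10 * \<sigma>\<^sup>2 * L)" and T: "finite T" "T \<noteq> {}"
    and gap: "\<And>H. H \<in> borel_probs \<Longrightarrow> 0 \<le> gap H \<and> gap H \<le> b"
  obtains R where "R \<subseteq> borel_probs" "finite R" "ln (real (card R)) \<le> 320 * real (card T) * M * L powr (3 / 2)"
    "\<And>H. H \<in> borel_probs \<Longrightarrow> \<exists>r\<in>R. gap H \<le> 2 * gap r \<and>
      (\<forall>x t. t \<in> T \<longrightarrow> \<bar>x - t\<bar> \<le> 2 * M \<longrightarrow> \<bar>mix \<sigma> H x - mix \<sigma> r x\<bar> \<le> 1 / (real n)\<^sup>2)"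
proof -
  have L1: "L \<ge> 2 / 3" unfolding L by (rule ln_nat_ge_two_thirds[OF n])
  have M0: "M \<ge> 0" using order_trans[OF real_sqrt_ge_zero M] L1 by simp
  have expL: "exp L = real n" using n L by simp
  define h where "h = \<sigma> * sqrt L"
  have h: "h > 0" using sg L1 by (simp add: h_def)
  define K where "K = \<lceil>M / h\<rceil> + 1"
  define A where "A = (\<lambda>(t, k). t + 2 * h * of_int k) ` (T \<times> {- K .. K})"
  define D where "D = nat \<lceil>14 * L\<rceil>"
  define N where "N = int n ^ 3"
  define code where "code H = (\<lambda>(a, k) \<in> A \<times> {..<D}. \<lfloor>damped_moment \<sigma> H a k * real n ^ 3\<rfloor>)" for H
  have Mh: "M / h \<ge> 3"
    using cutoff_bounds(4)[OF sg L1 M] h by (simp add: h_def pos_le_divide_eq)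
  have K0: "K \<ge> 0" using Mh unfolding K_def by linarith
  have finA: "finite A" using T by (simp add: A_def)
  have cardA: "real (card A) \<le> real (card T) * (4 * (M / h))"
  proof -
    have "card A \<le> card (T \<times> {- K .. K})" unfolding A_def by (rule card_image_le) (use T in auto)
    then have "card A \<le> card T * nat (2 * K + 1)" using K0 by (simp add: card_cartesian_product)
    then have "real (card A) \<le> real (card T) * real (nat (2 * K + 1))" by (metis of_nat_le_iff of_nat_mult)
    also have "real (nat (2 * K + 1)) \<le> 4 * (M / h)"
    proof -
      have "real (nat (2 * K + 1)) = 2 * of_int K + 1" using K0 by simp
      moreover have "real_of_int K \<le> M / h + 2" unfolding K_def of_int_add of_int_1
        using of_int_ceiling_le_add_one[of "M / h"] by linarith
      ultimately show ?thesis using Mh by linarith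
    qed
    then have "real (card T) * real (nat (2 * K + 1)) \<le> real (card T) * (4 * (M / h))" by (intro mult_left_mono) auto
    finally show ?thesis .
  qed
  have D: "real D \<le> 16 * L" "real D \<ge> 14 * L" using L1 unfolding D_def by linarith+
  have codeP: "code ` borel_probs \<subseteq> (A \<times> {..<D}) \<rightarrow>\<^sub>E {- N .. N}"
  proof
    fix w assume "w \<in> code ` borel_probs"
    then obtain H where H: "H \<in> borel_probs" and w: "w = code H" by auto
    have "\<lfloor>damped_moment \<sigma> H a k * real n ^ 3\<rfloor> \<in> {- N .. N}" for a k
    proof -
      have "\<bar>damped_moment \<sigma> H a k * real n ^ 3\<bar> \<le> 1 * real n ^ 3"
        using mult_right_mono[OF damped_moment_le[OF H, of \<sigma> a k], of "real n ^ 3"] by (simp add: abs_mult)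
      then have "\<bar>damped_moment \<sigma> H a k * real n ^ 3\<bar> \<le> real_of_int N" by (simp add: N_def)
      then show ?thesis by (auto simp: abs_le_iff le_floor_iff floor_le_iff)
    qed
    then show "w \<in> (A \<times> {..<D}) \<rightarrow>\<^sub>E {- N .. N}" unfolding w code_def case_prod_beta by (intro restrict_PiE_iff[THEN iffD2]) simp
  qed
  have finE: "finite ((A \<times> {..<D}) \<rightarrow>\<^sub>E {- N .. N})" using finA by (intro finite_PiE) auto
  have fin: "finite (code ` borel_probs)" using codeP finE by (rule finite_subset)
  have "\<exists>R. R \<subseteq> borel_probs \<and> finite R \<and> card R \<le> card (code ` borel_probs) \<and>
    (\<forall>H\<in>borel_probs. \<exists>r\<in>R. code r = code H \<and> gap H \<le> 2 * gap r)"
    by (rule finite_representatives[OF fin]) (rule gap)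
  then obtain R where R: "R \<subseteq> borel_probs" "finite R" "card R \<le> card (code ` borel_probs)"
    "\<And>H. H \<in> borel_probs \<Longrightarrow> \<exists>r\<in>R. code r = code H \<and> gap H \<le> 2 * gap r"
    by blast
  show thesis
  proof (rule that[OF R(1,2)])
    have "card R \<le> card ((A \<times> {..<D}) \<rightarrow>\<^sub>E {- N .. N})"
      using R(3) card_mono[OF finE codeP] by linarith
    also have "\<dots> = nat (2 * N + 1) ^ (card A * D)"
      using finA by (simp add: card_PiE card_cartesian_product)
    also have "nat (2 * N + 1) \<le> n ^ 5"
    proof -
      have "2 * n ^ 3 + 1 \<le> 4 * n ^ 3" using n by simp
      also have "4 * n ^ 3 \<le> n ^ 2 * n ^ 3" using power_mono[of 2 n 2] n by (intro mult_right_mono) auto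
      also have "\<dots> = n ^ 5" by (simp flip: power_add)
      finally show ?thesis unfolding N_def by (simp add: nat_add_distrib nat_mult_distrib nat_power_eq)
    qed
    then have "nat (2 * N + 1) ^ (card A * D) \<le> (n ^ 5) ^ (card A * D)" by (rule power_mono) simp
    finally have "card R \<le> (n ^ 5) ^ (card A * D)" .
    then have cR: "real (card R) \<le> real n ^ (5 * (card A * D))"
      by (metis of_nat_le_iff of_nat_power power_mult)
    show "ln (real (card R)) \<le> 320 * real (card T) * M * L powr (3 / 2)"
    proof (cases "card R = 0")
      case True
      then show ?thesis using M0 by simp
    next
      case False
      then have "ln (real (card R)) \<le> ln (real n ^ (5 * (card A * D)))" using cR by (subst ln_le_cancel_iff) (use n in auto)
      also have "\<dots> = 5 * real (card A) * real D * L" using n L by (simp add: ln_realpow)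
      also have "\<dots> \<le> 5 * (real (card T) * (4 * (M / h))) * (16 * L) * L"
        using cardA D(1) L1 by (intro mult_right_mono mult_mono mult_left_mono) auto
      also have "\<dots> = 320 * real (card T) * (M / h * (L * L))" by simp
      also have "M / h * (L * L) = M / \<sigma> * L powr (3 / 2)"
      proof -
        have "L powr (3 / 2) = L * sqrt L" using L1 powr_add[of L 1 "1 / 2"] by (simp add: powr_half_sqrt)
        moreover have "L * L = L * sqrt L * sqrt L" using L1 by simp
        moreover have "M / h * (l * sqrt L * sqrt L) = M / \<sigma> * (l * sqrt L)" for l
          using L1 sg by (simp add: h_def)
        ultimately show ?thesis by metis
      qed
      also have "320 * real (card T) * (M / \<sigma> * L powr (3 / 2)) \<le> 320 * real (card T) * (M * L powr (3 / 2))"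
      proof -
        have "M / \<sigma> \<le> M / 1" using sg M0 by (intro frac_le) auto
        then have "M / \<sigma> \<le> M" by simp
        then show ?thesis by (intro mult_left_mono mult_right_mono) auto
      qed
      finally show ?thesis by (simp add: mult.assoc)
    qed
  next
    fix H assume H: "H \<in> borel_probs"
    obtain r where r: "r \<in> R" "code r = code H" "gap H \<le> 2 * gap r" using R(4)[OF H] by auto
    have rP: "r \<in> borel_probs" using r(1) R(1) by auto
    have "\<bar>mix \<sigma> H x - mix \<sigma> r x\<bar> \<le> 1 / (real n)\<^sup>2" if t: "t \<in> T" and x: "\<bar>x - t\<bar> \<le> 2 * M" for x t
    proof -
      obtain k where k: "k \<in> {- K .. K}" "\<bar>x - (t + 2 * h * of_int k)\<bar> \<le> h"
        using grid_covers[OF h x] unfolding K_def by metis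
      define a where "a = t + 2 * h * of_int k"
      have a: "a \<in> A" using t k(1) by (auto simp: A_def a_def)
      have n3: "real n ^ 3 > 0" using n by simp
      have cl: "\<bar>damped_moment \<sigma> H a j - damped_moment \<sigma> r a j\<bar> \<le> 1 / real n ^ 3" if "j < D" for j
      proof -
        have "\<lfloor>damped_moment \<sigma> H a j * real n ^ 3\<rfloor> = \<lfloor>damped_moment \<sigma> r a j * real n ^ 3\<rfloor>"
          using fun_cong[OF r(2), of "(a, j)"] a that by (simp add: code_def)
        then have "\<bar>damped_moment \<sigma> H a j * real n ^ 3 - damped_moment \<sigma> r a j * real n ^ 3\<bar> \<le> 1" by linarith
        then have "\<bar>damped_moment \<sigma> H a j - damped_moment \<sigma> r a j\<bar> * real n ^ 3 \<le> 1"
          by (simp add: abs_mult flip: left_diff_distrib)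
        then show ?thesis using n3 by (simp add: field_simps)
      qed
      have "\<bar>mix \<sigma> H x - mix \<sigma> r x\<bar> \<le> \<phi> \<sigma> (x - a) * (1 / real n ^ 3 * (3 / 2 * exp ((sqrt L)\<^sup>2)) + 2 / 2 ^ D * (3 / 2 * exp (4 * (sqrt L)\<^sup>2)))"
        using k(2) sg by (intro mix_close_if_moments_close[OF H rP] cl) (auto simp: a_def h_def)
      also have "\<dots> \<le> 1 / 2 * (1 / real n ^ 3 * (3 / 2 * exp ((sqrt L)\<^sup>2)) + 2 / 2 ^ D * (3 / 2 * exp (4 * (sqrt L)\<^sup>2)))"
      proof (rule mult_right_mono)
        have "sqrt (2 * pi) \<ge> sqrt 4" using pi_gt3 by (intro real_sqrt_le_mono) auto
        then have "sqrt (2 * pi) * \<sigma> \<ge> 2 * 1" using sg by (intro mult_mono) auto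
        then have "1 / (sqrt (2 * pi) * \<sigma>) \<le> 1 / 2" by (intro divide_left_mono) auto
        then show "\<phi> \<sigma> (x - a) \<le> 1 / 2" using phi_le[of \<sigma> "x - a"] sg by linarith
      qed (auto intro!: add_nonneg_nonneg)
      also have "\<dots> = 3 / 4 * (real n / real n ^ 3) + 3 / 2 * (real n ^ 4 / 2 ^ D)"
      proof -
        have "exp (4 * L) = real n ^ 4" using expL exp_of_nat_mult[of 4 L] by simp
        then show ?thesis using L1 expL by simp
      qed
      also have "\<dots> \<le> 3 / 4 * (1 / (real n)\<^sup>2) + 3 / 2 * (1 / 6 * (1 / (real n)\<^sup>2))"
      proof (intro add_mono mult_left_mono)
        show "real n / real n ^ 3 \<le> 1 / (real n)\<^sup>2" using n by (simp add: power2_eq_square power3_eq_cube)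
        have "real n ^ 9 = exp (9 * L)" using expL exp_of_nat_mult[of 9 L] by simp
        also have "\<dots> \<le> exp (real D * ln 2)"
        proof -
          have "9 * L \<le> (14 * L) * (2 / 3)" using L1 by simp
          also have "\<dots> \<le> real D * ln 2" using D(2) ln2_ge_two_thirds L1 by (intro mult_mono) auto
          finally show ?thesis by simp
        qed
        also have "\<dots> = 2 ^ D" by (simp add: exp_of_nat_mult)
        finally have n9: "real n ^ 9 \<le> 2 ^ D" .
        have "real n ^ 4 * (6 * (real n)\<^sup>2) \<le> real n ^ 4 * (real n ^ 3 * (real n)\<^sup>2)"
          using power_mono[of 2 "real n" 3] n by (intro mult_left_mono mult_right_mono) auto
        also have "\<dots> = real n ^ 9" by (simp flip: power_add)
        finally have "real n ^ 4 * (6 * (real n)\<^sup>2) \<le> 2 ^ D" using n9 by linarith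
        then show "real n ^ 4 / 2 ^ D \<le> 1 / 6 * (1 / (real n)\<^sup>2)" using n by (simp add: field_simps)
      qed auto
      also have "\<dots> = 1 / (real n)\<^sup>2" by simp
      finally show ?thesis .
    qed
    then show "\<exists>r\<in>R. gap H \<le> 2 * gap r \<and>
      (\<forall>x t. t \<in> T \<longrightarrow> \<bar>x - t\<bar> \<le> 2 * M \<longrightarrow> \<bar>mix \<sigma> H x - mix \<sigma> r x\<bar> \<le> 1 / (real n)\<^sup>2)"
      using r by auto
  qed
qed

section \<open>The law of the observations\<close>

text \<open>On the generating boxes the measure is a finite product of kernels, each measurable in its own
coordinate.\<close>

lemma measurable_PiM_kernel:
  fixes K :: "real \<Rightarrow> real measure"
  assumes I: "finite I" and K: "K \<in> borel \<rightarrow>\<^sub>M prob_algebra borel"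
  shows "(\<lambda>\<xi>. PiM I (\<lambda>i. K (\<xi> i))) \<in> PiM I (\<lambda>_. borel) \<rightarrow>\<^sub>M prob_algebra (PiM I (\<lambda>_. borel))"
proof (rule measurable_prob_algebra_generated[OF sets_PiM Int_stable_prod_algebra prod_algebra_sets_into_space])
  have Kp: "prob_space (K m)" "sets (K m) = sets borel" for m
    using measurable_space[OF K, of m] by (auto simp: space_prob_algebra)
  fix \<xi> :: "'a \<Rightarrow> real"
  show "prob_space (PiM I (\<lambda>i. K (\<xi> i)))" by (rule prob_space_PiM) (rule Kp)
  show "sets (PiM I (\<lambda>i. K (\<xi> i))) = sets (PiM I (\<lambda>_. borel))" by (rule sets_PiM_cong) (auto simp: Kp)
next
  have Kp: "prob_space (K m)" "sets (K m) = sets borel" for m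
    using measurable_space[OF K, of m] by (auto simp: space_prob_algebra)
  fix A assume "A \<in> prod_algebra I (\<lambda>_. borel :: real measure)"
  then obtain E where A: "A = Pi\<^sub>E I E" and "E \<in> (\<Pi> i\<in>I. sets (borel :: real measure))" by (rule prod_algebraE_all)
  then have E: "\<And>i. i \<in> I \<Longrightarrow> E i \<in> sets borel" by auto
  have eq: "emeasure (PiM I (\<lambda>i. K (\<xi> i))) A = (\<Prod>i\<in>I. emeasure (K (\<xi> i)) (E i))" for \<xi>
  proof -
    interpret product_prob_space "\<lambda>i. K (\<xi> i)" I by (intro product_prob_spaceI Kp)
    show ?thesis unfolding A by (rule emeasure_PiM[OF I]) (simp add: Kp E)
  qed
  have "(\<lambda>m. emeasure (K m) (E i)) \<in> borel_measurable borel" if "i \<in> I" for i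
    using measurable_emeasure_subprob_algebra[OF E[OF that]] measurable_prob_algebraD[OF K]
    by (rule measurable_compose[rotated])
  then have "(\<lambda>\<xi>. emeasure (K (\<xi> i)) (E i)) \<in> borel_measurable (PiM I (\<lambda>_. borel))" if "i \<in> I" for i
    using that by (intro measurable_compose[OF measurable_component_singleton[OF that]]) auto
  then show "(\<lambda>\<xi>. emeasure (PiM I (\<lambda>i. K (\<xi> i))) A) \<in> borel_measurable (PiM I (\<lambda>_. borel))"
    unfolding eq by (intro borel_measurable_prod_ennreal) auto
qed

text \<open>Drawing independent parameters and then independent outcomes gives independent draws from the mixtures;
it suffices to compare boxes, where the integral of a product factorizes.\<close>

lemma PiM_bind:
  fixes K :: "real \<Rightarrow> real measure" and M :: "'i \<Rightarrow> real measure"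
  assumes I: "finite I" and K: "K \<in> borel \<rightarrow>\<^sub>M prob_algebra borel"
    and M: "\<And>i. prob_space (M i)" "\<And>i. sets (M i) = sets borel"
  shows "PiM I M \<bind> (\<lambda>\<xi>. PiM I (\<lambda>i. K (\<xi> i))) = PiM I (\<lambda>i. M i \<bind> K)"
proof -
  note [measurable_cong] = M(2)
  have Kp: "prob_space (K m)" "sets (K m) = sets borel" for m
    using measurable_space[OF K, of m] by (auto simp: space_prob_algebra)
  have spM: "space (M i) = UNIV" for i using sets_eq_imp_space_eq[OF M(2)[of i]] by simp
  have KM: "K \<in> M i \<rightarrow>\<^sub>M prob_algebra borel" for i using K measurable_cong_sets[OF M(2)[of i] refl] by simp
  have Ms: "M i \<in> space (prob_algebra borel)" for i using M by (simp add: space_prob_algebra)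
  have bp: "M i \<bind> K \<in> space (prob_algebra borel)" for i
  proof (rule measurable_space[where x = "M i" and f = "\<lambda>N. N \<bind> K"])
    show "(\<lambda>N. N \<bind> K) \<in> prob_algebra borel \<rightarrow>\<^sub>M prob_algebra borel" using K by measurable
  qed (rule Ms)
  then have bp': "prob_space (M i \<bind> K)" "sets (M i \<bind> K) = sets borel" for i by (simp_all add: space_prob_algebra)
  interpret B: product_prob_space "\<lambda>i. M i \<bind> K" I
    by (intro product_prob_spaceI bp')
  interpret P: product_prob_space M I
    by (intro product_prob_spaceI M)
  have sM: "sets (PiM I M) = sets (PiM I (\<lambda>_. borel :: real measure))" by (rule sets_PiM_cong) (auto simp: M)
  have ker: "(\<lambda>\<xi>. PiM I (\<lambda>i. K (\<xi> i))) \<in> PiM I M \<rightarrow>\<^sub>M subprob_algebra (PiM I (\<lambda>_. borel))"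
    using measurable_prob_algebraD[OF measurable_PiM_kernel[OF I K]] measurable_cong_sets[OF sM refl] by blast
  have ne: "space (PiM I M) \<noteq> {}" by (rule P.not_empty)
  show ?thesis
  proof (rule B.PiM_eqI[OF I])
    show "sets (PiM I M \<bind> (\<lambda>\<xi>. PiM I (\<lambda>i. K (\<xi> i)))) = sets (PiM I (\<lambda>i. M i \<bind> K))"
    proof -
      have "sets (PiM I M \<bind> (\<lambda>\<xi>. PiM I (\<lambda>i. K (\<xi> i)))) = sets (PiM I (\<lambda>_. borel :: real measure))"
        using ne by (intro sets_bind sets_PiM_cong) (auto simp: Kp)
      also have "\<dots> = sets (PiM I (\<lambda>i. M i \<bind> K))" by (rule sets_PiM_cong) (auto simp: bp')
      finally show ?thesis .
    qed
    fix A assume A0: "\<And>i. i \<in> I \<Longrightarrow> A i \<in> sets (M i \<bind> K)"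
    then have A: "\<And>i. i \<in> I \<Longrightarrow> A i \<in> sets borel" by (simp add: bp')
    have mK: "(\<lambda>m. emeasure (K m) (A i)) \<in> borel_measurable (M i)" if "i \<in> I" for i
      using measurable_emeasure_subprob_algebra[OF A[OF that]] measurable_prob_algebraD[OF KM]
      by (rule measurable_compose[rotated])
    have "emeasure (PiM I M \<bind> (\<lambda>\<xi>. PiM I (\<lambda>i. K (\<xi> i)))) (Pi\<^sub>E I A)
      = (\<integral>\<^sup>+\<xi>. emeasure (PiM I (\<lambda>i. K (\<xi> i))) (Pi\<^sub>E I A) \<partial>PiM I M)"
      by (rule emeasure_bind[OF ne ker]) (use A I in \<open>auto intro!: sets_PiM_I_finite\<close>)
    also have "\<dots> = (\<integral>\<^sup>+\<xi>. (\<Prod>i\<in>I. emeasure (K (\<xi> i)) (A i)) \<partial>PiM I M)"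
    proof (rule nn_integral_cong)
      fix \<xi>
      interpret product_prob_space "\<lambda>i. K (\<xi> i)" I by (intro product_prob_spaceI Kp)
      show "emeasure (PiM I (\<lambda>i. K (\<xi> i))) (Pi\<^sub>E I A) = (\<Prod>i\<in>I. emeasure (K (\<xi> i)) (A i))"
        by (rule emeasure_PiM[OF I]) (simp add: Kp A)
    qed
    also have "\<dots> = (\<Prod>i\<in>I. \<integral>\<^sup>+m. emeasure (K m) (A i) \<partial>M i)"
      by (rule P.product_nn_integral_prod[OF I mK])
    also have "\<dots> = (\<Prod>i\<in>I. emeasure (M i \<bind> K) (A i))"
    proof (rule prod.cong[OF refl])
      fix i assume i: "i \<in> I"
      show "(\<integral>\<^sup>+m. emeasure (K m) (A i) \<partial>M i) = emeasure (M i \<bind> K) (A i)"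
        by (rule emeasure_bind[symmetric, OF _ measurable_prob_algebraD[OF KM] A[OF i]]) (simp add: spM)
    qed
    finally show "emeasure (PiM I M \<bind> (\<lambda>\<xi>. PiM I (\<lambda>i. K (\<xi> i)))) (Pi\<^sub>E I A) = (\<Prod>i\<in>I. emeasure (M i \<bind> K) (A i))" .
  qed
qed

lemma normal_law_prob: "s > 0 \<Longrightarrow> prob_space (normal_law m s)" "sets (normal_law m s) = sets borel"
  by (simp_all add: normal_law_def prob_space_normal_density)

lemma normal_density_eq_phi: "normal_density m s x = \<phi> s (x - m)"
  by (simp add: normal_density_def)

lemma normal_law_kernel:
  assumes s: "s > 0"
  shows "(\<lambda>m. normal_law m s) \<in> borel \<rightarrow>\<^sub>M prob_algebra borel"
proof (rule measurable_prob_algebra_generated[where \<Omega> = UNIV and G = "sets borel"])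
  show "sets borel = sigma_sets UNIV (sets (borel :: real measure))"
    using sets.sigma_sets_eq[of "borel :: real measure"] by simp
  show "Int_stable (sets (borel :: real measure))" by (auto simp: Int_stable_def)
  fix A :: "real set" assume A[measurable]: "A \<in> sets borel"
  have "emeasure (normal_law m s) A = (\<integral>\<^sup>+x. ennreal (\<phi> s (x - m)) * indicator A x \<partial>lborel)" for m
    unfolding normal_law_def by (subst emeasure_density) (auto simp: normal_density_eq_phi[of m])
  then show "(\<lambda>m. emeasure (normal_law m s) A) \<in> borel_measurable borel" by simp
qed (auto simp: normal_law_prob s)

lemma bind_normal_law:
  assumes H: "H \<in> borel_probs" and s: "s > 0"
  shows "H \<bind> (\<lambda>m. normal_law m s) = density lborel (\<lambda>x. ennreal (mix s H x))"
proof (rule measure_eqI)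
  note [measurable_cong] = borel_probsD(2)[OF H]
  note [measurable] = measurable_mix[OF H]
  interpret H: prob_space H using borel_probsD[OF H] by simp
  interpret pair_sigma_finite lborel H
    by (intro pair_sigma_finite.intro) (auto simp: borel_probsD[OF H] lborel.sigma_finite_measure_axioms)
  have ker: "(\<lambda>m. normal_law m s) \<in> H \<rightarrow>\<^sub>M subprob_algebra borel"
    using measurable_prob_algebraD[OF normal_law_kernel[OF s]] measurable_cong_sets[OF borel_probsD(2)[OF H] refl] by blast
  have sb: "sets (H \<bind> (\<lambda>m. normal_law m s)) = sets borel"
    using borel_probsD(3)[OF H] by (intro sets_bind) (auto simp: normal_law_prob)
  show "sets (H \<bind> (\<lambda>m. normal_law m s)) = sets (density lborel (\<lambda>x. ennreal (mix s H x)))"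
    using sb by simp
  fix A assume "A \<in> sets (H \<bind> (\<lambda>m. normal_law m s))"
  then have A[measurable]: "A \<in> sets borel" using sb by simp
  have "emeasure (H \<bind> (\<lambda>m. normal_law m s)) A = (\<integral>\<^sup>+m. emeasure (normal_law m s) A \<partial>H)"
    by (rule emeasure_bind[OF _ ker A]) (use borel_probsD(3)[OF H] in auto)
  also have "\<dots> = (\<integral>\<^sup>+m. (\<integral>\<^sup>+x. ennreal (\<phi> s (x - m)) * indicator A x \<partial>lborel) \<partial>H)"
  proof (rule nn_integral_cong)
    fix m
    show "emeasure (normal_law m s) A = (\<integral>\<^sup>+x. ennreal (\<phi> s (x - m)) * indicator A x \<partial>lborel)"
      unfolding normal_law_def by (subst emeasure_density) (auto simp: normal_density_eq_phi[of m])
  qed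
  also have "\<dots> = (\<integral>\<^sup>+x. (\<integral>\<^sup>+m. ennreal (\<phi> s (x - m)) * indicator A x \<partial>H) \<partial>lborel)"
    by (rule Fubini') measurable
  also have "\<dots> = (\<integral>\<^sup>+x. ennreal (mix s H x) * indicator A x \<partial>lborel)"
    by (simp add: nn_integral_multc ennreal_mix[OF H s])
  also have "\<dots> = emeasure (density lborel (\<lambda>x. ennreal (mix s H x))) A" by (simp add: emeasure_density)
  finally show "emeasure (H \<bind> (\<lambda>m. normal_law m s)) A = emeasure (density lborel (\<lambda>x. ennreal (mix s H x))) A" .
qed

lemma normal_law_borel_prob: "s > 0 \<Longrightarrow> normal_law m s \<in> borel_probs"
  by (simp add: borel_probs_def normal_law_prob)

lemma mix_normal_law:
  assumes s: "s > 0" and t: "t > 0"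
  shows "mix t (normal_law m s) x = normal_density m (sqrt (t\<^sup>2 + s\<^sup>2)) x"
proof -
  have "ennreal (mix t (normal_law m s) x) = (\<integral>\<^sup>+\<xi>. ennreal (\<phi> t (x - \<xi>)) \<partial>normal_law m s)"
    by (rule ennreal_mix[OF normal_law_borel_prob[OF s] t])
  also have "\<dots> = (\<integral>\<^sup>+\<xi>. ennreal (normal_density m s \<xi>) * ennreal (\<phi> t (x - \<xi>)) \<partial>lborel)"
    unfolding normal_law_def by (subst nn_integral_density) auto
  also have "\<dots> = (\<integral>\<^sup>+z. ennreal (\<phi> t ((x - m) - z) * \<phi> s z) \<partial>lborel)"
    using nn_integral_real_affine[where c = 1 and t = m and f = "\<lambda>\<xi>. ennreal (normal_density m s \<xi>) * ennreal (\<phi> t (x - \<xi>))"]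
    by (simp add: normal_density_eq_phi[of m] ennreal_mult' mult.commute diff_diff_eq)
  also have "\<dots> = ennreal (\<phi> (sqrt (t\<^sup>2 + s\<^sup>2)) (x - m))"
    using fun_cong[OF conv_normal_density_zero_mean[OF t s], of "x - m"] by simp
  finally show ?thesis by (simp add: normal_density_eq_phi[of m] ennreal_inj)
qed

text \<open>Integrating out the latent variables one level at a time: the noise and the kernel combine to a normal
law of variance \<open>1 + c\<^sup>2\<close>, which is then mixed over \<open>H\<close>.\<close>

lemma hier_model_eq:
  assumes H: "H \<in> borel_probs" and c: "c > 0"
  shows "hier_model n c H = PiM {1..n} (\<lambda>_. density lborel (\<lambda>x. ennreal (mix (\<sigma>\<^sub>s c) H x)))"
proof -
  have in1: "PiM {1..n} (\<lambda>i. normal_law (\<xi> i) c) \<bind> (\<lambda>\<theta>. PiM {1..n} (\<lambda>i. normal_law (\<theta> i) 1))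
      = PiM {1..n} (\<lambda>i. normal_law (\<xi> i) (\<sigma>\<^sub>s c))" for \<xi> :: "nat \<Rightarrow> real"
  proof -
    have "PiM {1..n} (\<lambda>i. normal_law (\<xi> i) c) \<bind> (\<lambda>\<theta>. PiM {1..n} (\<lambda>i. normal_law (\<theta> i) 1))
      = PiM {1..n} (\<lambda>i. normal_law (\<xi> i) c \<bind> (\<lambda>m. normal_law m 1))"
      by (rule PiM_bind[OF _ normal_law_kernel]) (auto simp: normal_law_prob c)
    also have "\<dots> = PiM {1..n} (\<lambda>i. normal_law (\<xi> i) (\<sigma>\<^sub>s c))"
    proof -
      have "normal_law m c \<bind> (\<lambda>m. normal_law m 1) = normal_law m (\<sigma>\<^sub>s c)" for m
        unfolding bind_normal_law[OF normal_law_borel_prob[OF c] zero_less_one] mix_normal_law[OF c zero_less_one]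
        by (simp add: normal_law_def \<sigma>\<^sub>s_def)
      then show ?thesis by (simp only:)
    qed
    finally show ?thesis .
  qed
  have "hier_model n c H = PiM {1..n} (\<lambda>_. H) \<bind> (\<lambda>\<xi>. PiM {1..n} (\<lambda>i. normal_law (\<xi> i) (\<sigma>\<^sub>s c)))"
    unfolding hier_model_def in1 ..
  also have "\<dots> = PiM {1..n} (\<lambda>_. H \<bind> (\<lambda>m. normal_law m (\<sigma>\<^sub>s c)))"
    by (rule PiM_bind[OF _ normal_law_kernel]) (auto simp: borel_probsD[OF H] sigma_s)
  finally show ?thesis by (simp add: bind_normal_law[OF H sigma_s(2)])
qed

section \<open>Risk of the nonparametric maximum likelihood estimator\<close>

lemma nn_integral_cauchy: "(\<integral>\<^sup>+x. ennreal (1 / (1 + x\<^sup>2)) \<partial>lborel) \<le> ennreal pi"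
proof -
  have half: "(\<integral>\<^sup>+x. ennreal (1 / (1 + x\<^sup>2)) * indicator {0..} x \<partial>lborel) = ennreal (pi / 2)"
  proof -
    have "(\<integral>\<^sup>+x. ennreal (1 / (1 + x\<^sup>2)) * indicator {0..} x \<partial>lborel) = ennreal (pi / 2 - arctan 0)"
    proof (rule nn_integral_FTC_atLeast)
      show "DERIV arctan x :> 1 / (1 + x\<^sup>2)" for x :: real
        using DERIV_arctan[of x] by (simp add: inverse_eq_divide)
      show "(arctan \<longlongrightarrow> pi / 2) at_top" by (rule tendsto_arctan_at_top)
    qed auto
    then show ?thesis by simp
  qed
  have "(\<integral>\<^sup>+x. ennreal (1 / (1 + x\<^sup>2)) * indicator {..0} x \<partial>lborel)
    = (\<integral>\<^sup>+x. ennreal (1 / (1 + x\<^sup>2)) * indicator {0..} x \<partial>lborel)"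
    by (subst nn_integral_real_affine[where c = "- 1" and t = 0]) (auto intro!: nn_integral_cong simp: indicator_def)
  then have half': "(\<integral>\<^sup>+x. ennreal (1 / (1 + x\<^sup>2)) * indicator {..0} x \<partial>lborel) = ennreal (pi / 2)"
    using half by simp
  have "(\<integral>\<^sup>+x. ennreal (1 / (1 + x\<^sup>2)) \<partial>lborel)
    \<le> (\<integral>\<^sup>+x. ennreal (1 / (1 + x\<^sup>2)) * indicator {..0} x + ennreal (1 / (1 + x\<^sup>2)) * indicator {0..} x \<partial>lborel)"
    by (intro nn_integral_mono) (auto simp: indicator_def)
  also have "\<dots> = ennreal (pi / 2) + ennreal (pi / 2)"
    by (subst nn_integral_add) (auto simp: half half')
  also have "\<dots> = ennreal pi" by (simp flip: ennreal_plus)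
  finally show ?thesis .
qed

lemma nn_integral_cauchy_scaled:
  assumes M: "M > 0"
  shows "(\<integral>\<^sup>+x. ennreal (1 / (1 + ((x - t) / M)\<^sup>2)) \<partial>lborel) \<le> ennreal (4 * M)"
proof -
  have "(\<integral>\<^sup>+x. ennreal (1 / (1 + ((x - t) / M)\<^sup>2)) \<partial>lborel) = ennreal M * (\<integral>\<^sup>+x. ennreal (1 / (1 + x\<^sup>2)) \<partial>lborel)"
    using M by (subst nn_integral_real_affine[where c = M and t = t]) auto
  also have "\<dots> \<le> ennreal M * ennreal pi" by (intro mult_left_mono nn_integral_cauchy) auto
  also have "\<dots> = ennreal (M * pi)" using M by (simp add: ennreal_mult)
  also have "\<dots> \<le> ennreal (4 * M)" using pi_less_4 M by (intro ennreal_leI) (simp add: mult.commute)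
  finally show ?thesis .
qed

text \<open>Without \<open>v\<close>, the defect in the arithmetic-geometric mean inequality is \<open>(\<surd>a - \<surd>b)\<^sup>2 / 2\<close>, which is at least
\<open>(a - b)\<^sup>2 / 8\<close> because \<open>\<surd>a + \<surd>b \<le> 2\<close>. The perturbation \<open>v\<close> costs at most \<open>\<surd>(v b)\<close>, which is split by the same
inequality so that \<open>b\<close> receives the small weight \<open>1 / n\<close>.\<close>

lemma hellinger_pointwise:
  fixes a b v n :: real
  assumes a: "0 \<le> a" "a \<le> 1" and b: "0 \<le> b" "b \<le> 1" and v: "v \<ge> 0" and n: "n > 0"
  shows "sqrt ((a + v) * b) + (a - b)\<^sup>2 / 8 \<le> (a + b) / 2 + (b / n + n * v) / 2"
proof -
  define x y where "x = sqrt a" and "y = sqrt b"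
  have x: "0 \<le> x" "x \<le> 1" "a = x\<^sup>2" and y: "0 \<le> y" "y \<le> 1" "b = y\<^sup>2"
    using a b by (auto simp: x_def y_def)
  have "sqrt ((a + v) * b) \<le> sqrt (a * b) + sqrt (v * b)"
    unfolding distrib_right using a b v by (intro sqrt_add_le_add_sqrt) auto
  moreover have "sqrt (a * b) = x * y" by (simp add: x_def y_def real_sqrt_mult)
  moreover have "sqrt (v * b) \<le> (b / n + n * v) / 2"
    using arith_geo_mean_sqrt[of "b / n" "n * v"] b v n by (simp add: mult.commute)
  moreover have "x * y + (a - b)\<^sup>2 / 8 \<le> (a + b) / 2"
  proof -
    have "(a - b)\<^sup>2 = (x - y)\<^sup>2 * (x + y)\<^sup>2" unfolding x(3) y(3) by algebra
    also have "\<dots> \<le> (x - y)\<^sup>2 * 2\<^sup>2" using x y by (intro mult_left_mono power_mono) auto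
    finally have "(a - b)\<^sup>2 / 8 \<le> (x - y)\<^sup>2 / 2" by simp
    also have "\<dots> = (a + b) / 2 - x * y" unfolding x(3) y(3) by (simp add: power2_eq_square field_simps)
    finally show ?thesis by linarith
  qed
  ultimately show ?thesis by linarith
qed

lemma mix_le_1:
  assumes "H \<in> borel_probs" "s \<ge> 1"
  shows "mix s H x \<le> 1"
proof -
  have "sqrt (2 * pi) \<ge> sqrt 1" using pi_gt3 by (intro real_sqrt_le_mono) auto
  then have "sqrt (2 * pi) * s \<ge> 1 * 1" using assms by (intro mult_mono) auto
  then have "1 / (sqrt (2 * pi) * s) \<le> 1" by simp
  then show ?thesis using mix_le[OF assms(1), of s x] assms(2) by linarith
qed

lemma mixL2_le_2:
  assumes H: "H \<in> borel_probs" and H': "H' \<in> borel_probs" and s: "s \<ge> 1"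
  shows "mixL2 s H H' \<le> 2"
proof -
  have s0: "s > 0" using s by simp
  have "mixL2 s H H' \<le> (\<integral>x. mix s H x + mix s H' x \<partial>lborel)"
    unfolding mixL2_def
  proof (rule integral_mono)
    fix x
    have "\<bar>mix s H x - mix s H' x\<bar> \<le> 1"
      using mix_nonneg[of s H x] mix_nonneg[of s H' x] mix_le_1[OF H s, of x] mix_le_1[OF H' s, of x] by linarith
    then have "\<bar>mix s H x - mix s H' x\<bar> * \<bar>mix s H x - mix s H' x\<bar> \<le> 1 * \<bar>mix s H x - mix s H' x\<bar>"
      by (intro mult_right_mono) auto
    then have "(mix s H x - mix s H' x)\<^sup>2 \<le> \<bar>mix s H x - mix s H' x\<bar>"
      by (simp add: power2_eq_square flip: abs_mult)
    then show "(mix s H x - mix s H' x)\<^sup>2 \<le> mix s H x + mix s H' x"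
      using mix_nonneg[of s H x] mix_nonneg[of s H' x] by linarith
  qed (use integrable_mix[OF H s0] integrable_mix[OF H' s0] integrable_mix_diff_sq[OF H H' s0] in auto)
  also have "\<dots> = 2" using integrable_mix[OF H s0] integrable_mix[OF H' s0] by (simp add: integral_mix assms s0)
  finally show ?thesis .
qed

text \<open>The mean of the square root of a perturbed likelihood ratio. Its distance to one controls the squared
\<open>L\<^sup>2\<close> distance, and the exponential form multiplies up over independent observations.\<close>

lemma affinity_bound:
  assumes r: "r \<in> borel_probs" and H: "H \<in> borel_probs" and s: "s \<ge> 1" and n: "n > 0"
    and v[measurable]: "v \<in> borel_measurable borel" and v0: "\<And>x. v x \<ge> 0"
    and vI: "(\<integral>\<^sup>+x. ennreal (v x) \<partial>lborel) \<le> ennreal I" "I \<ge> 0"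
  shows "(\<integral>\<^sup>+x. ennreal (sqrt ((mix s r x + v x) / mix s H x)) * ennreal (mix s H x) \<partial>lborel)
    \<le> ennreal (exp ((1 / n + n * I) / 2 - mixL2 s r H / 8))"
proof -
  note [measurable] = measurable_mix[OF H] measurable_mix[OF r]
  have s0: "s > 0" using s by simp
  let ?f = "mix s H" and ?g = "mix s r"
  let ?A = "\<integral>\<^sup>+x. ennreal (sqrt ((?g x + v x) * ?f x)) \<partial>lborel"
  have "(\<integral>\<^sup>+x. ennreal (sqrt ((?g x + v x) / ?f x)) * ennreal (?f x) \<partial>lborel) = ?A"
  proof (rule nn_integral_cong)
    fix x
    have f: "?f x > 0" by (rule mix_pos[OF H s0])
    have "sqrt ((?g x + v x) / ?f x) * ?f x = sqrt ((?g x + v x) * ?f x)"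
    proof -
      have "sqrt ((?g x + v x) / ?f x) * ?f x = sqrt ((?g x + v x) / ?f x) * sqrt ((?f x)\<^sup>2)" using f by simp
      also have "\<dots> = sqrt (((?g x + v x) / ?f x) * (?f x)\<^sup>2)" by (rule real_sqrt_mult[symmetric])
      also have "((?g x + v x) / ?f x) * (?f x)\<^sup>2 = (?g x + v x) * ?f x" using f by (simp add: power2_eq_square)
      finally show ?thesis .
    qed
    then show "ennreal (sqrt ((?g x + v x) / ?f x)) * ennreal (?f x) = ennreal (sqrt ((?g x + v x) * ?f x))"
      using f v0 by (simp flip: ennreal_mult)
  qed
  also have "?A \<le> ennreal (exp ((1 / n + n * I) / 2 - mixL2 s r H / 8))"
  proof -
    have "?A + ennreal (mixL2 s r H / 8) = (\<integral>\<^sup>+x. ennreal (sqrt ((?g x + v x) * ?f x)) + ennreal ((?g x - ?f x)\<^sup>2 / 8) \<partial>lborel)"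
    proof -
      have "(\<integral>\<^sup>+x. ennreal ((?g x - ?f x)\<^sup>2 / 8) \<partial>lborel) = ennreal (mixL2 s r H / 8)"
        using integrable_mix_diff_sq[OF r H s0] by (subst nn_integral_eq_integral) (auto simp: mixL2_def)
      then show ?thesis by (subst nn_integral_add) auto
    qed
    also have "\<dots> \<le> (\<integral>\<^sup>+x. ennreal (1 / 2) * ennreal (?g x) + ennreal (1 / 2 + 1 / (2 * n)) * ennreal (?f x) + ennreal (n / 2) * ennreal (v x) \<partial>lborel)"
    proof (rule nn_integral_mono)
      fix x
      have "sqrt ((?g x + v x) * ?f x) + (?g x - ?f x)\<^sup>2 / 8 \<le> (?g x + ?f x) / 2 + (?f x / n + n * v x) / 2"
        by (rule hellinger_pointwise) (auto simp: mix_le_1 r H s v0 n)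
      also have "\<dots> = 1 / 2 * ?g x + (1 / 2 + 1 / (2 * n)) * ?f x + n / 2 * v x"
        using n by (simp add: field_simps)
      finally have "ennreal (sqrt ((?g x + v x) * ?f x) + (?g x - ?f x)\<^sup>2 / 8) \<le> ennreal (1 / 2 * ?g x + (1 / 2 + 1 / (2 * n)) * ?f x + n / 2 * v x)"
        by (rule ennreal_leI)
      also have "\<dots> = ennreal (1 / 2) * ennreal (?g x) + ennreal (1 / 2 + 1 / (2 * n)) * ennreal (?f x) + ennreal (n / 2) * ennreal (v x)"
        using n v0 by (simp only: ennreal_mult[symmetric] ennreal_plus[symmetric] mix_nonneg add_nonneg_nonneg mult_nonneg_nonneg divide_nonneg_nonneg zero_le_one zero_le_numeral less_imp_le)
      finally show "ennreal (sqrt ((?g x + v x) * ?f x)) + ennreal ((?g x - ?f x)\<^sup>2 / 8)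
        \<le> ennreal (1 / 2) * ennreal (?g x) + ennreal (1 / 2 + 1 / (2 * n)) * ennreal (?f x) + ennreal (n / 2) * ennreal (v x)"
        using v0 by (subst ennreal_plus[symmetric]) auto
    qed
    also have "\<dots> = ennreal (1 / 2) + ennreal (1 / 2 + 1 / (2 * n)) + ennreal (n / 2) * (\<integral>\<^sup>+x. ennreal (v x) \<partial>lborel)"
      by (simp add: nn_integral_add nn_integral_cmult nn_integral_mix_1 r H s0)
    also have "\<dots> \<le> ennreal (1 / 2) + ennreal (1 / 2 + 1 / (2 * n)) + ennreal (n / 2) * ennreal I"
      by (intro add_mono mult_left_mono vI) auto
    also have "\<dots> = ennreal (1 + (1 / n + n * I) / 2)"
    proof -
      have "ennreal (1 / 2) + ennreal (1 / 2 + 1 / (2 * n)) + ennreal (n / 2) * ennreal I = ennreal (1 / 2 + (1 / 2 + 1 / (2 * n)) + n / 2 * I)"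
        using n vI(2) by (subst ennreal_mult[symmetric], simp, simp, subst ennreal_plus[symmetric], simp, simp, subst ennreal_plus[symmetric], auto)
      also have "1 / 2 + (1 / 2 + 1 / (2 * n)) + n / 2 * I = 1 + (1 / n + n * I) / 2"
        by (simp add: add_divide_distrib)
      finally show ?thesis .
    qed
    finally have le: "?A + ennreal (mixL2 s r H / 8) \<le> ennreal (1 + (1 / n + n * I) / 2)" .
    then have "?A \<noteq> top" by (auto simp: top_unique)
    then obtain a where a: "?A = ennreal a" "a \<ge> 0" by (cases ?A) auto
    have "a + mixL2 s r H / 8 \<le> 1 + (1 / n + n * I) / 2"
      using le n vI(2) a(2) mixL2_nonneg[of s r H] unfolding a(1)
      by (simp add: ennreal_le_iff add_nonneg_nonneg flip: ennreal_plus)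
    then have "a \<le> 1 + ((1 / n + n * I) / 2 - mixL2 s r H / 8)" by linarith
    also have "\<dots> \<le> exp ((1 / n + n * I) / 2 - mixL2 s r H / 8)" by (rule exp_ge_add_one_self)
    finally show ?thesis unfolding a(1) by (rule ennreal_leI)
  qed
  finally show ?thesis .
qed

lemma nn_integral_PiM_prod:
  assumes \<mu>: "prob_space \<mu>" and a: "a \<in> borel_measurable \<mu>"
  shows "(\<integral>\<^sup>+X. (\<Prod>i\<in>{1..n::nat}. a (X i)) \<partial>PiM {1..n} (\<lambda>_. \<mu>)) = (\<integral>\<^sup>+x. a x \<partial>\<mu>) ^ n"
proof -
  interpret product_prob_space "\<lambda>_. \<mu>" "{1..n}" by (intro product_prob_spaceI \<mu>)
  show ?thesis by (subst product_nn_integral_prod) (auto simp: a)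
qed

lemma nn_integral_PiM_sum:
  assumes \<mu>: "prob_space \<mu>" and a: "a \<in> borel_measurable \<mu>"
  shows "(\<integral>\<^sup>+X. (\<Sum>i\<in>{1..n::nat}. a (X i)) \<partial>PiM {1..n} (\<lambda>_. \<mu>)) = of_nat n * (\<integral>\<^sup>+x. a x \<partial>\<mu>)"
proof -
  interpret product_prob_space "\<lambda>_. \<mu>" "{1..n}" by (intro product_prob_spaceI \<mu>)
  have "(\<integral>\<^sup>+X. a (X i) \<partial>PiM {1..n} (\<lambda>_. \<mu>)) = (\<integral>\<^sup>+x. a x \<partial>\<mu>)" if i: "i \<in> {1..n}" for i
  proof -
    have "(\<integral>\<^sup>+x. a x \<partial>distr (PiM {1..n} (\<lambda>_. \<mu>)) \<mu> (\<lambda>X. X i)) = (\<integral>\<^sup>+X. a (X i) \<partial>PiM {1..n} (\<lambda>_. \<mu>))"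
      by (rule nn_integral_distr[OF measurable_component_singleton[OF i]]) (simp add: a)
    then show ?thesis by (simp only: PiM_component[OF i])
  qed
  moreover have "(\<lambda>X. a (X i)) \<in> borel_measurable (PiM {1..n} (\<lambda>_. \<mu>))" if "i \<in> {1..n}" for i
    by (rule measurable_compose[OF measurable_component_singleton[OF that] a])
  ultimately show ?thesis by (subst nn_integral_sum) (auto simp: a)
qed

text \<open>For a representative \<open>r\<close> of the classes from \<open>mixture_entropy\<close>, let \<open>Z r X\<close> be the product over the sample of
square roots of likelihood ratios of \<open>mix \<sigma> r + v\<close> to the truth, normalized by the bound of
\<open>affinity_bound\<close>; it has mean at most one. The likelihood of the estimator is at least that of the truth,
so for the representative of its class \<open>ln (Z r X)\<close> is at least \<open>n\<close> times the squared error of \<open>r\<close>, up to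
constant factors, minus the penalties. On the other hand \<open>ln (Z r X) \<le> ln N + Z r X / N\<close>, and replacing
\<open>Z r X\<close> by the sum over all \<open>N\<close> representatives makes the bound independent of the estimator. The result is a
measurable bound \<open>W\<close>, valid for every maximizer even when the chosen maximizer depends on the sample in a
nonmeasurable way.\<close>

lemma npmle_L2_risk:
  fixes n :: nat
  assumes n: "n \<ge> 2" and c: "c > 0" and H: "H \<in> borel_probs" and L: "L = ln (real n)"
    and M: "M \<ge> sqrt (10 * (\<sigma>\<^sub>s c)\<^sup>2 * L)" and S: "compact S" "S \<noteq> {}" and p: "p \<ge> 1 / L"
  obtains W :: "(nat \<Rightarrow> real) \<Rightarrow> ennreal" where "W \<in> borel_measurable (hier_model n c H)"
    "\<And>X Hh. is_npmle n c X Hh \<Longrightarrow> ennreal (mixL2 (\<sigma>\<^sub>s c) Hh H) \<le> W X"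
    "(\<integral>\<^sup>+X. W X \<partial>hier_model n c H) \<le> ennreal (3900 * (measure lborel (fatten (\<sigma>\<^sub>s c) S) * (M / real n) * L powr (3 / 2)))
       + ennreal (32 * L) * (\<integral>\<^sup>+\<xi>. ennreal ((2 * infdist \<xi> S / M) powr p) \<partial>H)"
proof -
  define \<sigma> where "\<sigma> = \<sigma>\<^sub>s c"
  have sg: "\<sigma> \<ge> 1" "\<sigma> > 0" using sigma_s[of c] by (simp_all add: \<sigma>_def)
  define F where "F = (\<integral>\<^sup>+\<xi>. ennreal ((2 * infdist \<xi> S / M) powr p) \<partial>H)"
  define V where "V = measure lborel (fatten \<sigma> S)"
  define f where "f = mix \<sigma> H"
  note [measurable] = measurable_mix[OF H]
  have fm[measurable]: "f \<in> borel_measurable borel" by (simp add: f_def)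
  have fpos: "f x > 0" for x unfolding f_def by (rule mix_pos[OF H sg(2)])
  have L1: "L \<ge> 2 / 3" unfolding L by (rule ln_nat_ge_two_thirds[OF n])
  have n0: "real n > 0" using n by simp
  have expL: "exp L = real n" using n0 L by simp
  note cut = cutoff_bounds[OF sg(1) L1 M[folded \<sigma>_def]]
  have sL: "sqrt L \<ge> 3 / 4" and M2s: "M \<ge> 2 * \<sigma>" and M3: "M \<ge> 3 * sqrt L" using cut by auto
  have M0: "M > 0" using M2s sg by simp
  obtain T where T: "finite T" "T \<subseteq> S" "T \<noteq> {}"
    "\<And>x. \<exists>t\<in>T. \<bar>x - t\<bar> \<le> infdist x S + 2 * \<sigma>" "real (card T) * (2 * \<sigma>) \<le> V"
    using packing_net[OF S sg(2)] unfolding V_def by metis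
  have cT: "real (card T) \<ge> 1" using T by (simp add: Suc_leI card_gt_0_iff)
  \<comment> \<open>The envelope: at least \<open>n\<^sup>-\<^sup>2\<close> on \<open>B\<close>, where the classes are resolved up to \<open>n\<^sup>-\<^sup>2\<close>, and decaying so slowly
    off \<open>B\<close> that the cost of replacing a density by \<open>v\<close> there is only logarithmic in the distance.\<close>
  define v where "v x = 5 / (real n)\<^sup>2 * (\<Sum>t\<in>T. 1 / (1 + ((x - t) / M)\<^sup>2))" for x
  have vm[measurable]: "v \<in> borel_measurable borel" unfolding v_def by measurable
  have bump0: "1 / (1 + ((x - t) / M)\<^sup>2) \<ge> 0" for x t by simp
  have v0: "v x \<ge> 0" for x unfolding v_def by (intro mult_nonneg_nonneg sum_nonneg bump0) auto
  have vlow: "v x \<ge> 5 / (real n)\<^sup>2 * (1 / (1 + (2 * y)\<^sup>2))" if "t \<in> T" "\<bar>x - t\<bar> \<le> 2 * (y * M)" for x t y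
  proof -
    have "\<bar>(x - t) / M\<bar> \<le> 2 * y" using that(2) M0 by (simp add: abs_divide divide_le_eq mult_ac)
    then have "((x - t) / M)\<^sup>2 \<le> (2 * y)\<^sup>2" by (metis abs_ge_zero power2_abs power_mono)
    then have "1 / (1 + (2 * y)\<^sup>2) \<le> 1 / (1 + ((x - t) / M)\<^sup>2)"
      by (intro divide_left_mono) (auto intro!: mult_pos_pos add_pos_nonneg)
    also have "\<dots> \<le> (\<Sum>t\<in>T. 1 / (1 + ((x - t) / M)\<^sup>2))"
      using T(1) that(1) bump0 by (intro member_le_sum) auto
    finally show ?thesis unfolding v_def by (intro mult_left_mono) auto
  qed
  define I where "I = 20 / (real n)\<^sup>2 * (real (card T) * M)"
  have I0: "I \<ge> 0" using M0 by (simp add: I_def)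
  have vI: "(\<integral>\<^sup>+x. ennreal (v x) \<partial>lborel) \<le> ennreal I"
  proof -
    have "(\<integral>\<^sup>+x. ennreal (v x) \<partial>lborel) = (\<integral>\<^sup>+x. ennreal (5 / (real n)\<^sup>2) * (\<Sum>t\<in>T. ennreal (1 / (1 + ((x - t) / M)\<^sup>2))) \<partial>lborel)"
      unfolding v_def by (intro nn_integral_cong) (simp add: ennreal_mult' sum_ennreal del: times_divide_eq_left)
    also have "\<dots> = ennreal (5 / (real n)\<^sup>2) * (\<Sum>t\<in>T. (\<integral>\<^sup>+x. ennreal (1 / (1 + ((x - t) / M)\<^sup>2)) \<partial>lborel))"
    proof -
      have "(\<integral>\<^sup>+x. (\<Sum>t\<in>T. ennreal (1 / (1 + ((x - t) / M)\<^sup>2))) \<partial>lborel) = (\<Sum>t\<in>T. (\<integral>\<^sup>+x. ennreal (1 / (1 + ((x - t) / M)\<^sup>2)) \<partial>lborel))"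
        by (rule nn_integral_sum) measurable
      then show ?thesis by (subst nn_integral_cmult) simp_all
    qed
    also have "\<dots> \<le> ennreal (5 / (real n)\<^sup>2) * (\<Sum>t\<in>T. ennreal (4 * M))"
      by (intro mult_left_mono sum_mono nn_integral_cauchy_scaled M0) auto
    also have "\<dots> = ennreal (5 / (real n)\<^sup>2 * (real (card T) * (4 * M)))"
    proof -
      have "(\<Sum>t\<in>T. ennreal (4 * M)) = ennreal (real (card T) * (4 * M))"
        using M0 by (simp only: sum_constant ennreal_of_nat_eq_real_of_nat) (simp add: ennreal_mult'')
      then show ?thesis using M0 by (simp only:) (subst ennreal_mult[symmetric], auto)
    qed
    also have "5 / (real n)\<^sup>2 * (real (card T) * (4 * M)) = I" by (simp add: I_def)
    finally show ?thesis .
  qed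
  obtain R where R: "R \<subseteq> borel_probs" "finite R" "ln (real (card R)) \<le> 320 * real (card T) * M * L powr (3 / 2)"
    "\<And>H'. H' \<in> borel_probs \<Longrightarrow> \<exists>r\<in>R. mixL2 \<sigma> H' H \<le> 2 * mixL2 \<sigma> r H \<and>
      (\<forall>x t. t \<in> T \<longrightarrow> \<bar>x - t\<bar> \<le> 2 * M \<longrightarrow> \<bar>mix \<sigma> H' x - mix \<sigma> r x\<bar> \<le> 1 / (real n)\<^sup>2)"
  proof (rule mixture_entropy[OF n sg(1) L M[folded \<sigma>_def] T(1,3), where gap = "\<lambda>H'. mixL2 \<sigma> H' H" and b = 2])
    show "0 \<le> mixL2 \<sigma> H' H \<and> mixL2 \<sigma> H' H \<le> 2" if "H' \<in> borel_probs" for H'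
      using mixL2_nonneg mixL2_le_2[OF that H sg(1)] by auto
  qed (rule that)
  have Rne: "R \<noteq> {}" using R(4)[OF H] by auto
  define N where "N = real (card R)"
  have N: "N \<ge> 1" using Rne R(2) by (simp add: N_def Suc_leI card_gt_0_iff)
  \<comment> \<open>Off \<open>B\<close> the representative says nothing about the estimator, whose density is bounded there by
    \<open>1 \<le> v x * exp (lq x)\<close>.\<close>
  define lq where "lq x = 2 * (L + ln (infdist x S / M)) * indicator (- fatten M S) x" for x
  have lqm[measurable]: "lq \<in> borel_measurable borel" unfolding lq_def by measurable
  have lq0: "lq x \<ge> 0" for x
  proof (cases "x \<in> fatten M S")
    case False
    then have "infdist x S / M > 1" using M0 by (simp add: fatten_def)
    then show ?thesis using L1 by (simp add: lq_def)
  qed (simp add: lq_def)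
  have envelope: "mix \<sigma> H' x \<le> (mix \<sigma> r x + v x) * exp (lq x)"
    if H': "H' \<in> borel_probs" and cl: "\<forall>x t. t \<in> T \<longrightarrow> \<bar>x - t\<bar> \<le> 2 * M \<longrightarrow> \<bar>mix \<sigma> H' x - mix \<sigma> r x\<bar> \<le> 1 / (real n)\<^sup>2" for H' r x
  proof (cases "x \<in> fatten M S")
    case True
    obtain t where t: "t \<in> T" "\<bar>x - t\<bar> \<le> infdist x S + 2 * \<sigma>" using T(4) by auto
    have xt: "\<bar>x - t\<bar> \<le> 2 * M" using t(2) True M2s by (simp add: fatten_def)
    have "v x \<ge> 1 / (real n)\<^sup>2" using vlow[OF t(1), of x 1] xt by simp
    moreover have "\<bar>mix \<sigma> H' x - mix \<sigma> r x\<bar> \<le> 1 / (real n)\<^sup>2" using cl t(1) xt by blast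
    ultimately have "mix \<sigma> H' x \<le> mix \<sigma> r x + v x" by linarith
    then show ?thesis using True by (simp add: lq_def)
  next
    case False
    define y where "y = infdist x S / M"
    have y: "y > 1" using False M0 by (simp add: y_def fatten_def)
    obtain t where t: "t \<in> T" "\<bar>x - t\<bar> \<le> infdist x S + 2 * \<sigma>" using T(4) by auto
    have "infdist x S = y * M" using M0 by (simp add: y_def)
    moreover have "1 * M \<le> y * M" using y M0 by (intro mult_right_mono) auto
    ultimately have "\<bar>x - t\<bar> \<le> 2 * (y * M)" using t(2) M2s by linarith
    then have "5 / (real n)\<^sup>2 * (1 / (1 + (2 * y)\<^sup>2)) \<le> v x" by (rule vlow[OF t(1)])
    moreover have "1 / (5 * y\<^sup>2) \<le> 1 / (1 + (2 * y)\<^sup>2)"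
    proof (rule divide_left_mono)
      show "1 + (2 * y)\<^sup>2 \<le> 5 * y\<^sup>2" using y by (simp add: power_mult_distrib)
      show "0 < 5 * y\<^sup>2 * (1 + (2 * y)\<^sup>2)" using y by (intro mult_pos_pos add_pos_nonneg) auto
    qed simp
    then have "5 / (real n)\<^sup>2 * (1 / (5 * y\<^sup>2)) \<le> 5 / (real n)\<^sup>2 * (1 / (1 + (2 * y)\<^sup>2))" by (intro mult_left_mono) auto
    ultimately have vv: "5 / (real n)\<^sup>2 * (1 / (5 * y\<^sup>2)) \<le> v x" by linarith
    have "lq x = L + L + (ln y + ln y)" using False by (simp add: lq_def y_def)
    then have "exp (lq x) = exp L * exp L * (exp (ln y) * exp (ln y))" by (simp only: exp_add)
    moreover have "exp (ln y) = y" using y by simp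
    ultimately have eq: "exp (lq x) = (real n)\<^sup>2 * y\<^sup>2" by (simp only: expL power2_eq_square)
    have "1 = 5 / (real n)\<^sup>2 * (1 / (5 * y\<^sup>2)) * exp (lq x)" unfolding eq using n0 y by simp
    also have "\<dots> \<le> v x * exp (lq x)" using vv by (intro mult_right_mono) auto
    also have "\<dots> \<le> (mix \<sigma> r x + v x) * exp (lq x)" by (intro mult_right_mono) auto
    finally show ?thesis using mix_le_1[OF H' sg(1), of x] by linarith
  qed
  define \<kappa> where "\<kappa> = (1 / real n + real n * I) / 2"
  define a where "a r x = sqrt ((mix \<sigma> r x + v x) / f x)" for r x
  have am: "a r \<in> borel_measurable borel" if "r \<in> R" for r
  proof -
    have [measurable]: "mix \<sigma> r \<in> borel_measurable borel" using that R(1) by (intro measurable_mix) auto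
    show ?thesis unfolding a_def by measurable
  qed
  define Z where "Z r X = (\<Prod>i\<in>{1..n}. a r (X i)) * exp (real n * (mixL2 \<sigma> r H / 8 - \<kappa>))" for r X
  define W where "W X = ennreal (16 / real n) * (ennreal (ln N + real n * \<kappa>) + (\<Sum>r\<in>R. ennreal (Z r X)) * ennreal (1 / N)
     + ennreal (1 / 2) * (\<Sum>i\<in>{1..n}. ennreal (lq (X i))))" for X
  define \<mu> where "\<mu> = density lborel (\<lambda>x. ennreal (f x))"
  have \<mu>p: "prob_space \<mu>"
    unfolding \<mu>_def by (rule prob_spaceI) (simp add: emeasure_density f_def nn_integral_mix_1[OF H sg(2)])
  have \<mu>s[measurable_cong]: "sets \<mu> = sets borel" by (simp add: \<mu>_def)
  have hm: "hier_model n c H = PiM {1..n} (\<lambda>_. \<mu>)"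
    unfolding hier_model_eq[OF H c] \<mu>_def f_def \<sigma>_def ..
  have apos: "a r x \<ge> 0" for r x unfolding a_def using v0 fpos by (simp add: less_imp_le)
  have comp: "(\<lambda>X. u (X i)) \<in> borel_measurable (PiM {1..n} (\<lambda>_. \<mu>))" if "i \<in> {1..n}" and u: "u \<in> borel_measurable borel" for i and u :: "real \<Rightarrow> real"
  proof -
    have "u \<in> borel_measurable \<mu>" using u by (simp cong: measurable_cong_sets)
    then show ?thesis by (intro measurable_compose[OF measurable_component_singleton[OF that(1)]])
  qed
  have Zm: "(\<lambda>X. Z r X) \<in> borel_measurable (PiM {1..n} (\<lambda>_. \<mu>))" if "r \<in> R" for r
    unfolding Z_def
    by (intro borel_measurable_times borel_measurable_const borel_measurable_prod comp[OF _ am[OF that]])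
  have lqX: "(\<lambda>X. ennreal (lq (X i))) \<in> borel_measurable (PiM {1..n} (\<lambda>_. \<mu>))" if "i \<in> {1..n}" for i
    by (intro measurable_compose[OF comp[OF that lqm]]) auto
  have EZ: "(\<integral>\<^sup>+X. ennreal (Z r X) \<partial>PiM {1..n} (\<lambda>_. \<mu>)) \<le> 1" if r: "r \<in> R" for r
  proof -
    let ?e = "exp (real n * (mixL2 \<sigma> r H / 8 - \<kappa>))"
    have [measurable]: "a r \<in> borel_measurable borel" by (rule am[OF r])
    have rP: "r \<in> borel_probs" using r R(1) by auto
    have "(\<integral>\<^sup>+X. ennreal (Z r X) \<partial>PiM {1..n} (\<lambda>_. \<mu>)) = (\<integral>\<^sup>+X. (\<Prod>i\<in>{1..n}. ennreal (a r (X i))) * ennreal ?e \<partial>PiM {1..n} (\<lambda>_. \<mu>))"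
      unfolding Z_def by (intro nn_integral_cong) (simp add: ennreal_mult prod_nonneg apos prod_ennreal)
    also have "\<dots> = (\<integral>\<^sup>+X. (\<Prod>i\<in>{1..n}. ennreal (a r (X i))) \<partial>PiM {1..n} (\<lambda>_. \<mu>)) * ennreal ?e"
      using comp[OF _ am[OF r]] by (intro nn_integral_multc borel_measurable_prod_ennreal) auto
    also have "\<dots> = (\<integral>\<^sup>+x. ennreal (a r x) \<partial>\<mu>) ^ n * ennreal ?e"
      by (subst nn_integral_PiM_prod[OF \<mu>p]) auto
    also have "(\<integral>\<^sup>+x. ennreal (a r x) \<partial>\<mu>) = (\<integral>\<^sup>+x. ennreal (sqrt ((mix \<sigma> r x + v x) / mix \<sigma> H x)) * ennreal (mix \<sigma> H x) \<partial>lborel)"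
    proof -
      have "(\<integral>\<^sup>+x. ennreal (a r x) \<partial>\<mu>) = (\<integral>\<^sup>+x. ennreal (f x) * ennreal (a r x) \<partial>lborel)"
        unfolding \<mu>_def by (rule nn_integral_density) measurable
      then show ?thesis by (simp only: a_def f_def mult.commute)
    qed
    also have "\<dots> ^ n * ennreal ?e \<le> ennreal (exp (\<kappa> - mixL2 \<sigma> r H / 8)) ^ n * ennreal ?e"
      unfolding \<kappa>_def by (intro mult_right_mono power_mono affinity_bound[OF rP H sg(1) n0 vm v0 vI I0]) auto
    also have "\<dots> = ennreal (exp (\<kappa> - mixL2 \<sigma> r H / 8) ^ n * ?e)"
      by (simp add: ennreal_power ennreal_mult)
    also have "exp (\<kappa> - mixL2 \<sigma> r H / 8) ^ n * ?e = 1"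
      by (simp add: exp_of_nat_mult[symmetric] exp_add[symmetric] algebra_simps)
    finally show ?thesis by simp
  qed
  have Z0: "Z r X \<ge> 0" for r X unfolding Z_def by (intro mult_nonneg_nonneg prod_nonneg) (auto simp: apos)
  have Elq: "(\<integral>\<^sup>+x. ennreal (lq x) \<partial>\<mu>) \<le> ennreal (4 * L) * F + ennreal (256 * L / real n)"
  proof -
    have "(\<integral>\<^sup>+x. ennreal (lq x) \<partial>\<mu>) = (\<integral>\<^sup>+x. ennreal 2 * (ennreal (L + ln (infdist x S / M)) * indicator (- fatten M S) x * ennreal (mix \<sigma> H x)) \<partial>lborel)"
    proof -
      have "(\<integral>\<^sup>+x. ennreal (lq x) \<partial>\<mu>) = (\<integral>\<^sup>+x. ennreal (f x) * ennreal (lq x) \<partial>lborel)"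
        unfolding \<mu>_def by (rule nn_integral_density) measurable
      also have "\<dots> = (\<integral>\<^sup>+x. ennreal 2 * (ennreal (L + ln (infdist x S / M)) * indicator (- fatten M S) x * ennreal (mix \<sigma> H x)) \<partial>lborel)"
      proof (rule nn_integral_cong)
        fix x
        have "ennreal (lq x) = ennreal 2 * (ennreal (L + ln (infdist x S / M)) * indicator (- fatten M S) x)"
          using ennreal_mult'[of 2 "L + ln (infdist x S / M)"]
          by (cases "x \<in> fatten M S") (simp_all add: lq_def)
        then show "ennreal (f x) * ennreal (lq x) = ennreal 2 * (ennreal (L + ln (infdist x S / M)) * indicator (- fatten M S) x * ennreal (mix \<sigma> H x))"
          by (simp only: f_def mult_ac)
      qed
      finally show ?thesis .
    qed
    also have "\<dots> = ennreal 2 * (\<integral>\<^sup>+x. ennreal (L + ln (infdist x S / M)) * indicator (- fatten M S) x * ennreal (mix \<sigma> H x) \<partial>lborel)"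
      by (rule nn_integral_cmult) measurable
    also have "\<dots> \<le> ennreal 2 * (ennreal (2 * L) * F + ennreal (128 * L * exp (- L)))"
      unfolding F_def
      by (intro mult_left_mono mixture_tail[OF H sg(2) sg(2) order_refl _ M[folded \<sigma>_def] p]) (use L1 in auto)
    also have "\<dots> = ennreal (4 * L) * F + ennreal (256 * L / real n)"
    proof -
      have "exp (- L) = 1 / real n" using expL by (simp add: exp_minus inverse_eq_divide)
      moreover have "ennreal 2 * ennreal (2 * L) = ennreal (4 * L)" using L1 by (subst ennreal_mult[symmetric]) auto
      moreover have "ennreal 2 * ennreal (128 * L * (1 / real n)) = ennreal (256 * L / real n)"
        using L1 by (subst ennreal_mult[symmetric]) auto
      ultimately show ?thesis by (simp only: distrib_left mult.assoc[symmetric])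
    qed
    finally show ?thesis .
  qed
  have m1[measurable]: "(\<lambda>X. \<Sum>r\<in>R. ennreal (Z r X)) \<in> borel_measurable (PiM {1..n} (\<lambda>_. \<mu>))"
    by (intro borel_measurable_sum measurable_compose[OF Zm measurable_ennreal])
  have m2[measurable]: "(\<lambda>X. \<Sum>i\<in>{1..n}. ennreal (lq (X i))) \<in> borel_measurable (PiM {1..n} (\<lambda>_. \<mu>))"
    by (intro borel_measurable_sum lqX)
  show thesis
  proof (rule that[of W])
    show "W \<in> borel_measurable (hier_model n c H)"
      unfolding hm W_def by measurable
    show "ennreal (mixL2 (\<sigma>\<^sub>s c) Hh H) \<le> W X" if np: "is_npmle n c X Hh" for X Hh
    proof -
      have HhP: "Hh \<in> borel_probs" and ll: "log_lik n c X H \<le> log_lik n c X Hh"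
        using np H by (auto simp: is_npmle_def is_arg_max_def not_less)
      obtain r where r: "r \<in> R" "mixL2 \<sigma> Hh H \<le> 2 * mixL2 \<sigma> r H"
        "\<forall>x t. t \<in> T \<longrightarrow> \<bar>x - t\<bar> \<le> 2 * M \<longrightarrow> \<bar>mix \<sigma> Hh x - mix \<sigma> r x\<bar> \<le> 1 / (real n)\<^sup>2"
        using R(4)[OF HhP] by auto
      have rP: "r \<in> borel_probs" using r R(1) by auto
      have apos': "a r x > 0" for x
        unfolding a_def using mix_pos[OF rP sg(2), of x] v0[of x] fpos[of x] by (simp add: add_pos_nonneg)
      \<comment> \<open>The factor 2 appears because \<open>a r\<close> is the square root of a likelihood ratio.\<close>
      have pt: "ln (mix \<sigma> Hh x) - ln (f x) \<le> 2 * ln (a r x) + lq x" for x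
      proof -
        have g: "mix \<sigma> r x + v x > 0" using mix_pos[OF rP sg(2), of x] v0[of x] by simp
        have "ln (mix \<sigma> Hh x) \<le> ln ((mix \<sigma> r x + v x) * exp (lq x))"
          using envelope[OF HhP r(3), of x] mix_pos[OF HhP sg(2), of x] g by (subst ln_le_cancel_iff) auto
        also have "\<dots> = ln (mix \<sigma> r x + v x) + lq x" using g by (simp add: ln_mult)
        finally have "ln (mix \<sigma> Hh x) - ln (f x) \<le> ln ((mix \<sigma> r x + v x) / f x) + lq x"
          using g fpos[of x] by (simp add: ln_div)
        also have "ln ((mix \<sigma> r x + v x) / f x) = 2 * ln (a r x)"
          unfolding a_def using g fpos[of x] by (simp add: ln_sqrt)
        finally show ?thesis .
      qed
      have "0 \<le> (\<Sum>i=1..n. ln (mix \<sigma> Hh (X i)) - ln (f (X i)))"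
        using ll by (simp add: log_lik_def f_dens_eq_mix sum_subtractf f_def \<sigma>_def)
      also have "\<dots> \<le> (\<Sum>i=1..n. 2 * ln (a r (X i)) + lq (X i))" by (intro sum_mono pt)
      also have "\<dots> = 2 * (\<Sum>i=1..n. ln (a r (X i))) + (\<Sum>i=1..n. lq (X i))"
        by (simp add: sum.distrib sum_distrib_left)
      finally have 1: "0 \<le> 2 * (\<Sum>i=1..n. ln (a r (X i))) + (\<Sum>i=1..n. lq (X i))" .
      have Zp: "Z r X > 0" unfolding Z_def by (intro mult_pos_pos prod_pos apos') auto
      have "ln (Z r X) = (\<Sum>i=1..n. ln (a r (X i))) + real n * (mixL2 \<sigma> r H / 8 - \<kappa>)"
        unfolding Z_def using apos' by (subst ln_mult) (auto intro!: prod_pos ln_prod simp: order.strict_implies_not_eq[symmetric])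
      moreover have "ln (Z r X) \<le> ln N + Z r X / N"
      proof -
        have "ln (Z r X / N) \<le> Z r X / N - 1" using Zp N by (intro ln_le_minus_one) simp
        then show ?thesis using Zp N by (simp add: ln_div)
      qed
      moreover have "Z r X / N \<le> (\<Sum>r\<in>R. Z r X) * (1 / N)"
      proof -
        have "Z r X \<le> (\<Sum>r\<in>R. Z r X)"
          using r(1) R(2) by (intro member_le_sum) (auto simp: Z0)
        then show ?thesis using N by (simp add: divide_right_mono)
      qed
      moreover have "real n * (mixL2 \<sigma> r H / 8 - \<kappa>) = real n * mixL2 \<sigma> r H / 8 - real n * \<kappa>" by (simp add: algebra_simps)
      ultimately have "real n * mixL2 \<sigma> r H / 8 \<le> ln N + real n * \<kappa> + (\<Sum>r\<in>R. Z r X) * (1 / N) + 1 / 2 * (\<Sum>i=1..n. lq (X i))"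
        using 1 by linarith
      then have "16 / real n * (real n * mixL2 \<sigma> r H / 8) \<le> 16 / real n * (ln N + real n * \<kappa> + (\<Sum>r\<in>R. Z r X) * (1 / N) + 1 / 2 * (\<Sum>i=1..n. lq (X i)))"
        by (intro mult_left_mono) auto
      moreover have "16 / real n * (real n * mixL2 \<sigma> r H / 8) = 2 * mixL2 \<sigma> r H" using n0 by simp
      ultimately have "mixL2 \<sigma> Hh H \<le> 16 / real n * (ln N + real n * \<kappa> + (\<Sum>r\<in>R. Z r X) * (1 / N) + 1 / 2 * (\<Sum>i=1..n. lq (X i)))"
        using r(2) by (simp only:)
      then have "ennreal (mixL2 \<sigma> Hh H) \<le> ennreal (16 / real n * (ln N + real n * \<kappa> + (\<Sum>r\<in>R. Z r X) * (1 / N) + 1 / 2 * (\<Sum>i=1..n. lq (X i))))"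
        by (rule ennreal_leI)
      also have "\<dots> = W X"
      proof -
        have "\<kappa> \<ge> 0" using I0 by (simp add: \<kappa>_def)
        moreover note Z0
        ultimately show ?thesis unfolding W_def using N lq0
          by (simp add: ennreal_mult' ennreal_plus sum_nonneg sum_ennreal del: times_divide_eq_left times_divide_eq_right)
      qed
      finally show ?thesis by (simp add: \<sigma>_def)
    qed
    have "(\<integral>\<^sup>+X. W X \<partial>hier_model n c H) = ennreal (16 / real n) * (ennreal (ln N + real n * \<kappa>)
        + (\<Sum>r\<in>R. (\<integral>\<^sup>+X. ennreal (Z r X) \<partial>PiM {1..n} (\<lambda>_. \<mu>))) * ennreal (1 / N)
        + ennreal (1 / 2) * (\<integral>\<^sup>+X. (\<Sum>i\<in>{1..n}. ennreal (lq (X i))) \<partial>PiM {1..n} (\<lambda>_. \<mu>)))"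
    proof -
      interpret P: prob_space "PiM {1..n} (\<lambda>_. \<mu>)" by (rule prob_space_PiM) (rule \<mu>p)
      have "(\<integral>\<^sup>+X. (\<Sum>r\<in>R. ennreal (Z r X)) \<partial>PiM {1..n} (\<lambda>_. \<mu>)) = (\<Sum>r\<in>R. (\<integral>\<^sup>+X. ennreal (Z r X) \<partial>PiM {1..n} (\<lambda>_. \<mu>)))"
        by (intro nn_integral_sum measurable_compose[OF Zm measurable_ennreal])
      then show ?thesis unfolding hm W_def using m1 m2 P.emeasure_space_1
        by (simp add: nn_integral_cmult nn_integral_add nn_integral_multc)
    qed
    also have "\<dots> \<le> ennreal (16 / real n) * (ennreal (ln N + real n * \<kappa>) + (\<Sum>r\<in>R. 1) * ennreal (1 / N)
        + ennreal (1 / 2) * (of_nat n * (ennreal (4 * L) * F + ennreal (256 * L / real n))))"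
    proof (intro mult_left_mono add_mono mult_right_mono sum_mono EZ order_refl)
      have "(\<integral>\<^sup>+X. (\<Sum>i\<in>{1..n}. ennreal (lq (X i))) \<partial>PiM {1..n} (\<lambda>_. \<mu>)) = of_nat n * (\<integral>\<^sup>+x. ennreal (lq x) \<partial>\<mu>)"
        by (rule nn_integral_PiM_sum[OF \<mu>p]) measurable
      also have "\<dots> \<le> of_nat n * (ennreal (4 * L) * F + ennreal (256 * L / real n))" by (intro mult_left_mono Elq) auto
      finally show "(\<integral>\<^sup>+X. (\<Sum>i\<in>{1..n}. ennreal (lq (X i))) \<partial>PiM {1..n} (\<lambda>_. \<mu>)) \<le> of_nat n * (ennreal (4 * L) * F + ennreal (256 * L / real n))" .
    qed auto
    also have "(\<Sum>r\<in>R. 1) * ennreal (1 / N) = 1"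
      using N by (simp add: N_def ennreal_of_nat_eq_real_of_nat flip: ennreal_mult)
    also have "ennreal (16 / real n) * (ennreal (ln N + real n * \<kappa>) + 1 + ennreal (1 / 2) * (of_nat n * (ennreal (4 * L) * F + ennreal (256 * L / real n))))
      = ennreal (16 / real n * (ln N + real n * \<kappa> + 1 + 128 * L)) + ennreal (32 * L) * F"
    proof -
      have k0: "ln N + real n * \<kappa> \<ge> 0" using N I0 by (simp add: \<kappa>_def)
      have e1: "ennreal (16 / real n) * (ennreal (1 / 2) * (of_nat n * (ennreal (4 * L) * F))) = ennreal (32 * L) * F"
      proof -
        have "ennreal (16 / real n) * (ennreal (1 / 2) * (of_nat n * (ennreal (4 * L) * F)))
          = (ennreal (16 / real n) * ennreal (1 / 2) * ennreal (real n) * ennreal (4 * L)) * F"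
          by (simp only: ennreal_of_nat_eq_real_of_nat mult.assoc)
        also have "ennreal (16 / real n) * ennreal (1 / 2) * ennreal (real n) * ennreal (4 * L) = ennreal (16 / real n * (1 / 2) * real n * (4 * L))"
        proof -
          have "ennreal w * ennreal x * ennreal y * ennreal z = ennreal (w * x * y * z)"
            if "w \<ge> 0" "x \<ge> 0" "y \<ge> 0" "z \<ge> 0" for w x y z
            using that by (simp add: ennreal_mult)
          then show ?thesis by this (use L1 in auto)
        qed
        also have "16 / real n * (1 / 2) * real n * (4 * L) = 32 * L" using n0 by simp
        finally show ?thesis .
      qed
      have e2: "ennreal (1 / 2) * (of_nat n * ennreal (256 * L / real n)) = ennreal (128 * L)"
      proof -
        have "ennreal (1 / 2) * (of_nat n * ennreal (256 * L / real n)) = ennreal (1 / 2 * (real n * (256 * L / real n)))"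
        proof -
          have "ennreal x * (ennreal y * ennreal z) = ennreal (x * (y * z))"
            if "x \<ge> 0" "y \<ge> 0" "z \<ge> 0" for x y z
            using that by (simp add: ennreal_mult)
          then show ?thesis unfolding ennreal_of_nat_eq_real_of_nat by this (use L1 in auto)
        qed
        also have "1 / 2 * (real n * (256 * L / real n)) = 128 * L" using n0 by simp
        finally show ?thesis .
      qed
      have "ennreal (16 / real n) * (ennreal (ln N + real n * \<kappa>) + 1 + ennreal (128 * L)) = ennreal (16 / real n * (ln N + real n * \<kappa> + 1 + 128 * L))"
        using k0 L1 by (simp add: ennreal_mult' ennreal_plus add_nonneg_nonneg del: times_divide_eq_left)
      moreover have "k * (a + 1 + h * (m * (x + y))) = k * (a + 1 + h * (m * y)) + k * (h * (m * x))" for k a h m x y :: ennreal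
        by (simp add: distrib_left add_ac)
      ultimately show ?thesis by (simp only: e1 e2)
    qed
    also have "\<dots> \<le> ennreal (3900 * (V * (M / real n) * L powr (3 / 2))) + ennreal (32 * L) * F"
    proof (intro add_right_mono ennreal_leI)
      define Y where "Y = real (card T) * M * L powr (3 / 2)"
      have Lp: "L powr (3 / 2) = L * sqrt L" using L1 powr_add[of L 1 "1 / 2"] by (simp add: powr_half_sqrt)
      have "L * sqrt L \<ge> 2 / 3 * (3 / 4)" using L1 sL by (intro mult_mono) auto
      then have Lp2: "L powr (3 / 2) \<ge> 1 / 2" unfolding Lp by simp
      have TM: "real (card T) * M \<ge> 1 * M" using cT M0 by (intro mult_right_mono) auto
      have Y1: "real (card T) * M * (1 / 2) \<le> Y" unfolding Y_def using Lp2 M0 by (intro mult_left_mono) auto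
      have Y2: "L \<le> Y"
      proof -
        have "3 * sqrt L * (L * sqrt L) \<le> real (card T) * M * (L * sqrt L)" using TM M3 L1 by (intro mult_right_mono) auto
        moreover have "3 * sqrt L * (L * sqrt L) = 3 * L * L" using L1 by simp
        moreover have "3 * (2 / 3) * L \<le> 3 * L * L" using L1 by (intro mult_right_mono mult_left_mono) auto
        ultimately show ?thesis unfolding Y_def Lp using L1 by linarith
      qed
      have Y3: "1 \<le> Y" using Y1 TM M2s sg by linarith
      have "real n * \<kappa> = 1 / 2 + 10 * (real (card T) * M)"
        using n0 by (simp add: \<kappa>_def I_def power2_eq_square field_simps)
      moreover have "ln N \<le> 320 * Y" using R(3) by (simp add: N_def Y_def mult.assoc)
      ultimately have "ln N + real n * \<kappa> + 1 + 128 * L \<le> 480 * Y" using Y1 Y2 Y3 by linarith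
      then have "16 / real n * (ln N + real n * \<kappa> + 1 + 128 * L) \<le> 16 / real n * (480 * Y)" by (intro mult_left_mono) auto
      also have "Y \<le> V / 2 * M * L powr (3 / 2)"
      proof -
        have "real (card T) * 2 \<le> real (card T) * (2 * \<sigma>)" using sg by (intro mult_left_mono) auto
        then have "real (card T) \<le> V / 2" using T(5) by linarith
        then show ?thesis unfolding Y_def using M0 by (intro mult_right_mono) auto
      qed
      then have "16 / real n * (480 * Y) \<le> 16 / real n * (480 * (V / 2 * M * L powr (3 / 2)))" by (intro mult_left_mono) auto
      also have "\<dots> = 3840 * (V * (M / real n) * L powr (3 / 2))" by simp
      also have "\<dots> \<le> 3900 * (V * (M / real n) * L powr (3 / 2))"
        using M0 by (intro mult_right_mono) (auto simp: V_def)
      finally show "16 / real n * (ln N + real n * \<kappa> + 1 + 128 * L) \<le> 3900 * (V * (M / real n) * L powr (3 / 2))" .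
    qed
    finally show "(\<integral>\<^sup>+X. W X \<partial>hier_model n c H) \<le> ennreal (3900 * (measure lborel (fatten (\<sigma>\<^sub>s c) S) * (M / real n) * L powr (3 / 2)))
       + ennreal (32 * L) * (\<integral>\<^sup>+\<xi>. ennreal ((2 * infdist \<xi> S / M) powr p) \<partial>H)"
      by (simp add: V_def F_def \<sigma>_def)
  qed
qed

section \<open>Rate for the weighted total variation\<close>

text \<open>The net of \<open>packing_net\<close> covers the \<open>M\<close>-neighbourhood by intervals of radius \<open>2 M\<close>, while its cardinality is
bounded by the volume of the \<open>r\<close>-neighbourhood.\<close>

lemma measure_fatten_le:
  assumes S: "compact S" "S \<noteq> {}" and r: "r > 0" and M: "M \<ge> 2 * r"
  shows "r * measure lborel (fatten M S) \<le> 2 * M * measure lborel (fatten r S)"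
    and "2 * r \<le> measure lborel (fatten r S)"
proof -
  obtain T where T: "finite T" "T \<subseteq> S" "T \<noteq> {}"
    "\<And>x. \<exists>t\<in>T. \<bar>x - t\<bar> \<le> infdist x S + 2 * r" "real (card T) * (2 * r) \<le> measure lborel (fatten r S)"
    using packing_net[OF S r] by metis
  have cT: "real (card T) \<ge> 1" using T by (simp add: Suc_leI card_gt_0_iff)
  have "1 * (2 * r) \<le> real (card T) * (2 * r)" using cT r by (intro mult_right_mono) auto
  then show "2 * r \<le> measure lborel (fatten r S)" using T(5) by linarith
  have sub: "fatten M S \<subseteq> (\<Union>t\<in>T. {t - 2 * M .. t + 2 * M})"
  proof
    fix x assume x: "x \<in> fatten M S"
    obtain t where t: "t \<in> T" "\<bar>x - t\<bar> \<le> infdist x S + 2 * r" using T(4) by auto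
    then have "\<bar>x - t\<bar> \<le> 2 * M" using x M by (simp add: fatten_def)
    then show "x \<in> (\<Union>t\<in>T. {t - 2 * M .. t + 2 * M})" using t(1) by (auto simp: abs_le_iff intro!: bexI[of _ t])
  qed
  have "measure lborel (fatten M S) \<le> measure lborel (\<Union>t\<in>T. {t - 2 * M .. t + 2 * M})"
    using T(1) by (intro measure_mono_fmeasurable[OF sub] fmeasurable.finite_UN) (auto intro!: fmeasurableI simp: emeasure_lborel_Icc_eq)
  also have "\<dots> \<le> (\<Sum>t\<in>T. measure lborel {t - 2 * M .. t + 2 * M})"
    using T(1) by (intro measure_UNION_le) auto
  also have "\<dots> = real (card T) * (4 * M)" using M r by simp
  finally have "r * measure lborel (fatten M S) \<le> r * (real (card T) * (4 * M))" using r by (intro mult_left_mono) auto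
  also have "\<dots> = real (card T) * (2 * r) * (2 * M)" by simp
  also have "\<dots> \<le> measure lborel (fatten r S) * (2 * M)" using T(5) M r by (intro mult_right_mono) auto
  finally show "r * measure lborel (fatten M S) \<le> 2 * M * measure lborel (fatten r S)" by (simp add: mult_ac)
qed

lemma wTV_le_mixL2_plus_tail:
  assumes H': "H' \<in> borel_probs" and H: "H \<in> borel_probs" and c: "c > 0" and L: "L \<ge> 2 / 3"
    and M: "M \<ge> sqrt (10 * (\<sigma>\<^sub>s c)\<^sup>2 * L)" and S: "compact S" "S \<noteq> {}" and p: "p \<ge> 1 / L" and \<tau>: "\<tau> > 0"
  shows "wTV c H' H \<le> ennreal (2 * (\<tau> * measure lborel (fatten M S) + mixL2 c H' H / \<tau>))
    + ennreal 4 * (\<integral>\<^sup>+\<xi>. ennreal ((2 * infdist \<xi> S / M) powr p) \<partial>H) + ennreal (256 * exp (- L))"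
proof -
  note [measurable] = measurable_mix[OF H] measurable_mix[OF H']
  define F where "F = (\<integral>\<^sup>+\<xi>. ennreal ((2 * infdist \<xi> S / M) powr p) \<partial>H)"
  define t where "t = (\<integral>\<^sup>+x. ennreal (mix c H x) * indicator (- fatten M S) x \<partial>lborel)"
  have M0: "M > 0"
  proof -
    have "0 < sqrt (10 * (\<sigma>\<^sub>s c)\<^sup>2 * L)" using L sigma_s(2)[of c] by simp
    then show ?thesis using M by linarith
  qed
  have "ennreal L * t = (\<integral>\<^sup>+x. ennreal L * (ennreal (mix c H x) * indicator (- fatten M S) x) \<partial>lborel)"
    unfolding t_def by (rule nn_integral_cmult[symmetric]) measurable
  also have "\<dots> \<le> (\<integral>\<^sup>+x. ennreal (L + ln (infdist x S / M)) * indicator (- fatten M S) x * ennreal (mix c H x) \<partial>lborel)"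
  proof (rule nn_integral_mono)
    fix x
    show "ennreal L * (ennreal (mix c H x) * indicator (- fatten M S) x) \<le> ennreal (L + ln (infdist x S / M)) * indicator (- fatten M S) x * ennreal (mix c H x)"
    proof (cases "x \<in> fatten M S")
      case False
      then have "infdist x S / M > 1" using M0 by (simp add: fatten_def)
      then have "ennreal L \<le> ennreal (L + ln (infdist x S / M))" by (intro ennreal_leI) simp
      then show ?thesis using False by (simp add: mult_right_mono)
    qed simp
  qed
  also have "\<dots> \<le> ennreal (2 * L) * F + ennreal (128 * L * exp (- L))"
    unfolding F_def using L by (intro mixture_tail[OF H sigma_s(2) c sigma_s(4) _ M p]) auto
  also have "\<dots> = ennreal L * (ennreal 2 * F + ennreal (128 * exp (- L)))"
  proof -
    have "ennreal (2 * L) = ennreal L * ennreal 2" "ennreal (128 * L * exp (- L)) = ennreal L * ennreal (128 * exp (- L))"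
      using L ennreal_mult[of L 2] ennreal_mult[of L "128 * exp (- L)"] by (simp_all add: mult_ac)
    then show ?thesis by (simp only: distrib_left mult.assoc)
  qed
  finally have tl: "t \<le> ennreal 2 * F + ennreal (128 * exp (- L))"
    using L by (simp add: ennreal_mult_le_mult_iff)
  have "wTV c H' H \<le> (\<integral>\<^sup>+x. ennreal \<bar>mix c H' x - mix c H x\<bar> \<partial>lborel)" by (rule wTV_le[OF H' H c])
  also have "\<dots> \<le> 2 * (\<integral>\<^sup>+x. ennreal \<bar>mix c H' x - mix c H x\<bar> * indicator (fatten M S) x \<partial>lborel) + 2 * t"
    unfolding t_def by (rule L1_mix_split[OF H' H c]) measurable
  also have "\<dots> \<le> 2 * ennreal (\<tau> * measure lborel (fatten M S) + mixL2 c H' H / \<tau>) + 2 * (ennreal 2 * F + ennreal (128 * exp (- L)))"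
    by (intro add_mono mult_left_mono tl L1_le_L2_on[OF H' H c _ _ \<tau>] fatten_finite[OF S]) auto
  also have "\<dots> = ennreal (2 * (\<tau> * measure lborel (fatten M S) + mixL2 c H' H / \<tau>)) + ennreal 4 * F + ennreal (256 * exp (- L))"
  proof -
    have "2 * ennreal x = ennreal (2 * x)" for x by (simp add: ennreal_mult')
    from this[of "\<tau> * measure lborel (fatten M S) + mixL2 c H' H / \<tau>"] this[of "128 * exp (- L)"]
    have "2 * ennreal (\<tau> * measure lborel (fatten M S) + mixL2 c H' H / \<tau>) = ennreal (2 * (\<tau> * measure lborel (fatten M S) + mixL2 c H' H / \<tau>))"
      "2 * ennreal (128 * exp (- L)) = ennreal (256 * exp (- L))" by simp_all
    moreover have "2 * (ennreal 2 * F) = ennreal 4 * F" by (simp flip: mult.assoc)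
    ultimately show ?thesis by (simp only: distrib_left add.assoc)
  qed
  finally show ?thesis unfolding F_def .
qed

lemma wTV_le_2:
  assumes "H' \<in> borel_probs" "H \<in> borel_probs" "c > 0"
  shows "wTV c H' H \<le> 2"
  using wTV_le[OF assms] L1_mix_le_2[OF assms] by (rule order_trans)

text \<open>A linear majorant of the power, which allows a bound on the mean of \<open>D\<close> to be inserted after integration.\<close>

lemma powr_add_le_linear:
  fixes q D \<alpha> :: real
  assumes "q > 0" "D \<ge> 0" "0 \<le> \<alpha>" "\<alpha> \<le> 1"
  shows "(D + q) powr \<alpha> \<le> q powr \<alpha> * (1 + D / q)"
proof -
  have "(D + q) = q * (1 + D / q)" using assms by (simp add: field_simps)
  then have "(D + q) powr \<alpha> = q powr \<alpha> * (1 + D / q) powr \<alpha>" using assms by (simp add: powr_mult)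
  also have "(1 + D / q) powr \<alpha> \<le> (1 + D / q) powr 1" using assms by (intro powr_mono) auto
  then have "q powr \<alpha> * (1 + D / q) powr \<alpha> \<le> q powr \<alpha> * (1 + D / q)" using assms by (intro mult_left_mono) auto
  finally show ?thesis .
qed

text \<open>If \<open>\<epsilon>\<^sub>n \<ge> 1\<close>, the claim holds because the weighted total variation is bounded and \<open>M V \<ge> 1\<close>. Otherwise write
\<open>q = \<epsilon>\<^sub>n\<^sup>2\<close> and \<open>R = \<epsilon>\<^sub>n powr \<alpha>\<close>. The mean of the squared marginal error \<open>D\<close> is of order \<open>q\<close>, so by deconvolution
the squared prior error is of order \<open>R\<^sup>2 (1 + D / q)\<close>. With the balancing parameter \<open>\<tau> = R / sqrt (M V)\<close> the \<open>L\<^sup>1\<close>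
distance on \<open>B\<close>, of volume at most \<open>2 M V\<close>, is of order \<open>sqrt (M V) R (1 + D / q)\<close>, which integrates to the claimed
rate. The tail terms are of order \<open>q \<le> R\<close>.\<close>

lemma npmle_wTV_bound:
  fixes n :: nat
  assumes n: "n \<ge> 2" and c: "c > 0" and H: "H \<in> borel_probs"
    and M: "M \<ge> sqrt (10 * (\<sigma>\<^sub>s c)\<^sup>2 * ln (real n))" and S: "compact S" "S \<noteq> {}"
    and np: "\<And>X. X \<in> space (hier_model n c H) \<Longrightarrow> is_npmle n c X (Hhat X)"
  shows "(\<integral>\<^sup>+X. wTV c (Hhat X) H \<partial>hier_model n c H)
    \<le> ennreal ((8002 * (1 + 8 / c) + 1000) * sqrt (M * measure lborel (fatten (\<sigma>\<^sub>s c) S)))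
      * epowr (eps c n M S H) (\<alpha>\<^sub>s c)"
proof -
  define L where "L = ln (real n)"
  define V where "V = measure lborel (fatten (\<sigma>\<^sub>s c) S)"
  define K where "K = 1 + 8 / c"
  define \<alpha> where "\<alpha> = \<alpha>\<^sub>s c"
  define B where "B = sqrt (M * V)"
  define A where "A = V * (M / real n) * L powr (3 / 2)"
  define e2 where "e2 = eps_sq c n M S H"
  have K: "K \<ge> 1" using c by (simp add: K_def)
  have "1 + c\<^sup>2 > 0" by (intro add_pos_nonneg) auto
  then have al: "0 \<le> \<alpha>" "\<alpha> \<le> 1" by (simp_all add: \<alpha>_def \<alpha>\<^sub>s_def sigma_s(3))
  have sg: "\<sigma>\<^sub>s c \<ge> 1" by (rule sigma_s)
  have n0: "real n > 0" using n by simp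
  have L1: "L \<ge> 2 / 3" unfolding L_def by (rule ln_nat_ge_two_thirds[OF n])
  have expL: "exp (- L) = 1 / real n" using n0 by (simp add: L_def exp_minus inverse_eq_divide)
  have M_cutoff: "M \<ge> sqrt (10 * (\<sigma>\<^sub>s c)\<^sup>2 * L)" using M by (simp add: L_def)
  have M2s: "M \<ge> 2 * \<sigma>\<^sub>s c" and M3: "M \<ge> 3 * sqrt L" using cutoff_bounds[OF sg L1 M_cutoff] by auto
  have M0: "M > 0" using M2s sg by simp
  have V2: "V \<ge> 2" and VM: "measure lborel (fatten M S) \<le> 2 * (M * V)"
  proof -
    note vol = measure_fatten_le[OF S sigma_s(2) M2s]
    show "V \<ge> 2" using vol(2) sg by (simp add: V_def)
    have "1 * measure lborel (fatten M S) \<le> \<sigma>\<^sub>s c * measure lborel (fatten M S)"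
      using sg by (intro mult_right_mono) auto
    then show "measure lborel (fatten M S) \<le> 2 * (M * V)" using vol(1) by (simp add: V_def)
  qed
  have B1: "B \<ge> 1"
  proof -
    have "1 * 1 \<le> M * V" using M2s V2 sg by (intro mult_mono) auto
    then show ?thesis by (simp add: B_def)
  qed
  have LA: "L / real n \<le> A"
  proof -
    have "L powr (3 / 2) = L * sqrt L" using L1 powr_add[of L 1 "1 / 2"] by (simp add: powr_half_sqrt)
    then have "A * real n = V * (M * (L * sqrt L))" using n0 by (simp add: A_def)
    moreover have "2 * (3 * sqrt L * (L * sqrt L)) \<le> V * (M * (L * sqrt L))"
      using V2 M3 L1 M0 by (intro mult_mono mult_right_mono) auto
    moreover have "2 * (3 * sqrt L * (L * sqrt L)) = 6 * L * L" using L1 by simp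
    moreover have "6 * (2 / 3) * L \<le> 6 * L * L" using L1 by (intro mult_right_mono mult_left_mono) auto
    ultimately have "L \<le> A * real n" using L1 by linarith
    then show ?thesis using n0 by (simp add: divide_le_eq)
  qed
  have A0: "A > 0" using LA L1 n0 by (smt (verit) divide_pos_pos)
  have hmP: "prob_space (hier_model n c H)"
  proof -
    have "prob_space (density lborel (\<lambda>x. ennreal (mix (\<sigma>\<^sub>s c) H x)))"
      using measurable_mix[OF H] nn_integral_mix_1[OF H sigma_s(2)]
      by (intro prob_spaceI) (simp add: emeasure_density)
    then show ?thesis unfolding hier_model_eq[OF H c] by (intro prob_space_PiM)
  qed
  have HhP: "Hhat X \<in> borel_probs" if "X \<in> space (hier_model n c H)" for X
    using np[OF that] by (auto simp: is_npmle_def is_arg_max_def)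
  have e2_eq: "e2 = ennreal A + ennreal L * (INF p\<in>{1 / L..}. epowr (2 * moment p S H / ennreal M) p)"
    by (simp add: e2_def eps_sq_def A_def L_def V_def)
  have main: "(\<integral>\<^sup>+X. wTV c (Hhat X) H \<partial>hier_model n c H)
    \<le> ennreal ((8002 * K + 1000) * B) * epowr (epowr e2 (1 / 2)) \<alpha>"
  proof (cases "e2 < 1")
    case False
    then have e1: "epowr (epowr e2 (1 / 2)) \<alpha> \<ge> 1"
    proof (cases e2)
      case (real q)
      then have "q \<ge> 1" using False by (simp add: not_less)
      then show ?thesis using real al by (simp add: epowr_def ge_one_powr_ge_zero)
    qed (simp add: epowr_def)
    have "(\<integral>\<^sup>+X. wTV c (Hhat X) H \<partial>hier_model n c H) \<le> (\<integral>\<^sup>+X. 2 \<partial>hier_model n c H)"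
      by (intro nn_integral_mono wTV_le_2 HhP H c)
    also have "\<dots> = ennreal 2 * 1" using prob_space.emeasure_space_1[OF hmP] by simp
    also have "\<dots> \<le> ennreal ((8002 * K + 1000) * B) * epowr (epowr e2 (1 / 2)) \<alpha>"
    proof (intro mult_mono e1 ennreal_leI)
      have "2 * 1 \<le> (8002 * K + 1000) * B" using K B1 by (intro mult_mono) auto
      then show "2 \<le> (8002 * K + 1000) * B" by simp
    qed auto
    finally show ?thesis .
  next
    case True
    then obtain q where q: "e2 = ennreal q" "q \<ge> 0" "q < 1"
      by (cases e2) (auto simp: ennreal_less_iff simp flip: ennreal_1)
    define J where "J = (INF p\<in>{1 / L..}. epowr (2 * moment p S H / ennreal M) p)"
    have J: "ennreal A + ennreal L * J = ennreal q" using e2_eq q(1) by (simp add: J_def)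
    have Aq: "A \<le> q"
    proof -
      have "ennreal A \<le> ennreal q" unfolding J[symmetric] by simp
      then show ?thesis using q(2) by simp
    qed
    have q0: "q > 0" using Aq A0 by simp
    \<comment> \<open>The infimum over \<open>p\<close> is attained up to \<open>1 / n\<close>, and this slack is covered by the volume term of \<open>\<epsilon>\<^sub>n\<^sup>2\<close>.\<close>
    have "J \<noteq> top" using J L1 by (auto simp: ennreal_mult_top)
    then have "J < J + ennreal (1 / real n)" using n0 by (cases J) (auto simp: ennreal_less_iff simp flip: ennreal_plus)
    then obtain p where p: "p \<ge> 1 / L" and pJ: "epowr (2 * moment p S H / ennreal M) p < J + ennreal (1 / real n)"
      unfolding J_def INF_less_iff by auto
    have p0: "p > 0"
    proof -
      have "1 / L > 0" using L1 by simp
      then show ?thesis using p by linarith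
    qed
    define F where "F = (\<integral>\<^sup>+\<xi>. ennreal ((2 * infdist \<xi> S / M) powr p) \<partial>H)"
    have LF: "ennreal L * F \<le> ennreal q"
    proof -
      have "ennreal L * F \<le> ennreal L * (J + ennreal (1 / real n))"
        using pJ unfolding F_def epowr_moment[OF H p0 M0] by (intro mult_left_mono) auto
      also have "\<dots> = ennreal L * J + ennreal (L / real n)"
        using L1 by (simp add: distrib_left flip: ennreal_mult)
      also have "\<dots> \<le> ennreal L * J + ennreal A" by (intro add_left_mono ennreal_leI LA)
      also have "\<dots> = ennreal q" using J by (simp add: add.commute)
      finally show ?thesis .
    qed
    obtain W :: "(nat \<Rightarrow> real) \<Rightarrow> ennreal" where W: "W \<in> borel_measurable (hier_model n c H)"
      "\<And>X Hh. is_npmle n c X Hh \<Longrightarrow> ennreal (mixL2 (\<sigma>\<^sub>s c) Hh H) \<le> W X"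
      "(\<integral>\<^sup>+X. W X \<partial>hier_model n c H) \<le> ennreal (3900 * A) + ennreal (32 * L) * F"
      using npmle_L2_risk[OF n c H L_def M_cutoff S p] unfolding A_def V_def F_def by metis
    have EW: "(\<integral>\<^sup>+X. W X \<partial>hier_model n c H) \<le> ennreal (4000 * q)"
    proof -
      have "ennreal (32 * L) * F = ennreal 32 * (ennreal L * F)" using L1 by (simp add: ennreal_mult mult.assoc)
      also have "\<dots> \<le> ennreal 32 * ennreal q" by (intro mult_left_mono LF) auto
      finally have "ennreal (3900 * A) + ennreal (32 * L) * F \<le> ennreal (3900 * A) + ennreal 32 * ennreal q"
        by (rule add_left_mono)
      also have "\<dots> = ennreal (3900 * A + 32 * q)" using A0 q0 by (simp add: ennreal_mult)
      also have "\<dots> \<le> ennreal (4000 * q)" using Aq q0 by (intro ennreal_leI) simp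
      finally show ?thesis using W(3) by (rule order_trans[rotated])
    qed
    define R where "R = q powr (\<alpha> / 2)"
    have R0: "R > 0" using q0 by (simp add: R_def)
    have qR: "q \<le> R" unfolding R_def using q0 q(3) al powr_mono'[of "\<alpha> / 2" 1 q] by simp
    have RR: "q powr \<alpha> = R * R" unfolding R_def by (simp flip: powr_add)
    have rhs: "epowr (epowr e2 (1 / 2)) \<alpha> = ennreal R"
      using q q0 by (simp add: epowr_def R_def powr_powr mult.commute)
    have pt: "wTV c (Hhat X) H \<le> ennreal ((2 * K + 1000) * B * R) + ennreal (2 * K * B * R / q) * W X"
      if X: "X \<in> space (hier_model n c H)" for X
    proof -
      define D where "D = mixL2 (\<sigma>\<^sub>s c) (Hhat X) H"
      have D0: "D \<ge> 0" by (simp add: D_def mixL2_nonneg)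
      have DW: "ennreal D \<le> W X" unfolding D_def by (rule W(2)[OF np[OF X]])
      have G: "mixL2 c (Hhat X) H \<le> K * (R * R * (1 + D / q))"
      proof -
        have "mixL2 c (Hhat X) H \<le> K * (D + q) powr \<alpha>"
          unfolding K_def \<alpha>_def by (rule mixL2_deconvolution[OF HhP[OF X] H c]) (use q0 D0 in \<open>auto simp: D_def\<close>)
        also have "\<dots> \<le> K * (q powr \<alpha> * (1 + D / q))"
          using K by (intro mult_left_mono powr_add_le_linear q0 D0 al) auto
        finally show ?thesis by (simp only: RR)
      qed
      have B0: "B > 0" using B1 by simp
      have BB: "B * B = M * V" using M0 V2 by (simp add: B_def)
      have "wTV c (Hhat X) H \<le> ennreal (2 * (R / B * measure lborel (fatten M S) + mixL2 c (Hhat X) H / (R / B)))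
        + ennreal 4 * F + ennreal (256 * exp (- L))"
        unfolding F_def by (rule wTV_le_mixL2_plus_tail[OF HhP[OF X] H c L1 M_cutoff S p]) (use R0 B0 in simp)
      also have "\<dots> \<le> ennreal (4 * (B * R) + 2 * K * B * R * (1 + D / q)) + ennreal (6 * (B * R)) + ennreal (384 * (B * R))"
      proof (intro add_mono ennreal_leI)
        have "R / B * measure lborel (fatten M S) \<le> R / B * (2 * (B * B))"
          using VM R0 B0 unfolding BB by (intro mult_left_mono) auto
        also have "\<dots> = 2 * (B * R)" using B0 by simp
        finally have 1: "R / B * measure lborel (fatten M S) \<le> 2 * (B * R)" .
        have "mixL2 c (Hhat X) H / (R / B) \<le> K * (R * R * (1 + D / q)) / (R / B)"
          using R0 B0 by (intro divide_right_mono G) auto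
        also have "\<dots> = K * B * R * (1 + D / q)" using R0 B0 by simp
        finally have 2: "mixL2 c (Hhat X) H / (R / B) \<le> K * B * R * (1 + D / q)" .
        show "2 * (R / B * measure lborel (fatten M S) + mixL2 c (Hhat X) H / (R / B)) \<le> 4 * (B * R) + 2 * K * B * R * (1 + D / q)"
          using 1 2 by simp
        have RB: "1 * R \<le> B * R" using B1 R0 by (intro mult_right_mono) auto
        have qBR: "q \<le> B * R" using qR RB by simp
        show "ennreal 4 * F \<le> ennreal (6 * (B * R))"
        proof -
          have "ennreal 4 * F \<le> ennreal 6 * (ennreal L * F)"
          proof -
            have "ennreal 4 \<le> ennreal (6 * L)" using L1 by (intro ennreal_leI) simp
            also have "ennreal (6 * L) = ennreal 6 * ennreal L" using L1 by (intro ennreal_mult) auto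
            finally have "ennreal 4 \<le> ennreal 6 * ennreal L" .
            then have "ennreal 4 * F \<le> ennreal 6 * ennreal L * F" by (rule mult_right_mono) simp
            then show ?thesis by (simp only: mult.assoc)
          qed
          also have "\<dots> \<le> ennreal 6 * ennreal q" by (intro mult_left_mono LF) auto
          also have "\<dots> = ennreal (6 * q)" using q0 by (simp add: ennreal_mult)
          also have "\<dots> \<le> ennreal (6 * (B * R))" using qBR by (intro ennreal_leI) simp
          finally show ?thesis .
        qed
        have "2 / 3 * (1 / real n) \<le> L * (1 / real n)" using L1 by (intro mult_right_mono) auto
        then have "2 / 3 * exp (- L) \<le> q" using LA Aq unfolding expL by simp
        then show "256 * exp (- L) \<le> 384 * (B * R)" using qBR by linarith
      qed
      also have "\<dots> = ennreal (4 * (B * R) + 2 * K * B * R * (1 + D / q) + 6 * (B * R) + 384 * (B * R))"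
      proof -
        have "4 * (B * R) + 2 * K * B * R * (1 + D / q) \<ge> 0" "6 * (B * R) \<ge> 0" "384 * (B * R) \<ge> 0"
          using K B0 R0 D0 q0 by (auto intro!: add_nonneg_nonneg mult_nonneg_nonneg)
        then show ?thesis by (simp only: ennreal_plus add_nonneg_nonneg)
      qed
      also have "\<dots> \<le> ennreal ((2 * K + 1000) * B * R + 2 * K * B * R / q * D)"
      proof (rule ennreal_leI)
        have "2 * K * B * R * (1 + D / q) = 2 * K * B * R + 2 * K * B * R / q * D"
          using q0 by (simp add: distrib_left)
        moreover have "(2 * K + 1000) * B * R = 2 * K * B * R + 1000 * (B * R)" by (simp add: distrib_right)
        moreover have "B * R \<ge> 0" using B0 R0 by simp
        ultimately show "4 * (B * R) + 2 * K * B * R * (1 + D / q) + 6 * (B * R) + 384 * (B * R) \<le> (2 * K + 1000) * B * R + 2 * K * B * R / q * D"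
          by linarith
      qed
      also have "\<dots> = ennreal ((2 * K + 1000) * B * R) + ennreal (2 * K * B * R / q) * ennreal D"
        using K B0 R0 D0 q0 by (simp add: ennreal_plus ennreal_mult del: times_divide_eq_left times_divide_eq_right)
      also have "\<dots> \<le> ennreal ((2 * K + 1000) * B * R) + ennreal (2 * K * B * R / q) * W X"
        by (intro add_left_mono mult_left_mono DW) auto
      finally show ?thesis .
    qed
    have "(\<integral>\<^sup>+X. wTV c (Hhat X) H \<partial>hier_model n c H)
      \<le> (\<integral>\<^sup>+X. ennreal ((2 * K + 1000) * B * R) + ennreal (2 * K * B * R / q) * W X \<partial>hier_model n c H)"
      by (rule nn_integral_mono) (rule pt)
    also have "\<dots> = ennreal ((2 * K + 1000) * B * R) + ennreal (2 * K * B * R / q) * (\<integral>\<^sup>+X. W X \<partial>hier_model n c H)"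
      using W(1) prob_space.emeasure_space_1[OF hmP] by (subst nn_integral_add) (auto simp: nn_integral_cmult)
    also have "\<dots> \<le> ennreal ((2 * K + 1000) * B * R) + ennreal (2 * K * B * R / q) * ennreal (4000 * q)"
      by (intro add_left_mono mult_left_mono EW) auto
    also have "\<dots> = ennreal ((2 * K + 1000) * B * R + 8000 * K * B * R)"
    proof -
      have nn: "2 * K * B * R / q \<ge> 0" "(2 * K + 1000) * B * R \<ge> 0" "8000 * K * B * R \<ge> 0" using K B1 R0 q0 by auto
      have "ennreal (2 * K * B * R / q) * ennreal (4000 * q) = ennreal (2 * K * B * R / q * (4000 * q))"
        using nn(1) q0 by (intro ennreal_mult[symmetric]) auto
      also have "2 * K * B * R / q * (4000 * q) = 8000 * K * B * R" using q0 by simp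
      finally show ?thesis using nn by (simp only: ennreal_plus)
    qed
    also have "\<dots> \<le> ennreal ((8002 * K + 1000) * B * R)" by (intro ennreal_leI) (simp add: distrib_right)
    also have "\<dots> = ennreal ((8002 * K + 1000) * B) * epowr (epowr e2 (1 / 2)) \<alpha>"
      unfolding rhs using R0 by (simp add: ennreal_mult'')
    finally show ?thesis .
  qed
  then show ?thesis by (simp add: K_def B_def V_def \<alpha>_def e2_def eps_def)
qed

theorem theorem2p3:
  fixes c :: real
  assumes "c > 0"
  shows "\<exists>C::real. C > 0 \<and>
    (\<forall>H \<in> borel_probs. \<forall>(M :: nat \<Rightarrow> real) (S :: nat \<Rightarrow> real set)
        (Hhat :: nat \<Rightarrow> (nat \<Rightarrow> real) \<Rightarrow> real measure).
      (\<forall>n\<ge>2. M n \<ge> sqrt (10 * (\<sigma>\<^sub>s c)\<^sup>2 * ln (real n))) \<longrightarrow>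
      (\<forall>n\<ge>2. compact (S n) \<and> S n \<noteq> {}) \<longrightarrow>
      (\<forall>n\<ge>2. \<forall>X \<in> space (hier_model n c H). is_npmle n c X (Hhat n X)) \<longrightarrow>
      (\<lambda>n. eps c n (M n) (S n) H) \<longlonglongrightarrow> 0 \<longrightarrow>
      (\<forall>n\<ge>2. (\<integral>\<^sup>+ X. wTV c (Hhat n X) H \<partial>hier_model n c H)
        \<le> ennreal (C * sqrt (M n * measure lborel (fatten (\<sigma>\<^sub>s c) (S n))))
            * epowr (eps c n (M n) (S n) H) (\<alpha>\<^sub>s c)))"
proof (intro exI[of _ "8002 * (1 + 8 / c) + 1000"] conjI ballI allI impI)
  show "8002 * (1 + 8 / c) + 1000 > 0" using assms by (intro add_pos_pos mult_pos_pos) auto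
qed (rule npmle_wTV_bound[OF _ assms]; blast)

end
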